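(* Let $G$ be a given fixed graph with $v=v(G)$ vertices and $e=e(G)\ge1$ edges. Let $N\ge v$, $p\in(0,1)$, and let $K(N,p)$ be the Erdős–Rényi random graph with $N$ vertices, in which each pair of vertices is connected by an edge with probability $p$, independently of all else. Let $S$ be the number of copies (not necessarily induced) of $G$ in $K(N,p)$, let $W=(S-ES)/\sqrt{\mathrm{Var}(S)}$, and let $\gamma=EW^3$. Let $$\psi=\min_{H\subset G,\ e(H)>0}\{N^{v(H)}p^{e(H)}\}.$$ Let $C_0$ be any fixed positive constant. Then there is a constant $C(G)$ depending only on $C_0$ and $G$ such that for all $0\le x\le C_0\big[N^6(1-p)^{5/2}p^{5e}/\psi^{5/2}\big]^{1/2}$, $$\max\left\{\Big|\frac{P(W<-x)}{\Phi(-x)e^{-\gamma x^3/6}}-1\Big|,\ \Big|\frac{P(W>x)}{(1-\Phi(x))e^{\gamma x^3/6}}-1\Big|\right\}\le\frac{C(G)\,\psi^{5/2}}{(1-p)^{5/2}p^{5e}N^6}(1+x^2).$$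
   Context: For a graph $H$, $v(H)$ and $e(H)$ denote its numbers of vertices and edges. The minimum defining $\psi$ is over subgraphs $H$ of $G$ with at least one edge. $\Phi$ is the standard normal distribution function. *)

theory Defs
  imports "HOL-Probability.Probability" "HOL-Probability.Product_PMF"
begin

section \<open>Finite simple graphs\<close>

text \<open>A graph is a pair of a vertex set and a set of edges, an edge being a two-element
  set of vertices.\<close>

type_synonym 'a graph = "'a set \<times> 'a set set"

abbreviation verts :: "'a graph \<Rightarrow> 'a set" where
  "verts G \<equiv> fst G"

abbreviation edges :: "'a graph \<Rightarrow> 'a set set" where
  "edges G \<equiv> snd G"

definition all_pairs :: "'a set \<Rightarrow> 'a set set" where
  "all_pairs V = {e. e \<subseteq> V \<and> card e = 2}"

definition simple_graph :: "'a graph \<Rightarrow> bool" where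
  "simple_graph G \<longleftrightarrow> finite (verts G) \<and> edges G \<subseteq> all_pairs (verts G)"

definition num_verts :: "'a graph \<Rightarrow> nat" where
  "num_verts G = card (verts G)"

definition num_edges :: "'a graph \<Rightarrow> nat" where
  "num_edges G = card (edges G)"

definition subgraph :: "'a graph \<Rightarrow> 'a graph \<Rightarrow> bool" where
  "subgraph H G \<longleftrightarrow> simple_graph H \<and> verts H \<subseteq> verts G \<and> edges H \<subseteq> edges G"

definition graph_iso :: "'a graph \<Rightarrow> 'b graph \<Rightarrow> bool" where
  "graph_iso G H \<longleftrightarrow> (\<exists>f. bij_betw f (verts G) (verts H) \<and>
     (\<forall>u\<in>verts G. \<forall>w\<in>verts G. {u, w} \<in> edges G \<longleftrightarrow> {f u, f w} \<in> edges H))"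

text \<open>Copies are not necessarily induced, and are counted as subgraphs, not as embeddings.\<close>

definition num_copies :: "'a graph \<Rightarrow> 'b graph \<Rightarrow> nat" where
  "num_copies G K = card {H. subgraph H K \<and> graph_iso G H}"

definition psi :: "'a graph \<Rightarrow> nat \<Rightarrow> real \<Rightarrow> real" where
  "psi G N p = Min {real N ^ num_verts H * p ^ num_edges H | H. subgraph H G \<and> num_edges H > 0}"

section \<open>Subgraph counts in the random graph\<close>

definition erdos_renyi :: "nat \<Rightarrow> real \<Rightarrow> nat graph pmf" where
  "erdos_renyi N p =
     map_pmf (\<lambda>\<omega>. ({..<N}, {e \<in> all_pairs {..<N}. \<omega> e}))
       (Pi_pmf (all_pairs {..<N}) False (\<lambda>_. bernoulli_pmf p))"

definition copy_count :: "'a graph \<Rightarrow> nat graph \<Rightarrow> real" where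
  "copy_count G K = real (num_copies G K)"

definition std_count :: "'a graph \<Rightarrow> nat \<Rightarrow> real \<Rightarrow> nat graph \<Rightarrow> real" where
  "std_count G N p K =
     (copy_count G K - measure_pmf.expectation (erdos_renyi N p) (copy_count G)) /
     sqrt (measure_pmf.variance (erdos_renyi N p) (copy_count G))"

definition skewness :: "'a graph \<Rightarrow> nat \<Rightarrow> real \<Rightarrow> real" where
  "skewness G N p = measure_pmf.expectation (erdos_renyi N p) (\<lambda>K. std_count G N p K ^ 3)"

definition Phi :: "real \<Rightarrow> real" where
  "Phi x = cdf std_normal_distribution x"

end

theory Submission
  imports Defs "HOL-Complex_Analysis.Complex_Analysis" "HOL-Real_Asymp.Real_Asymp"
begin

text \<open>Write \<open>v\<close> for the number of vertices of \<open>G\<close> and \<open>\<sigma>\<close> for the standard deviation of the number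
  \<open>S\<close> of copies. Every potential edge lies in \<open>O(N ^ (v - 2))\<close> potential copies, so the moment generating
  function of \<open>S\<close> has no zeros in a disc of radius of order \<open>1 / N ^ (v - 2)\<close>: conditioning on the edges
  one at a time only ever multiplies it by factors close to \<open>1\<close>. There its logarithm is \<open>O(N\<^sup>2)\<close>. For the
  standardised count the disc has radius \<open>R\<close> of order \<open>\<sigma> / N ^ (v - 2)\<close>, and the variance bound
  \<open>\<sigma>\<^sup>2 \<ge> const * (1 - p) * N ^ (2 * v) * p ^ (2 * e) / \<psi>\<close> shows that \<open>N ^ 4 / R ^ 5\<close> is at most a
  constant times the claimed error \<open>\<delta>\<close>. Cauchy's estimates then bound the third and fourth derivatives of
  the cumulant generating function by \<open>O(\<delta>)\<close> and \<open>O(\<delta>\<^sup>2)\<close>. Exponential tilting by \<open>x\<close>, together with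
  Esseen's smoothing inequality for the tilted law, gives the tail asymptotics as in Cramer's theorem; large
  \<open>\<delta>\<close> is trivial because then \<open>x\<close> stays bounded.\<close>

section \<open>Zero-free generating functions of random subsets\<close>

text \<open>The radius of the disc is dictated by the number of copies through one edge, not by the
  number of all copies: each of the at most N^v copies then adds O(1 / N^(v - 2)) to the logarithm,
  whence N^2. For the standardised count only this bound M on the logarithm and the radius R
  survive, and everything is expressed by one parameter \<delta> \<ge> M^2 / R^5. Since the second
  cumulant is 1, Cauchy's estimate gives R^2 \<le> 8 * M, and so M / R^3 \<le> 8 * \<delta> and 1 /
  R \<le> 64 * \<delta>; this is how the third cumulant is O(\<delta>), the fourth O(\<delta>^2),
  and the disc has radius at least of order 1 / \<delta>. Inserting M ~ N^2 and R ~ \<sigma> / N^(v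
  - 2) gives N^(5 * v - 6) / \<sigma>^5, and the variance bound to the power 5/2 turns this into the
  claimed error; that is the origin of 5/2 and of N^6. The admissible range of x says exactly that
  x^2 * \<delta> stays bounded. Hence the fourth order remainder of the cumulant generating
  function, O(\<delta>^2 * x^4), is O(\<delta> * x^2), and only the cubic term is left over as exp
  (\<gamma> * x^3 / 6).\<close>

definition random_subset :: "'e set \<Rightarrow> real \<Rightarrow> 'e set pmf" where
  "random_subset E p = map_pmf (\<lambda>\<omega>. {e \<in> E. \<omega> e}) (Pi_pmf E False (\<lambda>_. bernoulli_pmf p))"

lemma set_random_subset: "set_pmf (random_subset E p) \<subseteq> Pow E"
  by (auto simp: random_subset_def)

lemma finite_set_random_subset: "finite E \<Longrightarrow> finite (set_pmf (random_subset E p))"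
  by (meson finite_Pow_iff finite_subset set_random_subset)

lemma random_subset_insert:
  assumes "finite E" "e \<notin> E"
  shows "random_subset (insert e E) p =
    bernoulli_pmf p \<bind> (\<lambda>b. map_pmf (\<lambda>A. if b then insert e A else A) (random_subset E p))"
  unfolding random_subset_def Pi_pmf_insert'[OF assms]
  using assms(2)
  by (auto simp: map_bind_pmf map_pmf_def[symmetric] bind_assoc_pmf bind_return_pmf pmf.map_comp o_def
      intro!: bind_pmf_cong map_pmf_cong split: if_splits)

lemma expectation_random_subset_insert:
  fixes g :: "'e set \<Rightarrow> 'b :: {banach, second_countable_topology}"
  assumes "finite E" "e \<notin> E" "0 \<le> p" "p \<le> 1"
  shows "measure_pmf.expectation (random_subset (insert e E) p) g =
    p *\<^sub>R measure_pmf.expectation (random_subset E p) (\<lambda>A. g (insert e A)) +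
    (1 - p) *\<^sub>R measure_pmf.expectation (random_subset E p) g"
  unfolding random_subset_insert[OF assms(1,2)]
  using assms by (subst pmf_expectation_bind[of UNIV])
    (auto simp: UNIV_bool finite_set_random_subset)

lemma expectation_random_subset_cong:
  fixes g h :: "'e set \<Rightarrow> 'b :: {banach, second_countable_topology}"
  assumes "\<And>A. A \<subseteq> E \<Longrightarrow> g A = h A"
  shows "measure_pmf.expectation (random_subset E p) g = measure_pmf.expectation (random_subset E p) h"
  by (intro integral_cong_AE) (use assms set_random_subset[of E p] in \<open>auto simp: AE_measure_pmf_iff\<close>)

lemma expectation_random_subset_member:
  fixes g :: "'e set \<Rightarrow> 'b :: {banach, second_countable_topology}"
  assumes "finite E" "e \<in> E" "0 \<le> p" "p \<le> 1"
  shows "measure_pmf.expectation (random_subset E p) (\<lambda>A. if e \<in> A then g A else 0) =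
    p *\<^sub>R measure_pmf.expectation (random_subset E p) (\<lambda>A. g (insert e A))"
proof -
  define F where "F = E - {e}"
  have F: "finite F" "e \<notin> F" "E = insert e F" using assms by (auto simp: F_def)
  have *: "measure_pmf.expectation (random_subset F p) (\<lambda>A. if e \<in> A then g A else 0) =
      measure_pmf.expectation (random_subset F p) (\<lambda>A. 0)"
    by (rule expectation_random_subset_cong) (use F in auto)
  show ?thesis
    by (simp add: F(3) expectation_random_subset_insert[OF F(1,2) assms(3,4)] *
        scaleR_left.add[symmetric])
qed

lemma expectation_random_subset_superset:
  fixes g :: "'e set \<Rightarrow> 'b :: {banach, second_countable_topology}"
  assumes "finite E" "J \<subseteq> E" "0 \<le> p" "p \<le> 1"
  shows "measure_pmf.expectation (random_subset E p) (\<lambda>A. if J \<subseteq> A then g A else 0) =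
    p ^ card J *\<^sub>R measure_pmf.expectation (random_subset E p) (\<lambda>A. g (J \<union> A))"
proof -
  have "finite J" using assms finite_subset by blast
  then show ?thesis using assms(2)
  proof (induction J arbitrary: g)
    case (insert e J)
    have "measure_pmf.expectation (random_subset E p) (\<lambda>A. if insert e J \<subseteq> A then g A else 0) =
        measure_pmf.expectation (random_subset E p)
          (\<lambda>A. if e \<in> A then (if J \<subseteq> A then g A else 0) else 0)"
      by (rule arg_cong[where f = "integral\<^sup>L _"]) auto
    also have "\<dots> = p *\<^sub>R measure_pmf.expectation (random_subset E p)
          (\<lambda>A. if J \<subseteq> insert e A then g (insert e A) else 0)"
      using insert.prems assms by (subst expectation_random_subset_member) auto
    also have "(\<lambda>A. if J \<subseteq> insert e A then g (insert e A) else 0) =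
       (\<lambda>A. if J \<subseteq> A then g (insert e A) else 0)"
      using insert.hyps(2) by (auto simp: fun_eq_iff)
    also have "measure_pmf.expectation (random_subset E p) \<dots> =
        p ^ card J *\<^sub>R measure_pmf.expectation (random_subset E p) (\<lambda>A. g (insert e (J \<union> A)))"
      using insert by auto
    finally show ?case using insert by simp
  qed simp
qed

lemma erdos_renyi_eq: "erdos_renyi N p = map_pmf (Pair {..<N}) (random_subset (all_pairs {..<N}) p)"
  by (simp add: erdos_renyi_def random_subset_def pmf.map_comp o_def)

text \<open>With \<open>\<epsilon> = exp z - 1\<close> this is the moment generating function of the
  number of \<open>c\<close> with \<open>I c\<close> inside the random set. The family is indexed by
  \<open>C\<close>, not a set of sets, because deleting elements can make different members equal
  and their multiplicity must be kept.\<close>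

definition fam_gf :: "'e set \<Rightarrow> real \<Rightarrow> complex \<Rightarrow> 'c set \<Rightarrow> ('c \<Rightarrow> 'e set) \<Rightarrow> complex" where
  "fam_gf E p \<epsilon> C I =
     measure_pmf.expectation (random_subset E p) (\<lambda>A. \<Prod>c\<in>C. 1 + (if I c \<subseteq> A then \<epsilon> else 0))"

text \<open>A hypergraph with edges of size at most \<open>d\<close> and degrees at most
  \<open>L\<close>; deleting members or elements preserves both bounds, so the class is closed under
  the recursions below.\<close>

definition bounded_family :: "'e set \<Rightarrow> nat \<Rightarrow> nat \<Rightarrow> 'c set \<Rightarrow> ('c \<Rightarrow> 'e set) \<Rightarrow> bool" where
  "bounded_family E d L C I \<longleftrightarrow> finite C \<and> (\<forall>c\<in>C. I c \<subseteq> E \<and> card (I c) \<le> d) \<and>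
     (\<forall>e. card {c \<in> C. e \<in> I c} \<le> L)"

lemma bounded_family_Diff:
  assumes "bounded_family E d L C I" "finite E"
  shows "bounded_family (E - J) d L C (\<lambda>c. I c - J)"
  unfolding bounded_family_def
proof (intro conjI ballI allI)
  show "finite C" using assms(1) by (auto simp: bounded_family_def)
  fix e
  have "card {c \<in> C. e \<in> I c - J} \<le> card {c \<in> C. e \<in> I c}"
    using \<open>finite C\<close> by (intro card_mono) auto
  then show "card {c \<in> C. e \<in> I c - J} \<le> L"
    using assms(1) by (auto simp: bounded_family_def intro: order_trans)
next
  fix c assume c: "c \<in> C"
  have "I c \<subseteq> E" "card (I c) \<le> d" using assms c by (auto simp: bounded_family_def)
  then show "I c - J \<subseteq> E - J" "card (I c - J) \<le> d"
    using card_mono[of "I c" "I c - J"] assms(2) finite_subset[of "I c" E] by auto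
qed

lemma bounded_family_mono:
  assumes "bounded_family E d L C I" "C' \<subseteq> C" "E \<subseteq> E'"
  shows "bounded_family E' d L C' I"
  unfolding bounded_family_def
proof (intro conjI ballI allI)
  have "finite C" using assms(1) by (auto simp: bounded_family_def)
  then show "finite C'" using assms(2) finite_subset by blast
  fix e
  have "card {c \<in> C'. e \<in> I c} \<le> card {c \<in> C. e \<in> I c}"
    using \<open>finite C\<close> assms(2) by (intro card_mono) auto
  then show "card {c \<in> C'. e \<in> I c} \<le> L"
    using assms(1) by (auto simp: bounded_family_def intro: order_trans)
qed (use assms in \<open>auto simp: bounded_family_def\<close>)

text \<open>The new factor is 1 plus \<open>\<epsilon>\<close> times the indicator of
  \<open>I c \<subseteq> A\<close>; on that event the remaining members only need their elements
  outside \<open>I c\<close>.\<close>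

lemma fam_gf_insert:
  assumes "finite E" "finite C" "c \<notin> C" "I c \<subseteq> E" "0 \<le> p" "p \<le> 1"
  shows "fam_gf E p \<epsilon> (insert c C) I =
     fam_gf E p \<epsilon> C I + \<epsilon> * of_real p ^ card (I c) * fam_gf E p \<epsilon> C (\<lambda>c'. I c' - I c)"
proof -
  let ?g = "\<lambda>I A. \<Prod>c\<in>C. 1 + (if I c \<subseteq> A then \<epsilon> else 0)"
  let ?M = "measure_pmf (random_subset E p)"
  have int: "integrable ?M f" for f :: "_ \<Rightarrow> complex"
    by (simp add: integrable_measure_pmf_finite finite_set_random_subset assms)
  have "fam_gf E p \<epsilon> (insert c C) I = (\<integral>A. ?g I A + \<epsilon> * (if I c \<subseteq> A then ?g I A else 0) \<partial>?M)"
    unfolding fam_gf_def using assms by (intro Bochner_Integration.integral_cong) (auto simp: algebra_simps)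
  also have "\<dots> = fam_gf E p \<epsilon> C I + \<epsilon> * (\<integral>A. (if I c \<subseteq> A then ?g I A else 0) \<partial>?M)"
    unfolding fam_gf_def using int by (subst Bochner_Integration.integral_add) auto
  also have "(\<integral>A. (if I c \<subseteq> A then ?g I A else 0) \<partial>?M) = p ^ card (I c) *\<^sub>R (\<integral>A. ?g I (I c \<union> A) \<partial>?M)"
    using assms by (intro expectation_random_subset_superset) auto
  also have "(\<lambda>A. ?g I (I c \<union> A)) = ?g (\<lambda>c'. I c' - I c)"
    by (intro ext prod.cong) (auto intro!: arg_cong[where f = "\<lambda>x. 1 + x"])
  finally show ?thesis by (simp add: fam_gf_def scaleR_conv_of_real)
qed

lemma fam_gf_irrelevant:
  assumes "finite E" "e \<notin> E" "\<And>c. c \<in> C \<Longrightarrow> e \<notin> I c" "0 \<le> p" "p \<le> 1"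
  shows "fam_gf (insert e E) p \<epsilon> C I = fam_gf E p \<epsilon> C I"
proof -
  have *: "(\<Prod>c\<in>C. 1 + (if I c \<subseteq> insert e A then \<epsilon> else 0)) = (\<Prod>c\<in>C. 1 + (if I c \<subseteq> A then \<epsilon> else 0))" for A
    using assms(3) by (intro prod.cong refl) (auto simp: subset_insert)
  show ?thesis
    unfolding fam_gf_def expectation_random_subset_insert[OF assms(1,2,4,5)] *
    by (simp add: scaleR_left.add[symmetric])
qed

text \<open>If \<open>e\<close> is present, each member loses \<open>e\<close>; if \<open>e\<close>
  is absent, the members containing \<open>e\<close> contribute the factor 1 and drop out. The two
  terms thus differ by the members through \<open>e\<close>, whose number is what \<open>L\<close>
  bounds.\<close>

lemma fam_gf_split:
  assumes "finite E" "e \<notin> E" "finite C" "0 \<le> p" "p \<le> 1"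
  shows "fam_gf (insert e E) p \<epsilon> C I = of_real p * fam_gf E p \<epsilon> C (\<lambda>c. I c - {e}) +
     of_real (1 - p) * fam_gf E p \<epsilon> {c \<in> C. e \<notin> I c} (\<lambda>c. I c - {e})"
proof -
  have *: "(\<Prod>c\<in>C. 1 + (if I c \<subseteq> insert e A then \<epsilon> else 0)) =
      (\<Prod>c\<in>C. 1 + (if I c - {e} \<subseteq> A then \<epsilon> else 0))" for A
    by (intro prod.cong refl) (auto simp: subset_insert_iff)
  have **: "(\<integral>A. (\<Prod>c\<in>C. 1 + (if I c \<subseteq> A then \<epsilon> else 0)) \<partial>measure_pmf (random_subset E p)) =
     fam_gf E p \<epsilon> {c \<in> C. e \<notin> I c} (\<lambda>c. I c - {e})"
    unfolding fam_gf_def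
  proof (rule expectation_random_subset_cong)
    fix A assume "A \<subseteq> E"
    then have "e \<notin> A" using assms by auto
    then show "(\<Prod>c\<in>C. 1 + (if I c \<subseteq> A then \<epsilon> else 0)) =
       (\<Prod>c\<in>{c \<in> C. e \<notin> I c}. 1 + (if I c - {e} \<subseteq> A then \<epsilon> else 0))"
      using assms(3) by (intro prod.mono_neutral_cong_right) auto
  qed
  show ?thesis
    unfolding fam_gf_def expectation_random_subset_insert[OF assms(1,2,4,5)] *
    unfolding ** unfolding fam_gf_def by (simp add: scaleR_conv_of_real)
qed

text \<open>The bound 4/3 closes the induction: it makes the two conditional values differ by at
  most a third of one of them, which yields the factor 2 in \<open>zero_free\<close>. The
  \<open>2 ^ d\<close> is that factor once for each element of a member.\<close>

locale small_perturbation =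
  fixes p :: real and \<epsilon> :: complex and d L :: nat
  assumes p: "0 \<le> p" "p \<le> 1" and \<epsilon>: "norm \<epsilon> < 1" and small: "(1 + norm \<epsilon> * 2 ^ d) ^ L \<le> 4 / 3"
begin

text \<open>Nonvanishing alone is not inductive: adding a member requires comparing the family with
  the one from which the elements of that member are deleted. The second clause controls this, one
  element at a time.\<close>

definition zero_free :: "'e set \<Rightarrow> 'c set \<Rightarrow> ('c \<Rightarrow> 'e set) \<Rightarrow> bool" where
  "zero_free E C I \<longleftrightarrow> fam_gf E p \<epsilon> C I \<noteq> 0 \<and>
     (\<forall>e\<in>E. norm (fam_gf E p \<epsilon> C (\<lambda>c. I c - {e})) \<le> 2 * norm (fam_gf E p \<epsilon> C I))"

context
  fixes E :: "'e set"
  assumes fin: "finite E"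
    and IH: "\<And>(C :: 'c set) I. bounded_family E d L C I \<Longrightarrow> zero_free E C I"
begin

lemma norm_fam_gf_Diff_le:
  fixes C :: "'c set"
  assumes "bounded_family E d L C I" "finite J" "J \<subseteq> E"
  shows "norm (fam_gf E p \<epsilon> C (\<lambda>c. I c - J)) \<le> 2 ^ card J * norm (fam_gf E p \<epsilon> C I)"
  using assms(2,3)
proof (induction J)
  case (insert e J)
  have "bounded_family E d L C (\<lambda>c. I c - J)"
    using bounded_family_mono[OF bounded_family_Diff[OF assms(1) fin, of J]] by auto
  then have "norm (fam_gf E p \<epsilon> C (\<lambda>c. I c - J - {e})) \<le> 2 * norm (fam_gf E p \<epsilon> C (\<lambda>c. I c - J))"
    using IH insert.prems by (auto simp: zero_free_def)
  also have "\<dots> \<le> 2 * (2 ^ card J * norm (fam_gf E p \<epsilon> C I))"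
    using insert by auto
  also have "(\<lambda>c. I c - J - {e}) = (\<lambda>c. I c - insert e J)" by auto
  finally show ?case using insert by simp
qed simp

text \<open>By \<open>fam_gf_insert\<close> the new term is \<open>\<epsilon>\<close> times a power
  of \<open>p\<close> times a value for the shrunken family, which is at most \<open>2 ^ d\<close>
  times the old value.\<close>

lemma norm_fam_gf_insert_le:
  fixes C :: "'c set"
  assumes "bounded_family E d L (insert c C) I" "c \<notin> C"
  shows "norm (fam_gf E p \<epsilon> (insert c C) I / fam_gf E p \<epsilon> C I - 1) \<le> norm \<epsilon> * 2 ^ d"
proof -
  have bf: "bounded_family E d L C I" using assms(1) by (rule bounded_family_mono) auto
  have nz: "fam_gf E p \<epsilon> C I \<noteq> 0" using IH[OF bf] by (simp add: zero_free_def)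
  have c: "finite C" "I c \<subseteq> E" "card (I c) \<le> d" using assms(1) by (auto simp: bounded_family_def)
  have fI: "finite (I c)" using c fin finite_subset by blast
  have "norm (fam_gf E p \<epsilon> (insert c C) I / fam_gf E p \<epsilon> C I - 1) =
     norm \<epsilon> * p ^ card (I c) * norm (fam_gf E p \<epsilon> C (\<lambda>c'. I c' - I c)) / norm (fam_gf E p \<epsilon> C I)"
    using nz p by (simp add: fam_gf_insert[where I = I, OF fin c(1) assms(2) c(2) p] diff_divide_distrib add_divide_distrib
       norm_mult norm_divide norm_power)
  also have "\<dots> \<le> norm \<epsilon> * 1 * (2 ^ card (I c) * norm (fam_gf E p \<epsilon> C I)) / norm (fam_gf E p \<epsilon> C I)"
    using p norm_fam_gf_Diff_le[OF bf fI c(2)]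
    by (intro divide_right_mono mult_mono mult_left_mono) (auto simp: power_le_one)
  also have "\<dots> = norm \<epsilon> * 2 ^ card (I c)" using nz by simp
  also have "\<dots> \<le> norm \<epsilon> * 2 ^ d" using c by (intro mult_left_mono power_increasing) auto
  finally show ?thesis .
qed

lemma norm_fam_gf_Un_le:
  fixes C :: "'c set"
  assumes "bounded_family E d L (C \<union> D) I" "C \<inter> D = {}"
  shows "norm (fam_gf E p \<epsilon> (C \<union> D) I / fam_gf E p \<epsilon> C I - 1) \<le> (1 + norm \<epsilon> * 2 ^ d) ^ card D - 1"
proof -
  have "finite D" using assms(1) by (auto simp: bounded_family_def)
  then show ?thesis using assms
  proof (induction D)
    case empty
    then have "fam_gf E p \<epsilon> C I \<noteq> 0" using IH[of C I] by (auto simp: zero_free_def)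
    then show ?case by simp
  next
    case (insert c D)
    let ?\<eta> = "norm \<epsilon> * 2 ^ d"
    let ?r = "fam_gf E p \<epsilon> (C \<union> D) I / fam_gf E p \<epsilon> C I"
    let ?s = "fam_gf E p \<epsilon> (insert c (C \<union> D)) I / fam_gf E p \<epsilon> (C \<union> D) I"
    have bf: "bounded_family E d L (C \<union> D) I" by (rule bounded_family_mono[OF insert.prems(1)]) auto
    have r: "norm (?r - 1) \<le> (1 + ?\<eta>) ^ card D - 1" using insert bf by auto
    have s: "norm (?s - 1) \<le> ?\<eta>"
      by (rule norm_fam_gf_insert_le) (use insert in auto)
    have "fam_gf E p \<epsilon> (C \<union> D) I \<noteq> 0" using IH[OF bf] by (simp add: zero_free_def)
    then have "fam_gf E p \<epsilon> (C \<union> insert c D) I / fam_gf E p \<epsilon> C I - 1 = (?r - 1) * ?s + (?s - 1)"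
      by (simp add: field_simps)
    also have "norm \<dots> \<le> norm (?r - 1) * norm ?s + norm (?s - 1)"
      using norm_triangle_ineq[of "(?r - 1) * ?s" "?s - 1"] by (simp only: norm_mult)
    also have "\<dots> \<le> ((1 + ?\<eta>) ^ card D - 1) * (1 + ?\<eta>) + ?\<eta>"
    proof (intro add_mono mult_mono r s)
      show "norm ?s \<le> 1 + ?\<eta>" using norm_triangle_ineq[of 1 "?s - 1"] s by simp
      show "0 \<le> (1 + ?\<eta>) ^ card D - 1" by simp
    qed auto
    also have "\<dots> = (1 + ?\<eta>) ^ card (insert c D) - 1" using insert by (simp add: algebra_simps)
    finally show ?case .
  qed
qed

end

text \<open>Conditioning on one element \<open>e\<close> writes the generating function as a convex combination of two
  values whose quotient, by the induction hypothesis applied to the at most \<open>L\<close> members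
  containing \<open>e\<close>, is within \<open>1/3\<close> of \<open>1\<close>.\<close>

lemma zero_free_bounded_family:
  fixes C :: "'c set"
  assumes "finite E" "bounded_family E d L C I"
  shows "zero_free E C I"
  using assms
proof (induction "card E" arbitrary: E C I)
  case 0
  then have "E = {}" by auto
  \<comment> \<open>Without elements all members are empty, so every factor is
    \<open>1 + \<epsilon>\<close>.\<close>
  have "1 + \<epsilon> \<noteq> 0" using \<epsilon> by (metis add_eq_0_iff norm_minus_cancel norm_one less_irrefl)
  moreover have "fam_gf E p \<epsilon> C I = (\<Prod>c\<in>C. 1 + \<epsilon>)"
    using 0 \<open>E = {}\<close> by (auto simp: fam_gf_def random_subset_def bounded_family_def intro!: prod.cong)
  ultimately show ?case using \<open>E = {}\<close> by (simp add: zero_free_def)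
next
  case (Suc n)
  have "\<forall>e\<in>E. fam_gf E p \<epsilon> C I \<noteq> 0 \<and> norm (fam_gf E p \<epsilon> C (\<lambda>c. I c - {e})) \<le> 2 * norm (fam_gf E p \<epsilon> C I)"
  proof
    fix e assume "e \<in> E"
    define F where "F = E - {e}"
    have F: "finite F" "e \<notin> F" "E = insert e F" "n = card F"
      using Suc \<open>e \<in> E\<close> by (auto simp: F_def)
    have IH: "zero_free F C' I'" if "bounded_family F d L C' I'" for C' :: "'c set" and I'
      using Suc.hyps(1)[OF F(4) F(1) that] .
    let ?I = "\<lambda>c. I c - {e}"
    define C0 C1 where "C0 = {c \<in> C. e \<notin> I c}" and "C1 = {c \<in> C. e \<in> I c}"
    have C: "C = C0 \<union> C1" "C0 \<inter> C1 = {}" "card C1 \<le> L" "finite C"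
      using Suc.prems by (auto simp: C0_def C1_def bounded_family_def)
    have bf: "bounded_family F d L C ?I"
      using bounded_family_Diff[OF Suc.prems(2,1), of "{e}"] by (simp add: F_def)
    have bf0: "bounded_family F d L C0 ?I"
      by (rule bounded_family_mono[OF bf]) (auto simp: C0_def)
    define a b where "a = fam_gf F p \<epsilon> C ?I" and "b = fam_gf F p \<epsilon> C0 ?I"
    have "b \<noteq> 0" "a \<noteq> 0" using IH[OF bf] IH[OF bf0] by (auto simp: zero_free_def a_def b_def)
    have "norm (a / b - 1) \<le> (1 + norm \<epsilon> * 2 ^ d) ^ card C1 - 1"
      using norm_fam_gf_Un_le[OF F(1) IH, of C0 C1 ?I] bf C by (simp add: a_def b_def)
    also have "\<dots> \<le> (1 + norm \<epsilon> * 2 ^ d) ^ L - 1"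
      using C by (intro diff_right_mono power_increasing) auto
    also have "\<dots> \<le> 1 / 3" using small by simp
    finally have "norm ((a / b - 1) * b) \<le> 1 / 3 * norm b"
      unfolding norm_mult by (intro mult_right_mono) auto
    then have ab: "norm (a - b) \<le> norm b / 3" using \<open>b \<noteq> 0\<close> by (simp add: algebra_simps)
    \<comment> \<open>The triangle inequality turns a third of \<open>norm b\<close> into half of
      \<open>norm a\<close>, so the convex combination of \<open>a\<close> and \<open>b\<close>
      keeps at least half of \<open>norm a\<close>.\<close>
    have "norm b \<le> norm a + norm (a - b)" using norm_triangle_ineq4[of a "a - b"] by simp
    then have ba: "norm (b - a) \<le> norm a / 2" using ab by (simp add: norm_minus_commute)
    have eq: "fam_gf E p \<epsilon> C I = a + of_real (1 - p) * (b - a)"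
      unfolding F(3) fam_gf_split[OF F(1,2) C(4) p] a_def b_def C0_def by (simp add: algebra_simps)
    have "norm (of_real (1 - p) * (b - a)) \<le> 1 * (norm a / 2)"
      unfolding norm_mult using p ba by (intro mult_mono) (auto simp: norm_of_real simp del: of_real_diff)
    then have "norm a / 2 \<le> norm (fam_gf E p \<epsilon> C I)"
      unfolding eq using norm_diff_ineq[of a "of_real (1 - p) * (b - a)"] by simp
    \<comment> \<open>With \<open>e\<close> deleted from all members the choice of \<open>e\<close>
      no longer matters, so this family over \<open>E\<close> has the value
      \<open>a\<close>.\<close>
    moreover have "fam_gf E p \<epsilon> C ?I = a"
      unfolding F(3) a_def by (intro fam_gf_irrelevant F p) auto
    ultimately show "fam_gf E p \<epsilon> C I \<noteq> 0 \<and> norm (fam_gf E p \<epsilon> C ?I) \<le> 2 * norm (fam_gf E p \<epsilon> C I)"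
      using \<open>a \<noteq> 0\<close> by auto
  qed
  \<comment> \<open>The claim was shown for each \<open>e\<close>; nonvanishing follows only because
    some \<open>e\<close> exists.\<close>
  moreover have "E \<noteq> {}" using Suc.hyps(2) by auto
  ultimately show ?case by (auto simp: zero_free_def)
qed

end


section \<open>A holomorphic logarithm of the generating function\<close>

lemma holomorphic_fam_gf:
  assumes "finite E"
  shows "(\<lambda>z. fam_gf E p (exp z - 1) C I) holomorphic_on S"
proof -
  have "fam_gf E p \<epsilon> C I =
     (\<Sum>A\<in>Pow E. pmf (random_subset E p) A *\<^sub>R (\<Prod>c\<in>C. 1 + (if I c \<subseteq> A then \<epsilon> else 0)))" for \<epsilon>
    unfolding fam_gf_def using assms set_random_subset[of E p] by (intro integral_measure_pmf) auto
  moreover have "(\<lambda>z. if b then exp z - 1 else 0 :: complex) holomorphic_on S" for b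
    by (cases b) (auto intro!: holomorphic_intros)
  ultimately show ?thesis by (auto intro!: holomorphic_intros simp: scaleR_conv_of_real)
qed

lemma fam_gf_exp:
  assumes "finite C"
  shows "fam_gf E p (exp z - 1) C I =
     measure_pmf.expectation (random_subset E p) (\<lambda>A. exp (z * of_nat (card {c \<in> C. I c \<subseteq> A})))"
proof -
  have "(\<Prod>c\<in>C. 1 + (if I c \<subseteq> A then exp z - 1 else 0)) = exp (z * of_nat (card {c \<in> C. I c \<subseteq> A}))" for A
  proof -
    have "(\<Prod>c\<in>C. 1 + (if I c \<subseteq> A then exp z - 1 else 0)) = (\<Prod>c\<in>C. if I c \<subseteq> A then exp z else 1)"
      by (intro prod.cong) auto
    also have "\<dots> = (\<Prod>c\<in>{c \<in> C. I c \<subseteq> A}. exp z)"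
      using assms by (rule prod.inter_filter[symmetric])
    finally show ?thesis by (simp add: exp_of_nat_mult[symmetric] mult.commute)
  qed
  then show ?thesis by (simp add: fam_gf_def)
qed

text \<open>The members are added one by one and the principal logarithms of the successive
  quotients are summed. Each quotient is within 1/2 of 1, so it stays in the right half plane and no
  branch cut is met, and each logarithm is at most twice the distance of the quotient from
  1.\<close>

lemma fam_gf_logarithm:
  fixes C :: "'c set"
  assumes "finite E" "bounded_family E d L C I" "0 \<le> p" "p \<le> 1"
    and r: "\<And>z :: complex. norm z < r \<Longrightarrow> norm (exp z - 1) * 2 ^ d < 1 / 2"
      "\<And>z :: complex. norm z < r \<Longrightarrow> (1 + norm (exp z - 1) * 2 ^ d) ^ L \<le> 4 / 3"
  shows "\<exists>K. K holomorphic_on ball 0 r \<and> (\<forall>z\<in>ball 0 r. exp (K z) = fam_gf E p (exp z - 1) C I \<and>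
     norm (K z) \<le> real (card C) * (2 * (norm (exp z - 1) * 2 ^ d)))"
proof -
  have sp: "small_perturbation p (exp z - 1) d L" if "norm z < r" for z
  proof
    have "norm (exp z - 1) * 1 \<le> norm (exp z - 1) * 2 ^ d" by (intro mult_left_mono) auto
    then show "norm (exp z - 1) < 1" using r(1)[OF that] by linarith
  qed (use assms r(2)[OF that] in auto)
  have "finite C" using assms(2) by (simp add: bounded_family_def)
  then show ?thesis using assms(2)
  proof (induction C)
    case empty
    show ?case by (intro exI[of _ "\<lambda>_. 0"]) (auto simp: fam_gf_def)
  next
    case (insert c C)
    have bf: "bounded_family E d L C I" by (rule bounded_family_mono[OF insert.prems]) auto
    then obtain K where K: "K holomorphic_on ball 0 r"
      "\<And>z. z \<in> ball 0 r \<Longrightarrow> exp (K z) = fam_gf E p (exp z - 1) C I"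
      "\<And>z. z \<in> ball 0 r \<Longrightarrow> norm (K z) \<le> real (card C) * (2 * (norm (exp z - 1) * 2 ^ d))"
      using insert.IH by blast
    define q where "q z = fam_gf E p (exp z - 1) (insert c C) I / fam_gf E p (exp z - 1) C I" for z
    have nz: "fam_gf E p (exp z - 1) C I \<noteq> 0" if "z \<in> ball 0 r" for z
      using K(2)[OF that] by (metis exp_not_eq_zero)
    have q: "norm (q z - 1) \<le> norm (exp z - 1) * 2 ^ d" if "z \<in> ball 0 r" for z
    proof -
      interpret small_perturbation p "exp z - 1" d L using sp that by simp
      show ?thesis unfolding q_def
        by (intro norm_fam_gf_insert_le assms zero_free_bounded_family insert)
    qed
    have q2: "norm (q z - 1) < 1 / 2" if "z \<in> ball 0 r" for z
      using q[OF that] r(1)[of z] that by simp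
    have qpos: "0 < Re (q z)" if "z \<in> ball 0 r" for z
      using q2[OF that] abs_Re_le_cmod[of "q z - 1"] by auto
    have qhol: "q holomorphic_on ball 0 r"
      unfolding q_def by (intro holomorphic_intros holomorphic_fam_gf assms nz)
    show ?case
    proof (intro exI[of _ "\<lambda>z. K z + Ln (q z)"] conjI ballI)
      show "(\<lambda>z. K z + Ln (q z)) holomorphic_on ball 0 r"
        using qpos by (intro holomorphic_intros K qhol) (auto simp: complex_nonpos_Reals_iff, fastforce)
    next
      fix z assume z: "z \<in> ball (0 :: complex) r"
      have "q z \<noteq> 0" using qpos[OF z] by auto
      then show "exp (K z + Ln (q z)) = fam_gf E p (exp z - 1) (insert c C) I"
        using K(2)[OF z] nz[OF z] by (simp add: exp_add q_def)
      have "norm (Ln (q z)) \<le> 2 * (norm (exp z - 1) * 2 ^ d)"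
        using norm_Ln_le[OF q2[OF z]] q[OF z] by simp
      then show "norm (K z + Ln (q z)) \<le> real (card (insert c C)) * (2 * (norm (exp z - 1) * 2 ^ d))"
        using K(3)[OF z] norm_triangle_ineq[of "K z" "Ln (q z)"] insert.hyps by (simp add: algebra_simps)
    qed
  qed
qed

section \<open>Esseen's smoothing inequality\<close>

lemma (in real_distribution) borel_measurable_cdf: "cdf M \<in> borel_measurable borel"
  by (intro borel_measurable_mono monoI cdf_nondecreasing)

text \<open>A distribution function is not integrable; subtracting the step of the point mass at 0
  makes it so when the mean is finite. For the point mass at \<open>v\<close> the difference is up
  to sign the indicator of the interval between 0 and \<open>v\<close>, and Fubini averages this
  over \<open>v\<close>.\<close>

lemma (in real_distribution) fourier_cdf_minus_step:
  fixes u :: real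
  assumes int: "integrable M (\<lambda>x. x)" and u: "u \<noteq> 0"
  defines "s \<equiv> \<lambda>w :: real. if 0 \<le> w then 1 else 0"
  shows "integrable lborel (\<lambda>w. cdf M w - s w)"
    and "(CLINT w|lborel. of_real (cdf M w - s w) * iexp (u * w)) = \<i> * (char M u - 1) / of_real u"
proof -
  interpret P: pair_sigma_finite M lborel ..
  define \<phi> :: "real \<Rightarrow> real \<Rightarrow> real" where "\<phi> v w = (if v \<le> w then 1 else 0) - s w" for v w
  have [measurable]: "case_prod \<phi> \<in> borel_measurable (M \<Otimes>\<^sub>M lborel)"
    unfolding \<phi>_def s_def by measurable
  have \<phi>_eq: "AE w in lborel. \<phi> v w = - sgn v * indicator {min 0 v..max 0 v} w" for v
    using AE_lborel_singleton[of v] AE_lborel_singleton[of 0]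
    by eventually_elim (auto simp: \<phi>_def s_def indicator_def sgn_if)
  have abs_eq: "(\<integral>w. norm (\<phi> v w) \<partial>lborel) = \<bar>v\<bar>" for v
  proof -
    have "(\<integral>w. norm (\<phi> v w) \<partial>lborel) = (\<integral>w. indicator {min 0 v..max 0 v} w \<partial>lborel)"
    proof (rule integral_cong_AE)
      show "AE w in lborel. norm (\<phi> v w) = indicator {min 0 v..max 0 v} w"
        using \<phi>_eq[of v] AE_lborel_singleton[of 0]
        by eventually_elim (auto simp: indicator_def sgn_if abs_mult split: if_splits)
    qed (auto simp: \<phi>_def s_def)
    then show ?thesis by (simp add: min_def max_def abs_if)
  qed
  have \<phi>_int: "integrable lborel (\<phi> v)" for v
  proof -
    have "integrable lborel (\<lambda>w. - sgn v * indicator {min 0 v..max 0 v} w)" by simp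
    then show ?thesis using \<phi>_eq[of v]
      by (subst integrable_cong_AE[OF _ _ \<phi>_eq]) (auto simp: \<phi>_def s_def)
  qed
  have prod: "integrable (M \<Otimes>\<^sub>M lborel) (case_prod \<phi>)"
  proof (rule P.Fubini_integrable)
    show "integrable M (\<lambda>v. \<integral>w. norm (case (v, w) of (v, w) \<Rightarrow> \<phi> v w) \<partial>lborel)"
      unfolding prod.case abs_eq using int by (rule integrable_abs)
  qed (use \<phi>_int in simp_all)
  have mg: "(\<integral>v. \<phi> v w \<partial>M) = cdf M w - s w" for w
  proof -
    have "\<phi> v w = indicator {..w} v - s w" for v by (auto simp: indicator_def \<phi>_def)
    moreover have "integrable M (indicator {..w} :: real \<Rightarrow> real)"
      by (intro integrable_const_bound[of _ 1]) (auto simp: indicator_def)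
    ultimately show ?thesis using prob_space by (simp add: cdf_def)
  qed
  show "integrable lborel (\<lambda>w. cdf M w - s w)"
    using P.integrable_snd[OF prod] by (simp add: mg)
  have prod': "integrable (M \<Otimes>\<^sub>M lborel) (\<lambda>(v, w). of_real (\<phi> v w) * iexp (u * w))"
    by (rule Bochner_Integration.integrable_bound[OF prod]) (auto simp: norm_mult)
  have inner: "(CLINT w|lborel. of_real (\<phi> v w) * iexp (u * w)) = \<i> * (iexp (u * v) - 1) / of_real u" for v
  proof -
    have F: "((\<lambda>w. iexp (u * w) / (\<i> * u)) has_vector_derivative iexp (u * x)) (at x within S)" for x S
      using u by (auto intro!: derivative_eq_intros has_vector_derivative_real_field simp: field_simps)
    have "(CLINT w|lborel. of_real (\<phi> v w) * iexp (u * w)) =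
        (CLINT w|lborel. of_real (- sgn v) * (indicator {min 0 v..max 0 v} w *\<^sub>R iexp (u * w)))"
    proof (rule integral_cong_AE)
      show "AE w in lborel. of_real (\<phi> v w) * iexp (u * w) =
          of_real (- sgn v) * (indicator {min 0 v..max 0 v} w *\<^sub>R iexp (u * w))"
        using \<phi>_eq[of v] by eventually_elim (auto simp: scaleR_conv_of_real)
    qed (auto simp: \<phi>_def s_def)
    also have "\<dots> = of_real (- sgn v) * (iexp (u * max 0 v) / (\<i> * u) - iexp (u * min 0 v) / (\<i> * u))"
      by (subst integral_mult_right_zero, subst integral_FTC_Icc[OF _ F]) (auto intro!: continuous_intros)
    also have "\<dots> = \<i> * (iexp (u * v) - 1) / of_real u"
      using u by (auto simp: sgn_if max_def min_def field_simps)
    finally show ?thesis .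
  qed
  have "(CLINT w|lborel. of_real (cdf M w - s w) * iexp (u * w)) =
      (CLINT w|lborel. CLINT v|M. of_real (\<phi> v w) * iexp (u * w))"
    unfolding mg[symmetric] by (intro Bochner_Integration.integral_cong refl) simp
  also have "\<dots> = (CLINT v|M. CLINT w|lborel. of_real (\<phi> v w) * iexp (u * w))"
    by (rule P.Fubini_integral[OF prod'])
  also have "\<dots> = (CLINT v|M. \<i> * (iexp (u * v) - 1) / of_real u)"
    by (simp only: inner)
  also have "\<dots> = \<i> * (char M u - 1) / of_real u"
    using prob_space by (simp add: char_def integrable_iexp)
  finally show "(CLINT w|lborel. of_real (cdf M w - s w) * iexp (u * w)) = \<i> * (char M u - 1) / of_real u" .
qed

lemma
  fixes M1 M2 :: "real measure" and u :: real
  assumes "real_distribution M1" "real_distribution M2"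
    and "integrable M1 (\<lambda>x. x)" "integrable M2 (\<lambda>x. x)"
  shows integrable_cdf_diff: "integrable lborel (\<lambda>w. cdf M1 w - cdf M2 w)"
    and fourier_cdf_diff: "u \<noteq> 0 \<Longrightarrow> (CLINT w|lborel. of_real (cdf M1 w - cdf M2 w) * iexp (u * w)) =
      \<i> * (char M1 u - char M2 u) / of_real u"
proof -
  interpret M1: real_distribution M1 by fact
  interpret M2: real_distribution M2 by fact
  define s :: "real \<Rightarrow> real" where "s w = (if 0 \<le> w then 1 else 0)" for w
  have i: "integrable lborel (\<lambda>w. cdf M1 w - s w)" "integrable lborel (\<lambda>w. cdf M2 w - s w)"
    using M1.fourier_cdf_minus_step(1)[of 1] M2.fourier_cdf_minus_step(1)[of 1] assms
    by (simp_all add: s_def)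
  have eq: "cdf M1 w - cdf M2 w = (cdf M1 w - s w) - (cdf M2 w - s w)" for w by simp
  show "integrable lborel (\<lambda>w. cdf M1 w - cdf M2 w)"
    unfolding eq by (intro Bochner_Integration.integrable_diff i)
  have i': "integrable lborel (\<lambda>w. of_real (cdf N w - s w) * iexp (u * w))"
    if "integrable lborel (\<lambda>w. cdf N w - s w)" and [measurable]: "cdf N \<in> borel_measurable borel" for N
    by (rule Bochner_Integration.integrable_bound[OF that(1)]) (auto simp: norm_mult s_def)
  assume u: "u \<noteq> 0"
  have "(CLINT w|lborel. of_real (cdf M1 w - cdf M2 w) * iexp (u * w)) =
     (CLINT w|lborel. of_real (cdf M1 w - s w) * iexp (u * w) - of_real (cdf M2 w - s w) * iexp (u * w))"
    by (intro Bochner_Integration.integral_cong refl) (simp add: algebra_simps)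
  also have "\<dots> = \<i> * (char M1 u - 1) / of_real u - \<i> * (char M2 u - 1) / of_real u"
    using M1.fourier_cdf_minus_step(2)[OF assms(3) u] M2.fourier_cdf_minus_step(2)[OF assms(4) u]
    unfolding s_def[symmetric]
    by (subst Bochner_Integration.integral_diff[OF i'[OF i(1) M1.borel_measurable_cdf] i'[OF i(2) M2.borel_measurable_cdf]])
      simp
  also have "\<dots> = \<i> * (char M1 u - char M2 u) / of_real u"
    by (simp add: diff_divide_distrib right_diff_distrib)
  finally show "(CLINT w|lborel. of_real (cdf M1 w - cdf M2 w) * iexp (u * w)) =
      \<i> * (char M1 u - char M2 u) / of_real u" .
qed

text \<open>The kernel need not be normalised: only the positivity of its mass and its concentration near \<open>0\<close>
  matter. At \<open>s = 0\<close> it takes the junk value \<open>0\<close>.\<close>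

definition fejer :: "real \<Rightarrow> real \<Rightarrow> real" where
  "fejer T s = (1 - cos (T * s)) / (T * s\<^sup>2)"

lemma fejer_nonneg: "T > 0 \<Longrightarrow> fejer T s \<ge> 0"
  by (simp add: fejer_def)

lemma borel_measurable_fejer [measurable]: "fejer T \<in> borel_measurable borel"
  unfolding fejer_def by measurable

text \<open>The kernel is the cosine transform of the triangle function on \<open>{0..T}\<close>.
  Smoothing with it therefore sees only frequencies up to \<open>T\<close>.\<close>

lemma fejer_eq_integral:
  assumes "T > 0" "s \<noteq> 0"
  shows "(\<integral>u. ((1 - u / T) * cos (u * s)) * indicator {0..T} u \<partial>lborel) = fejer T s"
proof -
  let ?F = "\<lambda>u. sin (u * s) / s - u * sin (u * s) / (T * s) - cos (u * s) / (T * s\<^sup>2)"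
  have "(\<integral>u. ((1 - u / T) * cos (u * s)) * indicator {0..T} u \<partial>lborel) = ?F T - ?F 0"
  proof (rule integral_FTC_Icc_real)
    fix u
    have "DERIV ?F u :> cos (u * s) * s / s - (sin (u * s) + u * (cos (u * s) * s)) / (T * s) -
        (- sin (u * s) * s) / (T * s\<^sup>2)"
      using assms by (auto intro!: derivative_eq_intros)
    also have "cos (u * s) * s / s - (sin (u * s) + u * (cos (u * s) * s)) / (T * s) -
        (- sin (u * s) * s) / (T * s\<^sup>2) = (1 - u / T) * cos (u * s)"
      using assms by (simp add: divide_simps power2_eq_square) (simp add: algebra_simps)
    finally show "DERIV ?F u :> (1 - u / T) * cos (u * s)" .
  qed (use assms in \<open>auto intro!: continuous_intros\<close>)
  also have "\<dots> = fejer T s" using assms by (simp add: fejer_def field_simps)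
  finally show ?thesis .
qed

text \<open>Writing the kernel as a cosine integral and exchanging the integrals leaves the Fourier
  transform of the difference of distribution functions at frequencies in \<open>{0..T}\<close>. Its
  modulus is that of the difference of the characteristic functions divided by \<open>u\<close>,
  hence at most \<open>h u\<close>.\<close>

lemma fejer_smoothing_bound:
  fixes M1 M2 :: "real measure" and h :: "real \<Rightarrow> real"
  assumes M: "real_distribution M1" "real_distribution M2"
    "integrable M1 (\<lambda>x. x)" "integrable M2 (\<lambda>x. x)"
    and T: "T > 0" and h: "integrable lborel h" "\<And>u. 0 \<le> h u"
    and char: "\<And>u. 0 < u \<Longrightarrow> u \<le> T \<Longrightarrow> cmod (char M1 u - char M2 u) \<le> u * h u"
  shows "\<bar>\<integral>w. (cdf M1 w - cdf M2 w) * fejer T (y - w) \<partial>lborel\<bar> \<le> (\<integral>u. h u \<partial>lborel)"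
proof -
  define \<Delta> where "\<Delta> w = cdf M1 w - cdf M2 w" for w
  have \<Delta>: "integrable lborel \<Delta>" unfolding \<Delta>_def by (rule integrable_cdf_diff[OF M])
  then have [measurable]: "\<Delta> \<in> borel_measurable borel" by auto
  define k where "k w u = \<Delta> w * (((1 - u / T) * cos (u * (y - w))) * indicator {0..T} u)" for w u
  have "integrable (lborel \<Otimes>\<^sub>M lborel) (\<lambda>(w, u). \<Delta> w * indicator {0..T} u)"
    by (rule lborel_pair.Fubini_integrable) (use \<Delta> T in \<open>auto simp: abs_mult\<close>)
  then have k: "integrable (lborel \<Otimes>\<^sub>M lborel) (case_prod k)"
  proof (rule Bochner_Integration.integrable_bound)
    have "\<bar>k w u\<bar> \<le> \<bar>\<Delta> w * indicator {0..T} u\<bar>" for w u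
    proof -
      have "\<bar>(1 - u / T) * cos (u * (y - w))\<bar> \<le> 1 * 1" if "u \<in> {0..T}"
        unfolding abs_mult using that T by (intro mult_mono) (auto simp: field_simps)
      then have "\<bar>\<Delta> w\<bar> * \<bar>(1 - u / T) * cos (u * (y - w))\<bar> \<le> \<bar>\<Delta> w\<bar> * 1" if "u \<in> {0..T}"
        using that by (intro mult_left_mono) auto
      then show ?thesis by (auto simp: k_def abs_mult indicator_def)
    qed
    then show "AE x in lborel \<Otimes>\<^sub>M lborel. norm (case_prod k x) \<le> norm (case x of (w, u) \<Rightarrow> \<Delta> w * indicator {0..T} u)"
      by auto
    show "case_prod k \<in> borel_measurable (lborel \<Otimes>\<^sub>M lborel)"
      unfolding k_def by measurable
  qed
  have "(\<integral>w. \<Delta> w * fejer T (y - w) \<partial>lborel) = (\<integral>w. (\<integral>u. k w u \<partial>lborel) \<partial>lborel)"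
  proof (rule integral_cong_AE)
    show "AE w in lborel. \<Delta> w * fejer T (y - w) = (\<integral>u. k w u \<partial>lborel)"
      using AE_lborel_singleton[of y]
    proof eventually_elim
      case (elim w)
      then show ?case using fejer_eq_integral[OF T, of "y - w"] by (simp add: k_def)
    qed
    show "(\<lambda>w. \<integral>u. k w u \<partial>lborel) \<in> borel_measurable lborel"
      using lborel_pair.integrable_fst[OF k] by auto
  qed auto
  also have "\<dots> = (\<integral>u. (\<integral>w. k w u \<partial>lborel) \<partial>lborel)"
    using lborel_pair.Fubini_integral[OF k] by simp
  also have "\<bar>\<dots>\<bar> \<le> (\<integral>u. \<bar>\<integral>w. k w u \<partial>lborel\<bar> \<partial>lborel)"
    by (rule integral_abs_bound)
  also have "\<dots> \<le> (\<integral>u. h u \<partial>lborel)"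
  proof (rule integral_mono_AE)
    show "integrable lborel (\<lambda>u. \<bar>\<integral>w. k w u \<partial>lborel\<bar>)"
      using lborel_pair.integrable_snd[OF k] by (rule integrable_abs)
    show "AE u in lborel. \<bar>\<integral>w. k w u \<partial>lborel\<bar> \<le> h u"
      using AE_lborel_singleton[of 0]
    proof eventually_elim
      case (elim u)
      show ?case
      proof (cases "u \<in> {0..T}")
        case True
        then have u: "0 < u" "u \<le> T" using elim by auto
        have iw: "integrable lborel (\<lambda>w. of_real (\<Delta> w) * iexp (u * w))"
          by (rule Bochner_Integration.integrable_bound[OF \<Delta>]) (auto simp: norm_mult)
        have "(\<integral>w. \<Delta> w * cos (u * (y - w)) \<partial>lborel) =
            (\<integral>w. Re (iexp (- u * y) * (of_real (\<Delta> w) * iexp (u * w))) \<partial>lborel)"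
        proof (intro Bochner_Integration.integral_cong refl)
          fix w
          have "iexp (- u * y) * (of_real (\<Delta> w) * iexp (u * w)) = of_real (\<Delta> w) * iexp (- (u * (y - w)))"
            by (simp add: exp_add[symmetric] algebra_simps)
          then show "\<Delta> w * cos (u * (y - w)) = Re (iexp (- u * y) * (of_real (\<Delta> w) * iexp (u * w)))"
            by (simp only:) (simp add: Re_exp)
        qed
        also have "\<dots> = Re (iexp (- u * y) * (CLINT w|lborel. of_real (\<Delta> w) * iexp (u * w)))"
          using iw by (subst integral_Re) auto
        also have "\<bar>\<dots>\<bar> \<le> norm (iexp (- u * y) * (CLINT w|lborel. of_real (\<Delta> w) * iexp (u * w)))"
          by (rule abs_Re_le_cmod)
        also have "\<dots> = norm (char M1 u - char M2 u) / u"
          using u fourier_cdf_diff[OF M, of u] by (simp add: norm_mult norm_divide \<Delta>_def)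
        also have "\<dots> \<le> h u" using char[OF u] u by (simp add: field_simps)
        finally have c: "\<bar>\<integral>w. \<Delta> w * cos (u * (y - w)) \<partial>lborel\<bar> \<le> h u" .
        have "(\<integral>w. k w u \<partial>lborel) = (1 - u / T) * (\<integral>w. \<Delta> w * cos (u * (y - w)) \<partial>lborel)"
        proof -
          have "k w u = (1 - u / T) * (\<Delta> w * cos (u * (y - w)))" for w using True by (simp add: k_def)
          then show ?thesis by simp
        qed
        also have "\<bar>\<dots>\<bar> \<le> 1 * h u"
          unfolding abs_mult using u T c by (intro mult_mono) (auto simp: field_simps)
        finally show ?thesis by simp
      next
        case False
        then show ?thesis using h(2) by (simp add: k_def)
      qed
    qed
  qed (use h in auto)
  finally show ?thesis unfolding \<Delta>_def .
qed

section \<open>Mass of the Fejer kernel\<close>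

lemma frac_le_eq_mult: "(a :: real) / b \<le> c / d \<longleftrightarrow> a * d \<le> c * b" if "0 < b" "0 < d"
  using that by (simp add: field_simps)

lemma integrable_fejer: "integrable lborel (fejer 1)"
proof -
  have "integrable lborel (\<lambda>x :: real. indicator {0<..} x *\<^sub>R (1 / (1 + x\<^sup>2)))"
    using integrable_I0i_1_div_plus_square
    by (simp add: interval_lebesgue_integrable_def set_integrable_def einterval_def zero_ereal_def greaterThan_def)
  then have 1: "integrable lborel (\<lambda>x :: real. indicator {0<..} x * (1 / (1 + x\<^sup>2)))" by simp
  \<comment> \<open>The majorant on the whole line is glued from the half line and its reflection;
    only the null set containing the point 0 is lost.\<close>
  from lborel_integrable_real_affine[OF this, of "-1" 0]
  have "integrable lborel (\<lambda>x :: real. 5 / 2 * (indicator {0<..} x * (1 / (1 + x\<^sup>2)) + indicator {0<..} (-x) * (1 / (1 + x\<^sup>2))))"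
    by (intro integrable_mult_right Bochner_Integration.integrable_add 1) simp
  then show ?thesis
  proof (rule Bochner_Integration.integrable_bound)
    show "AE x in lborel. norm (fejer 1 x) \<le>
       norm (5 / 2 * (indicator {0<..} x * (1 / (1 + x\<^sup>2)) + indicator {0<..} (-x) * (1 / (1 + x\<^sup>2))))"
      using AE_lborel_singleton[of 0]
    proof eventually_elim
      case (elim x)
      have "(sin (x / 2))\<^sup>2 \<le> (x / 2)\<^sup>2"
        using abs_sin_x_le_abs_x[of "x / 2"] by (metis abs_le_square_iff)
      then have "1 - cos x \<le> x\<^sup>2 / 2" using cos_double_sin[of "x / 2"] by (simp add: power_divide)
      moreover have "x\<^sup>2 * (1 - cos x) \<le> x\<^sup>2 * 2" by (intro mult_left_mono) (use cos_ge_minus_one[of x] in auto)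
      \<comment> \<open>5/2 = 1/2 + 2 combines the bound \<open>x\<^sup>2 / 2\<close> for small
        \<open>x\<close> with the bound 2 for large \<open>x\<close>.\<close>
      ultimately have m: "(1 - cos x) * (1 + x\<^sup>2) \<le> 5 / 2 * x\<^sup>2" by (simp add: algebra_simps)
      have "0 < x\<^sup>2" "0 < 1 + x\<^sup>2" using elim by (simp, intro add_pos_nonneg, auto)
      then have "(1 - cos x) / x\<^sup>2 \<le> (5 / 2) / (1 + x\<^sup>2)"
        using m frac_le_eq_mult[of "x\<^sup>2" "1 + x\<^sup>2" "1 - cos x" "5 / 2"] by blast
      then have "fejer 1 x \<le> 5 / 2 * (1 / (1 + x\<^sup>2))" by (simp add: fejer_def)
      moreover have "indicator {0<..} x * (1 / (1 + x\<^sup>2)) + indicator {0<..} (-x) * (1 / (1 + x\<^sup>2)) = 1 / (1 + x\<^sup>2)"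
        using elim by (auto simp: indicator_def)
      ultimately show ?case using fejer_nonneg[of 1 x] by simp
    qed
  qed auto
qed


lemma
  assumes T: "T > 0" and \<psi>: "\<psi> \<in> borel_measurable borel" "\<And>s. \<bar>\<psi> s\<bar> \<le> B"
  shows integrable_fejer_scaled: "integrable lborel (\<lambda>w. fejer T (y - w) * \<psi> (T * (y - w)))"
    and integral_fejer_scaled:
      "(\<integral>w. fejer T (y - w) * \<psi> (T * (y - w)) \<partial>lborel) = (\<integral>s. fejer 1 s * \<psi> s \<partial>lborel)"
proof -
  have [measurable]: "\<psi> \<in> borel_measurable borel" by fact
  have "integrable lborel (\<lambda>s. B * fejer 1 s)" using integrable_fejer by simp
  then have int: "integrable lborel (\<lambda>s. fejer 1 s * \<psi> s)"
  proof (rule Bochner_Integration.integrable_bound)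
    have "\<bar>\<psi> s\<bar> * fejer 1 s \<le> \<bar>B\<bar> * fejer 1 s" for s
      using \<psi>(2)[of s] by (intro mult_right_mono fejer_nonneg) auto
    then show "AE s in lborel. norm (fejer 1 s * \<psi> s) \<le> norm (B * fejer 1 s)"
      using fejer_nonneg[of 1] by (simp add: abs_mult mult.commute)
  qed auto
  \<comment> \<open>\<open>fejer T s = T * fejer 1 (T * s)\<close>, so the mass does not depend on
    \<open>T\<close>.\<close>
  have eq: "fejer T (y - w) * \<psi> (T * (y - w)) = T * (fejer 1 (T * y + - T * w) * \<psi> (T * y + - T * w))" for w
    using T by (simp add: fejer_def right_diff_distrib[symmetric] power_mult_distrib power2_eq_square)
  show "integrable lborel (\<lambda>w. fejer T (y - w) * \<psi> (T * (y - w)))"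
    unfolding eq using T by (intro integrable_mult_right lborel_integrable_real_affine[OF int]) auto
  show "(\<integral>w. fejer T (y - w) * \<psi> (T * (y - w)) \<partial>lborel) = (\<integral>s. fejer 1 s * \<psi> s \<partial>lborel)"
    unfolding eq
    using T by (subst lborel_integral_real_affine[of "- T" "\<lambda>s. fejer 1 s * \<psi> s" "T * y"]) auto
qed

definition fejer_mass :: "real set \<Rightarrow> real" where
  "fejer_mass A = (\<integral>s. fejer 1 s * indicator A s \<partial>lborel)"

text \<open>Inside the window the lower bound \<open>l\<close> is used; outside nothing but
  \<open>- \<eta>\<close> is known, so the outer mass of the kernel is the price.\<close>

lemma fejer_smoothing_lower:
  fixes \<Delta> :: "real \<Rightarrow> real"
  assumes T: "T > 0" and [measurable]: "\<Delta> \<in> borel_measurable borel"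
    and b: "\<And>w. \<bar>\<Delta> w\<bar> \<le> \<eta>" and l: "\<And>w. \<bar>w - y\<bar> \<le> a / T \<Longrightarrow> l \<le> \<Delta> w"
  shows "l * fejer_mass {-a..a} - \<eta> * fejer_mass (- {-a..a}) \<le> (\<integral>w. \<Delta> w * fejer T (y - w) \<partial>lborel)"
proof -
  let ?ind = "\<lambda>A w. fejer T (y - w) * indicator A (T * (y - w))"
  have i: "integrable lborel (?ind A)" if "A \<in> sets borel" for A
    by (rule integrable_fejer_scaled[OF T, of _ 1]) (use that in \<open>auto simp: indicator_def\<close>)
  have m: "(\<integral>w. ?ind A w \<partial>lborel) = fejer_mass A" if "A \<in> sets borel" for A
    unfolding fejer_mass_def
    by (rule integral_fejer_scaled[OF T, of _ 1]) (use that in \<open>auto simp: indicator_def\<close>)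
  have "integrable lborel (\<lambda>w. \<eta> * ?ind UNIV w)" by (intro integrable_mult_right i) auto
  then have id: "integrable lborel (\<lambda>w. \<Delta> w * fejer T (y - w))"
  proof (rule Bochner_Integration.integrable_bound)
    have "\<bar>\<Delta> w\<bar> * fejer T (y - w) \<le> \<bar>\<eta>\<bar> * fejer T (y - w)" for w
      using b[of w] by (intro mult_right_mono fejer_nonneg T) auto
    then show "AE w in lborel. norm (\<Delta> w * fejer T (y - w)) \<le> norm (\<eta> * ?ind UNIV w)"
      using fejer_nonneg[OF T] by (simp add: abs_mult)
  qed auto
  have "l * fejer_mass {-a..a} - \<eta> * fejer_mass (- {-a..a}) =
      (\<integral>w. l * ?ind {-a..a} w - \<eta> * ?ind (- {-a..a}) w \<partial>lborel)"
    by (subst Bochner_Integration.integral_diff) (auto simp: m intro!: integrable_mult_right i)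
  also have "\<dots> \<le> (\<integral>w. \<Delta> w * fejer T (y - w) \<partial>lborel)"
  proof (rule integral_mono[OF _ id])
    show "integrable lborel (\<lambda>w. l * ?ind {-a..a} w - \<eta> * ?ind (- {-a..a}) w)"
      by (intro Bochner_Integration.integrable_diff integrable_mult_right i) auto
    fix w
    show "l * ?ind {-a..a} w - \<eta> * ?ind (- {-a..a}) w \<le> \<Delta> w * fejer T (y - w)"
    proof (cases "T * (y - w) \<in> {-a..a}")
      case True
      then have "l \<le> \<Delta> w" using T by (intro l) (auto simp: abs_le_iff field_simps)
      then show ?thesis using True fejer_nonneg[OF T, of "y - w"] by (simp add: mult_right_mono)
    next
      case False
      have "- \<eta> \<le> \<Delta> w" using b[of w] by auto
      then have "- \<eta> * fejer T (y - w) \<le> \<Delta> w * fejer T (y - w)"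
        by (rule mult_right_mono[OF _ fejer_nonneg[OF T]])
      then show ?thesis using False by simp
    qed
  qed
  finally show ?thesis .
qed

lemma fejer_mass_concentrated:
  obtains a where "a > 0" "fejer_mass {-a..a} > 0" "4 * fejer_mass (- {-a..a}) \<le> fejer_mass {-a..a}"
proof -
  let ?c = "\<integral>s. fejer 1 s \<partial>lborel"
  have lim: "(\<lambda>n. fejer_mass {- real n..real n}) \<longlonglongrightarrow> ?c"
    unfolding fejer_mass_def
  proof (rule integral_dominated_convergence[OF _ _ integrable_fejer])
    show "AE s in lborel. (\<lambda>n. fejer 1 s * indicator {- real n..real n} s) \<longlonglongrightarrow> fejer 1 s"
    proof (intro AE_I2 tendsto_eventually)
      fix s :: real
      show "\<forall>\<^sub>F n in sequentially. fejer 1 s * indicator {- real n..real n} s = fejer 1 s"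
        using eventually_ge_at_top[of "nat \<lceil>\<bar>s\<bar>\<rceil>"] by eventually_elim (auto simp: indicator_def)
    qed
  qed (auto simp: indicator_def fejer_nonneg)
  have "?c \<noteq> 0"
  proof
    assume "?c = 0"
    then have "AE s in lborel. fejer 1 s = 0"
      using integral_nonneg_eq_0_iff_AE[OF integrable_fejer] fejer_nonneg[of 1] by auto
    then have "AE s in lborel. s \<notin> {0 <..< 1 :: real}"
    proof eventually_elim
      case (elim s)
      have "fejer 1 s \<noteq> 0" if "0 < s" "s < 1"
        using cos_monotone_0_pi[of 0 s] that pi_gt3 by (auto simp: fejer_def)
      then show ?case using elim by auto
    qed
    then have "emeasure lborel {0 <..< 1 :: real} = 0"
      by (subst (asm) AE_iff_measurable[where N = "{0<..<1}"]) auto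
    then show False by simp
  qed
  moreover have "?c \<ge> 0" by (intro Bochner_Integration.integral_nonneg fejer_nonneg) auto
  ultimately have "?c > 0" by simp
  \<comment> \<open>Central mass above 4/5 of the total leaves less than 1/5 outside, which is less
    than a quarter of the central mass.\<close>
  then have "\<forall>\<^sub>F n in sequentially. 4 / 5 * ?c < fejer_mass {- real n..real n}"
    by (intro order_tendstoD[OF lim]) auto
  then have "\<forall>\<^sub>F n in sequentially. 4 / 5 * ?c < fejer_mass {- real n..real n} \<and> 0 < n"
    using eventually_gt_at_top by (rule eventually_conj)
  then obtain n where n: "4 / 5 * ?c < fejer_mass {- real n..real n}" "0 < n"
    by (auto simp: eventually_sequentially)
  have "fejer_mass A + fejer_mass (- A) = ?c" if "A \<in> sets borel" for A
  proof -
    have "integrable lborel (\<lambda>s. fejer 1 s * indicator B s)" if "B \<in> sets borel" for B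
      using that by (intro integrable_real_mult_indicator integrable_fejer) auto
    then have "fejer_mass A + fejer_mass (- A) = (\<integral>s. fejer 1 s * indicator A s + fejer 1 s * indicator (- A) s \<partial>lborel)"
      using that unfolding fejer_mass_def by (subst Bochner_Integration.integral_add) auto
    also have "\<dots> = ?c" by (intro Bochner_Integration.integral_cong) (auto simp: indicator_def)
    finally show ?thesis .
  qed
  from this[of "{- real n..real n}"] show ?thesis
    using n \<open>?c > 0\<close> by (intro that[of "real n"]) auto
qed

text \<open>A predicate on the constant, so that one constant can be fixed before the laws,
  \<open>T\<close> and \<open>h\<close> are chosen. The function \<open>h\<close> is any integrable
  majorant of the modulus of the difference of the characteristic functions divided by
  \<open>u\<close>, so the quotient itself is never integrated.\<close>

definition esseen_bound :: "real \<Rightarrow> bool" where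
  "esseen_bound C \<longleftrightarrow> C > 0 \<and> (\<forall>M1 M2 T h y. real_distribution M1 \<longrightarrow> real_distribution M2 \<longrightarrow>
       integrable M1 (\<lambda>x. x) \<longrightarrow> integrable M2 (\<lambda>x. x) \<longrightarrow>
       (\<forall>s t. s \<le> t \<longrightarrow> cdf M2 t - cdf M2 s \<le> t - s) \<longrightarrow> T > 0 \<longrightarrow>
       integrable lborel h \<longrightarrow> (\<forall>u. 0 \<le> h u) \<longrightarrow>
       (\<forall>u. 0 < u \<longrightarrow> u \<le> T \<longrightarrow> cmod (char M1 u - char M2 u) \<le> u * h u) \<longrightarrow>
       \<bar>cdf M1 y - cdf M2 y\<bar> \<le> C * ((\<integral>u. h u \<partial>lborel) + 1 / T))"

text \<open>Near a point where the deviation is almost its supremum \<open>\<eta>\<close> it stays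
  large on a one-sided window of length of order \<open>1 / T\<close>, as one distribution function
  is monotone and the other 1-Lipschitz. Smoothing over that window sees most of
  \<open>\<eta>\<close>, and the tails of the kernel lose only a fraction that can be
  absorbed.\<close>

lemma ex_esseen_bound: "\<exists>C. esseen_bound C"
proof -
  obtain a where a: "a > 0" "fejer_mass {-a..a} > 0" "4 * fejer_mass (- {-a..a}) \<le> fejer_mass {-a..a}"
    using fejer_mass_concentrated .
  define c where "c = fejer_mass {-a..a}"
  have c: "c > 0" "4 * fejer_mass (- {-a..a}) \<le> c" using a by (auto simp: c_def)
  define C where "C = 2 / c + 4 * a"
  have "C > 0" using a c by (simp add: C_def add_pos_pos)
  moreover have "\<bar>cdf M1 y - cdf M2 y\<bar> \<le> C * ((\<integral>u. h u \<partial>lborel) + 1 / T)"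
    if M: "real_distribution M1" "real_distribution M2"
      "integrable M1 (\<lambda>x. x)" "integrable M2 (\<lambda>x. x)"
      and lip: "\<And>s t. s \<le> t \<Longrightarrow> cdf M2 t - cdf M2 s \<le> t - s"
      and T: "T > 0" and h: "integrable lborel h" "\<And>u. 0 \<le> h u"
      and char: "\<And>u. 0 < u \<Longrightarrow> u \<le> T \<Longrightarrow> cmod (char M1 u - char M2 u) \<le> u * h u"
    for M1 M2 :: "real measure" and T :: real and h :: "real \<Rightarrow> real" and y :: real
  proof -
    interpret M1: real_distribution M1 by fact
    interpret M2: real_distribution M2 by fact
    define \<Delta> where "\<Delta> w = cdf M1 w - cdf M2 w" for w
    have \<Delta>m: "\<Delta> \<in> borel_measurable borel"
      unfolding \<Delta>_def using M1.borel_measurable_cdf M2.borel_measurable_cdf by auto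
    define \<eta> where "\<eta> = (SUP w. \<bar>\<Delta> w\<bar>)"
    have bdd: "bdd_above (range (\<lambda>w. \<bar>\<Delta> w\<bar>))"
      using M1.cdf_nonneg M2.cdf_nonneg M1.cdf_bounded_prob M2.cdf_bounded_prob
      by (intro bdd_aboveI[of _ 1]) (auto simp: \<Delta>_def abs_le_iff, (smt (verit))+)
    have le: "\<bar>\<Delta> w\<bar> \<le> \<eta>" for w unfolding \<eta>_def by (rule cSUP_upper[OF _ bdd]) auto
    let ?H = "\<integral>u. h u \<partial>lborel"
    have "?H \<ge> 0" using h by (intro Bochner_Integration.integral_nonneg) auto
    have key: "\<eta> \<le> C * (?H + 1 / T)"
    proof (cases "\<eta> > 0")
      case True
      \<comment> \<open>The supremum need not be attained; any fraction between 1/4, the part lost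
        to the tails, and 1 would do.\<close>
      then have "3 / 4 * \<eta> < \<eta>" by simp
      then obtain y0 where y0: "3 / 4 * \<eta> < \<bar>\<Delta> y0\<bar>"
        using less_cSUP_iff[OF UNIV_not_empty bdd, of "3 / 4 * \<eta>"] unfolding \<eta>_def by blast
      let ?l = "3 / 4 * \<eta> - 2 * a / T"
      have "\<exists>y. ?l * c - \<eta> * fejer_mass (- {-a..a}) \<le> \<bar>\<integral>w. \<Delta> w * fejer T (y - w) \<partial>lborel\<bar>"
      \<comment> \<open>A positive deviation persists to the right of \<open>y0\<close>, a negative
        one to the left; the centre of the window is shifted accordingly.\<close>
      proof (cases "\<Delta> y0 \<ge> 0")
        case True
        have "?l \<le> \<Delta> w" if "\<bar>w - (y0 + a / T)\<bar> \<le> a / T" for w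
        proof -
          have w: "y0 \<le> w" "w \<le> y0 + 2 * a / T" using that by (auto simp: abs_le_iff)
          show ?thesis using lip[OF w(1)] M1.cdf_nondecreasing[OF w(1)] w y0 True by (auto simp: \<Delta>_def)
        qed
        from fejer_smoothing_lower[OF T \<Delta>m le this]
        show ?thesis unfolding c_def by (meson abs_ge_self order_trans)
      next
        case False
        have "?l \<le> - \<Delta> w" if "\<bar>w - (y0 - a / T)\<bar> \<le> a / T" for w
        proof -
          have w: "w \<le> y0" "y0 - 2 * a / T \<le> w" using that by (auto simp: abs_le_iff)
          show ?thesis using lip[OF w(1)] M1.cdf_nondecreasing[OF w(1)] w y0 False by (auto simp: \<Delta>_def)
        qed
        from fejer_smoothing_lower[where \<Delta> = "\<lambda>w. - \<Delta> w" and \<eta> = \<eta>, OF T _ _ this] \<Delta>m le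
        have "?l * c - \<eta> * fejer_mass (- {-a..a}) \<le> (\<integral>w. - \<Delta> w * fejer T (y0 - a / T - w) \<partial>lborel)"
          unfolding c_def by auto
        also have "\<dots> \<le> \<bar>\<integral>w. \<Delta> w * fejer T (y0 - a / T - w) \<partial>lborel\<bar>" by simp
        finally show ?thesis by blast
      qed
      then obtain y where "?l * c - \<eta> * fejer_mass (- {-a..a}) \<le> \<bar>\<integral>w. \<Delta> w * fejer T (y - w) \<partial>lborel\<bar>" by blast
      also have "\<dots> \<le> ?H" unfolding \<Delta>_def by (rule fejer_smoothing_bound[OF M T h char])
      finally have "?l * c - \<eta> * fejer_mass (- {-a..a}) \<le> ?H" .
      moreover have "\<eta> * fejer_mass (- {-a..a}) \<le> \<eta> * (c / 4)"
        using True c by (intro mult_left_mono) auto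
      \<comment> \<open>Of \<open>3 / 4 * \<eta>\<close> at the centre a quarter of
        \<open>\<eta>\<close> is lost outside, and half of \<open>\<eta>\<close> remains.\<close>
      moreover have "c * (\<eta> / 2 - 2 * a / T) = ?l * c - \<eta> * (c / 4)"
        by (simp add: algebra_simps)
      ultimately have "c * (\<eta> / 2 - 2 * a / T) \<le> ?H" by linarith
      then have "\<eta> / 2 - 2 * a / T \<le> ?H / c" using c by (simp add: field_simps)
      then have "\<eta> \<le> 2 / c * ?H + 4 * a * (1 / T)" by simp
      also have "\<dots> \<le> C * ?H + C * (1 / T)"
        unfolding C_def using a c T \<open>?H \<ge> 0\<close> by (intro add_mono mult_right_mono) auto
      finally show ?thesis by (simp add: algebra_simps)
    next
      case False
      have "0 \<le> C * (?H + 1 / T)" using \<open>C > 0\<close> \<open>?H \<ge> 0\<close> T by simp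
      then show ?thesis using False by linarith
    qed
    show "\<bar>cdf M1 y - cdf M2 y\<bar> \<le> C * (?H + 1 / T)"
      using le[of y] key by (simp add: \<Delta>_def)
  qed
  ultimately show ?thesis unfolding esseen_bound_def by blast
qed

section \<open>Laplace transforms on the half-line and the normal tail\<close>

lemma has_bochner_integral_exp_tail:
  fixes x v :: real
  assumes "x > 0"
  shows "has_bochner_integral lborel (\<lambda>y. x * exp (- x * y) * indicator {v..} y) (exp (- x * v))"
proof (rule has_bochner_integral_nn_integral)
  have "(\<integral>\<^sup>+y. ennreal (x * exp (- x * y)) * indicator {v..} y \<partial>lborel) = ennreal (0 - (- exp (- x * v)))"
  proof (rule nn_integral_FTC_atLeast)
    show "DERIV (\<lambda>y. - exp (- x * y)) y :> x * exp (- x * y)" for y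
      by (auto intro!: derivative_eq_intros)
    have "((\<lambda>y. - exp (- x * y)) \<longlongrightarrow> - 0) at_top"
      using assms by real_asymp
    then show "((\<lambda>y. - exp (- x * y)) \<longlongrightarrow> 0) at_top" by simp
  qed (use assms in auto)
  then show "(\<integral>\<^sup>+y. ennreal (x * exp (- x * y) * indicator {v..} y) \<partial>lborel) = ennreal (exp (- x * v))"
    by (simp add: ennreal_mult'' ennreal_indicator)
qed (use assms in auto)

text \<open>For the law of the tilted count minus \<open>x\<close> this is the factor left in the
  probability of exceeding \<open>x\<close> after undoing the tilt; for the standard normal law it
  is the Mills ratio up to a constant factor. The open half line matches the strict inequality
  \<open>w > x\<close>.\<close>

definition pos_laplace :: "real measure \<Rightarrow> real \<Rightarrow> real" where
  "pos_laplace M x = (\<integral>v. exp (- x * v) * indicator {0<..} v \<partial>M)"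

lemma (in real_distribution) pos_laplace_zero: "pos_laplace M 0 = 1 - cdf M 0"
proof -
  have "UNIV - {..0} = {0 :: real<..}" by auto
  then show ?thesis using prob_compl[of "{..0}"] by (simp add: pos_laplace_def cdf_def)
qed

text \<open>Write \<open>exp (- x * v)\<close> as the integral of \<open>x * exp (- x * y)\<close>
  over \<open>y \<ge> v\<close> and exchange the integrals; the measure enters only through
  \<open>{0<..y}\<close>.\<close>

lemma (in real_distribution) pos_laplace_eq_cdf:
  assumes "x > 0"
  shows "pos_laplace M x = (\<integral>y. x * exp (- x * y) * indicator {0<..} y * (cdf M y - cdf M 0) \<partial>lborel)"
proof -
  interpret P: pair_sigma_finite M lborel ..
  define g where "g v y = (if 0 < v \<and> v \<le> y then x * exp (- x * y) else 0)" for v y :: real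
  have [measurable]: "case_prod g \<in> borel_measurable (M \<Otimes>\<^sub>M lborel)"
    unfolding g_def by measurable
  have g_eq: "g v = (\<lambda>y. indicator {0<..} v * (x * exp (- x * y) * indicator {v..} y))" for v
    by (auto simp: g_def indicator_def)
  have hb: "has_bochner_integral lborel (g v) (indicator {0<..} v * exp (- x * v))" for v
    unfolding g_eq by (intro has_bochner_integral_mult_right has_bochner_integral_exp_tail assms)
  have gi: "integrable lborel (g v)" and gv: "(\<integral>y. g v y \<partial>lborel) = indicator {0<..} v * exp (- x * v)" for v
    using hb by (auto simp: has_bochner_integral_iff)
  have "g v y \<ge> 0" for v y using assms by (simp add: g_def)
  then have gn: "norm (g v y) = g v y" for v y by simp
  have prod: "integrable (M \<Otimes>\<^sub>M lborel) (case_prod g)"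
  proof (rule P.Fubini_integrable)
    have "integrable M (\<lambda>v. indicator {0<..} v * exp (- x * v))"
      by (rule integrable_const_bound[of _ 1]) (use assms in \<open>auto simp: indicator_def\<close>)
    then show "integrable M (\<lambda>v. \<integral>w. norm (case (v, w) of (v, w) \<Rightarrow> g v w) \<partial>lborel)"
      unfolding prod.case gn gv .
  qed (use gi in simp_all)
  have "pos_laplace M x = (\<integral>v. (\<integral>y. g v y \<partial>lborel) \<partial>M)"
    unfolding pos_laplace_def gv by (simp add: mult.commute)
  also have "\<dots> = (\<integral>y. (\<integral>v. g v y \<partial>M) \<partial>lborel)"
    using P.Fubini_integral[OF prod] by simp
  also have "(\<lambda>y. \<integral>v. g v y \<partial>M) = (\<lambda>y. x * exp (- x * y) * indicator {0<..} y * (cdf M y - cdf M 0))"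
  proof
    fix y
    have "g v y = x * exp (- x * y) * indicator {0<..y} v" for v by (auto simp: g_def indicator_def)
    then have "(\<integral>v. g v y \<partial>M) = x * exp (- x * y) * measure M {0<..y}" by simp
    also have "measure M {0<..y} = indicator {0<..} y * (cdf M y - cdf M 0)"
      using cdf_diff_eq[of 0 y] by (auto simp: indicator_def not_less)
    finally show "(\<integral>v. g v y \<partial>M) = x * exp (- x * y) * indicator {0<..} y * (cdf M y - cdf M 0)" by simp
  qed
  finally show ?thesis .
qed

text \<open>The weight \<open>x * exp (- x * y)\<close> on the positive half line has mass 1, and
  the bracket in \<open>pos_laplace_eq_cdf\<close> changes by at most \<open>2 * d\<close>. At
  \<open>x = 0\<close> this weight vanishes, and the distribution functions are compared at 0
  directly.\<close>

lemma pos_laplace_diff_le: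
  fixes M1 M2 :: "real measure"
  assumes M: "real_distribution M1" "real_distribution M2" and x: "x \<ge> 0"
    and d: "\<And>y. \<bar>cdf M1 y - cdf M2 y\<bar> \<le> d"
  shows "\<bar>pos_laplace M1 x - pos_laplace M2 x\<bar> \<le> 2 * d"
proof -
  interpret M1: real_distribution M1 by fact
  interpret M2: real_distribution M2 by fact
  have "d \<ge> 0" using d[of 0] by linarith
  show ?thesis
  proof (cases "x = 0")
    case True
    then show ?thesis using d[of 0] \<open>d \<ge> 0\<close>
      by (simp add: M1.pos_laplace_zero M2.pos_laplace_zero abs_minus_commute)
  next
    case False
    then have x: "x > 0" using x by simp
    let ?k = "\<lambda>y. x * exp (- x * y) * indicator {0<..} y"
    have "AE y in lborel. ?k y = x * exp (- x * y) * indicator {0..} y"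
      using AE_lborel_singleton[of 0] by eventually_elim (auto simp: indicator_def)
    then have k: "has_bochner_integral lborel ?k 1"
      using has_bochner_integral_exp_tail[OF x, of 0]
      by (subst has_bochner_integral_cong_AE[where g = "\<lambda>y. x * exp (- x * y) * indicator {0..} y"]) auto
    have "integrable lborel (\<lambda>y. ?k y * (cdf M y - cdf M 0))" if "real_distribution M" for M
    proof -
      interpret M: real_distribution M by fact
      have [measurable]: "cdf M \<in> borel_measurable borel" by (rule M.borel_measurable_cdf)
      have "\<bar>cdf M y - cdf M 0\<bar> \<le> 1" for y
        using M.cdf_nonneg[of y] M.cdf_nonneg[of 0] M.cdf_bounded_prob[of y] M.cdf_bounded_prob[of 0]
        by (auto simp: abs_le_iff)
      then have "\<bar>?k y\<bar> * \<bar>cdf M y - cdf M 0\<bar> \<le> \<bar>?k y\<bar> * 1" for y by (intro mult_left_mono) auto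
      then have b: "AE y in lborel. norm (?k y * (cdf M y - cdf M 0)) \<le> norm (?k y)"
        by (auto simp: abs_mult)
      have "integrable lborel ?k" using k by (simp only: has_bochner_integral_iff)
      then show ?thesis
        by (rule Bochner_Integration.integrable_bound[OF _ _ b]) measurable
    qed
    note i = this[OF M(1)] this[OF M(2)]
    have "pos_laplace M1 x - pos_laplace M2 x = (\<integral>y. ?k y * (cdf M1 y - cdf M1 0) - ?k y * (cdf M2 y - cdf M2 0) \<partial>lborel)"
      unfolding M1.pos_laplace_eq_cdf[OF x] M2.pos_laplace_eq_cdf[OF x] using i
      by (subst Bochner_Integration.integral_diff) auto
    then have "\<bar>pos_laplace M1 x - pos_laplace M2 x\<bar> \<le> (\<integral>y. \<bar>?k y * (cdf M1 y - cdf M1 0) - ?k y * (cdf M2 y - cdf M2 0)\<bar> \<partial>lborel)"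
      by (simp only: integral_abs_bound)
    moreover have "(\<integral>y. \<bar>?k y * (cdf M1 y - cdf M1 0) - ?k y * (cdf M2 y - cdf M2 0)\<bar> \<partial>lborel) \<le> (\<integral>y. ?k y * (2 * d) \<partial>lborel)"
    proof (rule integral_mono)
      fix y
      have "?k y * (cdf M1 y - cdf M1 0) - ?k y * (cdf M2 y - cdf M2 0) =
         ?k y * ((cdf M1 y - cdf M2 y) - (cdf M1 0 - cdf M2 0))"
        by (simp only: right_diff_distrib)
      moreover have "0 \<le> ?k y" using x by simp
      ultimately have "\<bar>?k y * (cdf M1 y - cdf M1 0) - ?k y * (cdf M2 y - cdf M2 0)\<bar> =
         ?k y * \<bar>(cdf M1 y - cdf M2 y) - (cdf M1 0 - cdf M2 0)\<bar>"
        by (metis abs_mult abs_of_nonneg)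
      also have "\<dots> \<le> ?k y * (2 * d)"
        using d[of y] d[of 0] x by (intro mult_left_mono) auto
      finally show "\<bar>?k y * (cdf M1 y - cdf M1 0) - ?k y * (cdf M2 y - cdf M2 0)\<bar> \<le> ?k y * (2 * d)" .
    qed (use k i in \<open>auto simp: has_bochner_integral_iff intro!: integrable_mult_left\<close>)
    moreover have "(\<integral>y. ?k y * (2 * d) \<partial>lborel) = 2 * d" using k by (simp add: has_bochner_integral_iff)
    ultimately show ?thesis by linarith
  qed
qed

section \<open>Normal tails and shifted normal laws\<close>

lemma std_normal_density_le_1: "std_normal_density x \<le> 1"
proof -
  have "1 / sqrt (2 * pi) \<le> 1" using pi_gt3 by (simp add: real_le_rsqrt divide_le_eq)
  then show ?thesis unfolding std_normal_density_def by (intro mult_le_one) auto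
qed

lemma Phi_diff_le:
  assumes "s \<le> t"
  shows "Phi t - Phi s \<le> t - s"
proof -
  interpret real_distribution std_normal_distribution by (rule real_dist_normal_dist)
  have "ennreal (Phi t - Phi s) = emeasure std_normal_distribution {s<..t}"
    using emeasure_Ioc[OF assms] by (simp add: Phi_def)
  also have "\<dots> = (\<integral>\<^sup>+x. ennreal (std_normal_density x) * indicator {s<..t} x \<partial>lborel)"
    by (subst emeasure_density) auto
  also have "\<dots> \<le> (\<integral>\<^sup>+x. indicator {s<..t} x \<partial>lborel)"
    using std_normal_density_le_1 by (intro nn_integral_mono) (auto simp: indicator_def)
  also have "\<dots> = ennreal (t - s)" using assms by simp
  finally show ?thesis using assms by simp
qed

lemma abs_Phi_diff_le: "\<bar>Phi t - Phi s\<bar> \<le> \<bar>t - s\<bar>"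
proof -
  interpret real_distribution std_normal_distribution by (rule real_dist_normal_dist)
  have *: "\<bar>Phi t - Phi s\<bar> \<le> \<bar>t - s\<bar>" if "s \<le> t" for s t
    using Phi_diff_le[OF that] cdf_nondecreasing[OF that] that by (simp add: Phi_def)
  show ?thesis using *[of s t] *[of t s] by (cases "s \<le> t") (auto simp: abs_minus_commute)
qed

lemma Phi_minus: "Phi (- x) = 1 - Phi x"
proof -
  interpret real_distribution std_normal_distribution by (rule real_dist_normal_dist)
  have "emeasure std_normal_distribution {.. -x} = (\<integral>\<^sup>+y. ennreal (std_normal_density y) * indicator {..-x} y \<partial>lborel)"
    by (subst emeasure_density) auto
  also have "\<dots> = (\<integral>\<^sup>+y. ennreal (std_normal_density (0 + -1 * y)) * indicator {..-x} (0 + -1 * y) \<partial>lborel)"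
    by (subst nn_integral_real_affine[of _ "-1" 0]) auto
  also have "\<dots> = (\<integral>\<^sup>+y. ennreal (std_normal_density y) * indicator {x<..} y \<partial>lborel)"
  proof (rule nn_integral_cong_AE)
    show "AE y in lborel. ennreal (std_normal_density (0 + -1 * y)) * indicator {..-x} (0 + -1 * y) =
      ennreal (std_normal_density y) * indicator {x<..} y"
      using AE_lborel_singleton[of x] by eventually_elim (auto simp: indicator_def std_normal_density_def)
  qed
  also have "\<dots> = emeasure std_normal_distribution {x<..}"
    by (subst emeasure_density) auto
  finally have "prob {..-x} = prob {x<..}" by (simp add: measure_def)
  moreover have "UNIV - {..x} = {x<..}" by auto
  ultimately show ?thesis using prob_compl[of "{..x}"] by (simp add: Phi_def cdf_def)
qed

text \<open>The comparison law for the tilted count: \<open>\<mu>\<close> will be the mean of the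
  tilted law, so that the linear terms of the two exponents agree.\<close>

definition shifted_normal :: "real \<Rightarrow> real measure" where
  "shifted_normal \<mu> = distr std_normal_distribution borel (\<lambda>z. z + \<mu>)"

lemma real_distribution_shifted_normal: "real_distribution (shifted_normal \<mu>)"
proof -
  interpret real_distribution std_normal_distribution by (rule real_dist_normal_dist)
  show ?thesis unfolding shifted_normal_def by (rule real_distribution_distr) simp
qed

lemma integrable_shifted_normal: "integrable (shifted_normal \<mu>) (\<lambda>x. x)"
proof -
  interpret real_distribution std_normal_distribution by (rule real_dist_normal_dist)
  have "integrable std_normal_distribution (\<lambda>z. z)"
    using integrable_std_normal_distribution_moment[of 1] by (simp only: power_one_right)
  then have "integrable std_normal_distribution (\<lambda>z. z + \<mu>)"
    by (rule Bochner_Integration.integrable_add) (rule integrable_const)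
  then show ?thesis unfolding shifted_normal_def
    by (subst integrable_distr_eq) measurable
qed

lemma cdf_shifted_normal: "cdf (shifted_normal \<mu>) y = Phi (y - \<mu>)"
proof -
  have "(\<lambda>z. z + \<mu>) -` {..y} = {..y - \<mu>}" by auto
  then show ?thesis by (simp add: shifted_normal_def cdf_def Phi_def measure_distr)
qed

lemma char_shifted_normal: "char (shifted_normal \<mu>) u = iexp (u * \<mu>) * of_real (exp (- u\<^sup>2 / 2))"
proof -
  have "char (shifted_normal \<mu>) u = (CLINT z|std_normal_distribution. iexp (u * \<mu>) * iexp (u * z))"
    unfolding char_def shifted_normal_def
    by (subst integral_distr) (auto simp: distrib_left exp_add mult.commute)
  also have "\<dots> = iexp (u * \<mu>) * char std_normal_distribution u"
    by (simp add: char_def)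
  finally show ?thesis by (simp add: char_std_normal_distribution)
qed

lemma pos_laplace_shifted_normal:
  "pos_laplace (shifted_normal \<mu>) x =
    (\<integral>y. std_normal_density (y - \<mu>) * (exp (- x * y) * indicator {0<..} y) \<partial>lborel)"
proof -
  have "pos_laplace (shifted_normal \<mu>) x =
     (\<integral>z. std_normal_density z * (exp (- x * (z + \<mu>)) * indicator {0<..} (z + \<mu>)) \<partial>lborel)"
    unfolding pos_laplace_def shifted_normal_def
    by (subst integral_distr) (auto simp: integral_density)
  also have "\<dots> = (\<integral>y. std_normal_density (y - \<mu>) * (exp (- x * y) * indicator {0<..} y) \<partial>lborel)"
    by (subst lborel_integral_real_affine[of 1 _ "- \<mu>"]) auto
  finally show ?thesis .
qed

lemma shifted_normal_0: "shifted_normal 0 = std_normal_distribution"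
proof -
  have "shifted_normal 0 = distr std_normal_distribution std_normal_distribution (\<lambda>x. x)"
    unfolding shifted_normal_def by (intro distr_cong) auto
  then show ?thesis by simp
qed

text \<open>Completing the square: the density at \<open>x + y\<close> is
  \<open>exp (- x\<^sup>2 / 2)\<close> times the density at \<open>y\<close> times
  \<open>exp (- x * y)\<close>. This is the normal counterpart of \<open>tail_eq\<close>.\<close>

lemma one_minus_Phi_eq: "1 - Phi x = exp (- x\<^sup>2 / 2) * pos_laplace std_normal_distribution x"
proof -
  interpret real_distribution std_normal_distribution by (rule real_dist_normal_dist)
  have "UNIV - {..x} = {x<..}" by auto
  then have "1 - Phi x = prob {x<..}" using prob_compl[of "{..x}"] by (simp add: Phi_def cdf_def)
  also have "\<dots> = (\<integral>z. indicator {x<..} z \<partial>std_normal_distribution)" by simp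
  also have "\<dots> = (\<integral>z. std_normal_density z * indicator {x<..} z \<partial>lborel)"
    by (subst integral_density) auto
  also have "\<dots> = (\<integral>y. std_normal_density (x + y) * indicator {x<..} (x + y) \<partial>lborel)"
    by (subst lborel_integral_real_affine[of 1 _ x]) auto
  also have "\<dots> = (\<integral>y. exp (- x\<^sup>2 / 2) * (std_normal_density y * (exp (- x * y) * indicator {0<..} y)) \<partial>lborel)"
  proof (intro Bochner_Integration.integral_cong refl)
    fix y
    have "std_normal_density (x + y) = exp (- x\<^sup>2 / 2) * (std_normal_density y * exp (- x * y))"
      by (simp add: std_normal_density_def exp_add[symmetric] power2_eq_square field_simps)
    then show "std_normal_density (x + y) * indicator {x<..} (x + y) =
       exp (- x\<^sup>2 / 2) * (std_normal_density y * (exp (- x * y) * indicator {0<..} y))"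
      by (simp add: indicator_def)
  qed
  also have "\<dots> = exp (- x\<^sup>2 / 2) * pos_laplace std_normal_distribution x"
    using pos_laplace_shifted_normal[of 0 x] by (simp add: shifted_normal_0)
  finally show ?thesis .
qed

lemma integrable_laplace_density:
  "x \<ge> 0 \<Longrightarrow> integrable lborel (\<lambda>y. std_normal_density (y - \<mu>) * (exp (- x * y) * indicator {0<..} y))"
proof -
  assume x: "x \<ge> 0"
  have "integrable lborel (\<lambda>y. std_normal_density (- \<mu> + 1 * y))"
    by (rule lborel_integrable_real_affine) auto
  then show ?thesis
    by (rule Bochner_Integration.integrable_bound)
      (use x in \<open>auto simp: indicator_def intro!: mult_right_le_one_le\<close>)
qed

text \<open>Only \<open>y\<close> up to \<open>1 / (1 + x)\<close> is kept; there
  \<open>y \<le> 1\<close> and \<open>x * y \<le> 1\<close>, so the integrand is at least the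
  constant in the numerator. The decay \<open>1 / (1 + x)\<close> is the true order.\<close>

lemma pos_laplace_std_normal_ge:
  assumes "x \<ge> 0"
  shows "std_normal_density 1 * exp (-1) / (1 + x) \<le> pos_laplace std_normal_distribution x"
proof -
  let ?c = "std_normal_density 1 * exp (-1)"
  have "?c / (1 + x) = (\<integral>y. ?c * indicator {0<..1 / (1 + x)} y \<partial>lborel)"
    using assms by simp
  also have "\<dots> \<le> (\<integral>y. std_normal_density (y - 0) * (exp (- x * y) * indicator {0<..} y) \<partial>lborel)"
  proof (rule integral_mono[OF _ integrable_laplace_density[OF assms]])
    fix y
    show "?c * indicator {0<..1 / (1 + x)} y \<le> std_normal_density (y - 0) * (exp (- x * y) * indicator {0<..} y)"
    proof (cases "y \<in> {0<..1 / (1 + x)}")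
      case True
      have "y * (1 + x) \<le> 1" using True assms by (auto simp: field_simps)
      moreover have "0 \<le> x * y" "0 < y" using True assms by auto
      ultimately have "x * y \<le> 1" "y \<le> 1" by (simp_all add: distrib_left mult.commute)
      moreover have "y\<^sup>2 \<le> 1" using True \<open>y \<le> 1\<close> by (simp add: power_le_one)
      ultimately have "std_normal_density 1 * exp (-1) \<le> std_normal_density y * exp (- x * y)"
        unfolding std_normal_density_def by (intro mult_mono) (auto simp: divide_right_mono)
      then show ?thesis using True by simp
    qed (auto simp: indicator_def)
    show "integrable lborel (\<lambda>y. ?c * indicator {0<..1 / (1 + x)} y)"
      using assms by (intro integrable_mult_right integrable_real_indicator) auto
  qed
  also have "\<dots> = pos_laplace std_normal_distribution x"
    using pos_laplace_shifted_normal[of 0 x] by (simp add: shifted_normal_0)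
  finally show ?thesis .
qed

lemma std_normal_density_lipschitz: "\<bar>std_normal_density s - std_normal_density t\<bar> \<le> \<bar>s - t\<bar>"
proof -
  have d: "(std_normal_density has_field_derivative - x * std_normal_density x) (at x within UNIV)" for x
    unfolding std_normal_density_def by (auto intro!: derivative_eq_intros simp: field_simps)
  have "\<bar>- x * std_normal_density x\<bar> \<le> 1" for x
  proof -
    have "1 / sqrt (2 * pi) \<le> 1" using pi_gt3 by (simp add: real_le_rsqrt divide_le_eq)
    have "2 * \<bar>x\<bar> \<le> x\<^sup>2 + 1" using zero_le_power2[of "\<bar>x\<bar> - 1"] by (simp add: power2_eq_square algebra_simps)
    also have "\<dots> \<le> 2 * (1 + x\<^sup>2 / 2)" by simp
    also have "\<dots> \<le> 2 * exp (x\<^sup>2 / 2)" by (intro mult_left_mono exp_ge_add_one_self) auto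
    finally have "\<bar>x\<bar> * exp (- (x\<^sup>2 / 2)) \<le> 1" by (simp add: exp_minus field_simps)
    with \<open>1 / sqrt (2 * pi) \<le> 1\<close> have "(1 / sqrt (2 * pi)) * (\<bar>x\<bar> * exp (- (x\<^sup>2 / 2))) \<le> 1"
      by - (rule mult_le_one, assumption, simp, assumption)
    then show ?thesis by (simp add: std_normal_density_def abs_mult mult_ac)
  qed
  then show ?thesis
    using field_differentiable_bound[OF convex_UNIV d, of 1 s t] by simp
qed

text \<open>The gain \<open>1 / (1 + x)\<close> is essential, since \<open>\<mu>\<close> can later
  be of order \<open>\<delta> * x\<^sup>2\<close>. For \<open>x \<ge> 1\<close> it comes from the
  mass \<open>1 / x\<close> of \<open>exp (- x * y)\<close> and the Lipschitz density; for smaller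
  \<open>x\<close> the Lipschitz bound for \<open>Phi\<close> is enough.\<close>

lemma pos_laplace_shifted_normal_diff:
  assumes x: "x \<ge> 0"
  shows "\<bar>pos_laplace (shifted_normal \<mu>) x - pos_laplace std_normal_distribution x\<bar> \<le> 4 * \<bar>\<mu>\<bar> / (1 + x)"
proof (cases "x \<ge> 1")
  case False
  have "\<bar>cdf (shifted_normal \<mu>) y - cdf (shifted_normal 0) y\<bar> \<le> \<bar>\<mu>\<bar>" for y
    using abs_Phi_diff_le[of "y - \<mu>" y] by (simp add: cdf_shifted_normal)
  from pos_laplace_diff_le[OF real_distribution_shifted_normal real_distribution_shifted_normal x this]
  have "\<bar>pos_laplace (shifted_normal \<mu>) x - pos_laplace std_normal_distribution x\<bar> \<le> 2 * \<bar>\<mu>\<bar>"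
    by (simp add: shifted_normal_0)
  also have "\<dots> \<le> 4 * \<bar>\<mu>\<bar> / (1 + x)"
    using False x mult_left_mono[of "1 + x" 2 "2 * \<bar>\<mu>\<bar>"] by (simp add: field_simps)
  finally show ?thesis .
next
  case True
  let ?k = "\<lambda>y. exp (- x * y) * indicator {0<..} y"
  note i = integrable_laplace_density[OF x]
  have "AE y in lborel. x * ?k y = x * exp (- x * y) * indicator {0..} y"
    using AE_lborel_singleton[of 0] by eventually_elim (auto simp: indicator_def)
  then have k: "has_bochner_integral lborel (\<lambda>y. x * ?k y) 1"
    using has_bochner_integral_exp_tail[of x 0] True
    by (subst has_bochner_integral_cong_AE[where g = "\<lambda>y. x * exp (- x * y) * indicator {0..} y"]) auto
  have "pos_laplace (shifted_normal \<mu>) x - pos_laplace (shifted_normal 0) x =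
     (\<integral>y. std_normal_density (y - \<mu>) * ?k y - std_normal_density (y - 0) * ?k y \<partial>lborel)"
    unfolding pos_laplace_shifted_normal by (subst Bochner_Integration.integral_diff[OF i i]) simp
  then have "\<bar>pos_laplace (shifted_normal \<mu>) x - pos_laplace (shifted_normal 0) x\<bar> \<le>
     (\<integral>y. \<bar>std_normal_density (y - \<mu>) * ?k y - std_normal_density (y - 0) * ?k y\<bar> \<partial>lborel)"
    by (simp only: integral_abs_bound)
  moreover have "(\<integral>y. \<bar>std_normal_density (y - \<mu>) * ?k y - std_normal_density (y - 0) * ?k y\<bar> \<partial>lborel) \<le>
     (\<integral>y. (\<bar>\<mu>\<bar> / x) * (x * ?k y) \<partial>lborel)"
  proof (rule integral_mono)
    show "integrable lborel (\<lambda>y. (\<bar>\<mu>\<bar> / x) * (x * ?k y))"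
      using k by (intro integrable_mult_right) (simp add: has_bochner_integral_iff)
    show "integrable lborel (\<lambda>y. \<bar>std_normal_density (y - \<mu>) * ?k y - std_normal_density (y - 0) * ?k y\<bar>)"
      by (intro integrable_abs Bochner_Integration.integrable_diff i)
    fix y
    have "\<bar>std_normal_density (y - \<mu>) * ?k y - std_normal_density (y - 0) * ?k y\<bar> =
       \<bar>std_normal_density (y - \<mu>) - std_normal_density y\<bar> * ?k y"
      by (simp add: left_diff_distrib[symmetric] abs_mult)
    also have "\<dots> \<le> \<bar>\<mu>\<bar> * ?k y"
      using std_normal_density_lipschitz[of "y - \<mu>" y] by (intro mult_right_mono) auto
    finally show "\<bar>std_normal_density (y - \<mu>) * ?k y - std_normal_density (y - 0) * ?k y\<bar> \<le> (\<bar>\<mu>\<bar> / x) * (x * ?k y)"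
      using True by simp
  qed
  moreover have "(\<integral>y. (\<bar>\<mu>\<bar> / x) * (x * ?k y) \<partial>lborel) = \<bar>\<mu>\<bar> / x" using k by (subst integral_mult_right_zero) (simp add: has_bochner_integral_iff)
  moreover have "\<bar>\<mu>\<bar> / x \<le> 4 * \<bar>\<mu>\<bar> / (1 + x)"
    using True mult_left_mono[of "1 + x" "4 * x" "\<bar>\<mu>\<bar>"] by (simp add: field_simps)
  ultimately show ?thesis unfolding shifted_normal_0 by linarith
qed

section \<open>Moderate deviations from a bounded cumulant generating function\<close>

text \<open>Up to the factor \<open>b * \<delta> * (1 + x)\<close>, the bound for the difference of
  characteristic functions divided by \<open>u\<close>. The exponent -u^2 / 4 instead of -u^2 / 2
  pays for the factor exp (u^2 / 4) that bounds the perturbation.\<close>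

definition smoothing_weight :: "real \<Rightarrow> real" where
  "smoothing_weight u = (\<bar>u\<bar> + u\<^sup>2) / 2 * exp (- u\<^sup>2 / 4)"

lemma integrable_smoothing_weight: "integrable lborel smoothing_weight"
proof -
  have "integrable lborel (\<lambda>u. sqrt (4 * pi) / 2 *
      (normal_density 0 (sqrt 2) u * \<bar>u - 0\<bar> ^ 1 + normal_density 0 (sqrt 2) u * \<bar>u - 0\<bar> ^ 2))"
    by (intro integrable_mult_right Bochner_Integration.integrable_add integrable_normal_moment_abs) auto
  also have "(\<lambda>u. sqrt (4 * pi) / 2 *
      (normal_density 0 (sqrt 2) u * \<bar>u - 0\<bar> ^ 1 + normal_density 0 (sqrt 2) u * \<bar>u - 0\<bar> ^ 2)) = smoothing_weight"
    by (simp add: fun_eq_iff normal_density_def smoothing_weight_def field_simps)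
  finally show ?thesis .
qed

lemma smoothing_weight_nonneg: "0 \<le> smoothing_weight u"
  by (simp add: smoothing_weight_def)

definition weight_mass :: real where
  "weight_mass = (\<integral>u. smoothing_weight u \<partial>lborel)"

section \<open>Cumulants and exponential tilting\<close>

locale pmf_cgf =
  fixes P :: "real pmf" and K :: "complex \<Rightarrow> complex" and \<rho> :: real
  assumes fin: "finite (set_pmf P)"
    and mean: "measure_pmf.expectation P (\<lambda>w. w) = 0"
    and second: "measure_pmf.expectation P (\<lambda>w. w\<^sup>2) = 1"
    and hol: "K holomorphic_on ball 0 \<rho>"
    and exp_K: "\<And>z. z \<in> ball 0 \<rho> \<Longrightarrow> exp (K z) = measure_pmf.expectation P (\<lambda>w. exp (z * of_real w))"
    and K0: "K 0 = 0" and \<rho>: "\<rho> > 0"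
begin

text \<open>The derivative of order \<open>k\<close> of the moment generating function at
  \<open>z\<close>; an ordinary moment only at \<open>z = 0\<close>.\<close>

definition moment :: "nat \<Rightarrow> complex \<Rightarrow> complex" where
  "moment k z = (\<Sum>w\<in>set_pmf P. of_real (pmf P w * w ^ k) * exp (z * of_real w))"

definition cumulant :: "nat \<Rightarrow> complex \<Rightarrow> complex" where
  "cumulant k = (deriv ^^ k) K"

definition skew :: real where
  "skew = measure_pmf.expectation P (\<lambda>w. w ^ 3)"

lemma expectation_eq_sum:
  fixes g :: "real \<Rightarrow> real"
  shows "measure_pmf.expectation P g = (\<Sum>w\<in>set_pmf P. pmf P w * g w)"
  by (subst integral_measure_pmf[of "set_pmf P"]) (use fin in auto)

lemma moment_0: "moment k 0 = of_real (measure_pmf.expectation P (\<lambda>w. w ^ k))"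
  by (simp add: moment_def expectation_eq_sum)

lemma has_field_derivative_moment: "(moment k has_field_derivative moment (Suc k) z) (at z within S)"
  unfolding moment_def
  by (auto intro!: derivative_eq_intros sum.cong simp: mult_ac)

lemma has_field_derivative_cumulant:
  assumes "z \<in> ball 0 \<rho>"
  shows "(cumulant k has_field_derivative cumulant (Suc k) z) (at z within S)"
proof -
  have "cumulant k holomorphic_on ball 0 \<rho>"
    unfolding cumulant_def by (rule holomorphic_higher_deriv[OF hol]) auto
  then have "(cumulant k has_field_derivative deriv (cumulant k) z) (at z)"
    using assms holomorphic_derivI by blast
  then show ?thesis by (simp add: cumulant_def has_field_derivative_at_within)
qed

lemma cumulant_0: "cumulant 0 = K"
  by (simp add: cumulant_def)

lemma exp_K_eq: "z \<in> ball 0 \<rho> \<Longrightarrow> exp (K z) = moment 0 z"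
  unfolding exp_K moment_def
  by (subst integral_measure_pmf[of "set_pmf P"]) (use fin in \<open>auto simp: scaleR_conv_of_real\<close>)

lemma derivative_eq_on_ball:
  assumes "\<And>z. z \<in> ball 0 \<rho> \<Longrightarrow> f z = g z" "z \<in> ball 0 \<rho>"
    and "(f has_field_derivative f') (at z)" "(g has_field_derivative g') (at z)"
  shows "f' = g'"
proof -
  have "(g has_field_derivative f') (at z)"
    using assms by (intro has_field_derivative_transform_within_open[OF assms(3) open_ball assms(2)]) auto
  then show ?thesis using assms(4) DERIV_unique by blast
qed

text \<open>This and the two lemmas after it differentiate \<open>exp (K z) = moment 0 z\<close>
  repeatedly; at 0 they express the cumulants by the moments 0, 1 and the skewness.\<close>

lemma moment_1: 
  assumes z: "z \<in> ball 0 \<rho>"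
  shows "moment 1 z = moment 0 z * cumulant 1 z"
proof -
  have "((\<lambda>z. exp (K z)) has_field_derivative exp (K z) * cumulant 1 z) (at z)"
    using has_field_derivative_cumulant[OF z, of 0 UNIV] by (auto simp: cumulant_0 intro!: derivative_eq_intros)
  from derivative_eq_on_ball[OF exp_K_eq z this has_field_derivative_moment]
  show ?thesis using z by (simp add: exp_K_eq)
qed

lemma moment_2:
  assumes z: "z \<in> ball 0 \<rho>"
  shows "moment 2 z = moment 1 z * cumulant 1 z + moment 0 z * cumulant 2 z"
proof -
  have "((\<lambda>z. moment 0 z * cumulant 1 z) has_field_derivative
      moment 1 z * cumulant 1 z + moment 0 z * cumulant 2 z) (at z)"
    using has_field_derivative_cumulant[OF z, of 1 UNIV] has_field_derivative_moment[of 0 z UNIV]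
    by (auto intro!: derivative_eq_intros simp: numeral_2_eq_2 algebra_simps)
  from derivative_eq_on_ball[OF moment_1 z has_field_derivative_moment this]
  show ?thesis by (simp add: numeral_2_eq_2)
qed

lemma moment_3:
  assumes z: "z \<in> ball 0 \<rho>"
  shows "moment 3 z = moment 2 z * cumulant 1 z + 2 * (moment 1 z * cumulant 2 z) + moment 0 z * cumulant 3 z"
proof -
  have "((\<lambda>z. moment 1 z * cumulant 1 z + moment 0 z * cumulant 2 z) has_field_derivative
      moment 2 z * cumulant 1 z + 2 * (moment 1 z * cumulant 2 z) + moment 0 z * cumulant 3 z) (at z)"
    using has_field_derivative_cumulant[OF z, of 1 UNIV] has_field_derivative_cumulant[OF z, of 2 UNIV]
      has_field_derivative_moment[of 0 z UNIV] has_field_derivative_moment[of 1 z UNIV]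
    by (auto intro!: derivative_eq_intros simp: numeral_2_eq_2 numeral_3_eq_3 algebra_simps)
  from derivative_eq_on_ball[OF moment_2 z has_field_derivative_moment this]
  show ?thesis by (simp add: numeral_2_eq_2 numeral_3_eq_3)
qed

lemma cumulants_at_0: "cumulant 1 0 = 0" "cumulant 2 0 = 1" "cumulant 3 0 = of_real skew"
proof -
  have z: "0 \<in> ball (0 :: complex) \<rho>" using \<rho> by simp
  have m: "moment 0 0 = 1" "moment 1 0 = 0" "moment 2 0 = 1" "moment 3 0 = of_real skew"
    unfolding moment_0 skew_def by (simp_all add: mean second)
  show 1: "cumulant 1 0 = 0" using moment_1[OF z] m by simp
  show 2: "cumulant 2 0 = 1" using moment_2[OF z] m by simp
  show "cumulant 3 0 = of_real skew" using moment_3[OF z] m 1 by simp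
qed

definition mgf :: "real \<Rightarrow> real" where
  "mgf x = (\<Sum>w\<in>set_pmf P. pmf P w * exp (x * w))"

lemma moment_0_of_real: "moment 0 (of_real x) = of_real (mgf x)"
  by (simp add: moment_def mgf_def exp_of_real[symmetric])

lemma mgf_pos: "mgf x > 0"
  unfolding mgf_def by (rule sum_pos) (auto simp: fin set_pmf_not_empty pmf_positive)

text \<open>The law is tilted by \<open>x\<close> itself instead of the saddle point: this shifts the tilted mean away
  from \<open>x\<close> by only \<open>O(\<delta> x\<^sup>2)\<close>, which is harmless at the required precision.\<close>

definition tilt :: "real \<Rightarrow> real pmf" where
  "tilt x = embed_pmf (\<lambda>w. pmf P w * exp (x * w) / mgf x)"

lemma pmf_tilt: "pmf (tilt x) w = pmf P w * exp (x * w) / mgf x"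
  unfolding tilt_def
proof (rule pmf_embed_pmf)
  show "0 \<le> pmf P w * exp (x * w) / mgf x" for w using mgf_pos[of x] by simp
  have "(\<integral>\<^sup>+w. ennreal (pmf P w * exp (x * w) / mgf x) \<partial>count_space UNIV) =
     (\<Sum>w\<in>set_pmf P. ennreal (pmf P w * exp (x * w) / mgf x))"
    using fin by (intro nn_integral_count_space') (auto simp: set_pmf_iff)
  also have "\<dots> = ennreal (\<Sum>w\<in>set_pmf P. pmf P w * exp (x * w) / mgf x)"
    using mgf_pos[of x] by (intro sum_ennreal) auto
  also have "(\<Sum>w\<in>set_pmf P. pmf P w * exp (x * w) / mgf x) = 1"
    using mgf_pos[of x] by (simp add: sum_divide_distrib[symmetric] mgf_def)
  finally show "(\<integral>\<^sup>+w. ennreal (pmf P w * exp (x * w) / mgf x) \<partial>count_space UNIV) = 1" by simp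
qed

lemma set_pmf_tilt: "set_pmf (tilt x) = set_pmf P"
  using mgf_pos[of x] by (auto simp: set_pmf_iff pmf_tilt)

lemma expectation_tilt:
  fixes g :: "real \<Rightarrow> 'b :: {banach, second_countable_topology}"
  shows "measure_pmf.expectation (tilt x) g = (\<Sum>w\<in>set_pmf P. (pmf P w * exp (x * w) / mgf x) *\<^sub>R g w)"
  by (subst integral_measure_pmf[of "set_pmf P"]) (use fin in \<open>auto simp: set_pmf_tilt pmf_tilt\<close>)

text \<open>Centred at \<open>x\<close>, not at its own mean, so that exceeding \<open>x\<close>
  becomes positivity.\<close>

definition tilted_law :: "real \<Rightarrow> real measure" where
  "tilted_law x = distr (measure_pmf (tilt x)) borel (\<lambda>w. w - x)"

lemma real_distribution_tilted_law: "real_distribution (tilted_law x)"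
  unfolding tilted_law_def by (rule prob_space.real_distribution_distr[OF prob_space_measure_pmf]) simp

lemma integrable_tilted_law: "integrable (tilted_law x) (\<lambda>v. v)"
  unfolding tilted_law_def
  by (subst integrable_distr_eq) (auto simp: set_pmf_tilt fin intro!: integrable_measure_pmf_finite)

lemma char_tilted_law:
  assumes "of_real x \<in> ball (0 :: complex) \<rho>" "Complex x u \<in> ball 0 \<rho>"
  shows "char (tilted_law x) u = exp (K (Complex x u) - K (of_real x) - \<i> * of_real (u * x))"
proof -
  have "char (tilted_law x) u = (\<Sum>w\<in>set_pmf P. of_real (pmf P w * exp (x * w) / mgf x) * iexp (u * (w - x)))"
    unfolding char_def tilted_law_def
    by (subst integral_distr) (auto simp: expectation_tilt scaleR_conv_of_real)
  also have "\<dots> = (\<Sum>w\<in>set_pmf P. (of_real (pmf P w) * exp (Complex x u * of_real w)) * (iexp (- (u * x)) / of_real (mgf x)))"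
  proof (rule sum.cong[OF refl])
    fix w
    have "exp (Complex x u * of_real w) * iexp (- (u * x)) = of_real (exp (x * w)) * iexp (u * (w - x))"
      by (simp add: exp_of_real[symmetric] exp_add[symmetric] Complex_eq algebra_simps)
    then show "of_real (pmf P w * exp (x * w) / mgf x) * iexp (u * (w - x)) =
        (of_real (pmf P w) * exp (Complex x u * of_real w)) * (iexp (- (u * x)) / of_real (mgf x))"
      by (simp add: mult.assoc[symmetric])
  qed
  also have "\<dots> = moment 0 (Complex x u) * (iexp (- (u * x)) / moment 0 (of_real x))"
    unfolding moment_0_of_real by (simp add: moment_def sum_distrib_right sum_divide_distrib)
  also have "\<dots> = exp (K (Complex x u) - K (of_real x) - \<i> * of_real (u * x))"
    using assms by (simp add: exp_K_eq[symmetric] exp_diff exp_minus exp_add field_simps)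
  finally show ?thesis .
qed

text \<open>The inverse density of the tilt is \<open>mgf x * exp (- x * w)\<close>; with
  \<open>w = x + v\<close> this is \<open>mgf x * exp (- x\<^sup>2) * exp (- x * v)\<close>.\<close>

lemma tail_eq:
  "measure_pmf.prob P {w. w > x} = mgf x * exp (- x\<^sup>2) * pos_laplace (tilted_law x) x"
proof -
  have "pos_laplace (tilted_law x) x =
     (\<Sum>w\<in>set_pmf P. (pmf P w * exp (x * w) / mgf x) * (exp (- x * (w - x)) * indicator {0<..} (w - x)))"
    unfolding pos_laplace_def tilted_law_def
    by (subst integral_distr) (auto simp: expectation_tilt)
  also have "\<dots> = (\<Sum>w\<in>set_pmf P. pmf P w * indicator {w. w > x} w * (exp (x\<^sup>2) / mgf x))"
  proof (rule sum.cong[OF refl])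
    fix w
    have "exp (x * w) * exp (- x * (w - x)) = exp (x\<^sup>2)"
      by (simp add: exp_add[symmetric] power2_eq_square algebra_simps)
    then show "(pmf P w * exp (x * w) / mgf x) * (exp (- x * (w - x)) * indicator {0<..} (w - x)) =
       pmf P w * indicator {w. w > x} w * (exp (x\<^sup>2) / mgf x)"
      by (auto simp: indicator_def mult.assoc)
  qed
  also have "\<dots> = measure_pmf.expectation P (indicator {w. w > x}) * (exp (x\<^sup>2) / mgf x)"
    by (simp only: expectation_eq_sum sum_distrib_right)
  finally show ?thesis
    using mgf_pos[of x] by (simp add: exp_minus field_simps)
qed


end

text \<open>The radius bound reflects \<open>1 / R \<le> 64 * \<delta>\<close> and the passage to
  the disc of radius \<open>R / 2\<close>. As \<open>b\<close> exceeds 64, the condition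
  \<open>b * \<delta> * s \<le> 1 / 2\<close> puts every \<open>s \<ge> 0\<close> strictly inside
  the disc.\<close>

locale bounded_cgf = pmf_cgf +
  fixes \<delta> b :: real
  assumes \<delta>: "\<delta> > 0" and \<rho>_ge: "1 / (128 * \<delta>) \<le> \<rho>" and b: "b \<ge> 65"
    and third: "\<And>z. z \<in> ball 0 \<rho> \<Longrightarrow> norm ((deriv ^^ 3) K z) \<le> b * \<delta>"
    and fourth: "\<And>z. z \<in> ball 0 \<rho> \<Longrightarrow> norm ((deriv ^^ 4) K z) \<le> b * \<delta>\<^sup>2"
begin

lemma norm_cumulant_3: "z \<in> ball 0 \<rho> \<Longrightarrow> norm (cumulant 3 z) \<le> b * \<delta>"
  and norm_cumulant_4: "z \<in> ball 0 \<rho> \<Longrightarrow> norm (cumulant 4 z) \<le> b * \<delta>\<^sup>2"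
  using third fourth by (auto simp: cumulant_def)

lemma abs_skew_le: "\<bar>skew\<bar> \<le> b * \<delta>"
  using norm_cumulant_3[of 0] \<rho> cumulants_at_0(3) by simp

lemma cumulant_taylor:
  assumes "w \<in> ball 0 \<rho>" "z \<in> ball 0 \<rho>"
    and "\<And>\<zeta>. \<zeta> \<in> ball 0 \<rho> \<Longrightarrow> norm (cumulant (k + Suc n) \<zeta>) \<le> B"
  shows "norm (cumulant k z - (\<Sum>i\<le>n. cumulant (k + i) w * (z - w) ^ i / fact i))
    \<le> B * norm (z - w) ^ Suc n / fact n"
proof -
  have "norm (cumulant (k + 0) z - (\<Sum>i\<le>n. cumulant (k + i) w * (z - w) ^ i / fact i))
    \<le> B * norm (z - w) ^ Suc n / fact n"
    using assms has_field_derivative_cumulant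
    by (intro complex_Taylor[where f = "\<lambda>i. cumulant (k + i)" and S = "ball 0 \<rho>"]) auto
  then show ?thesis by simp
qed

text \<open>Here the main terms of the final formula appear: the cumulants at 0 are 0, 1 and the
  skewness, and the fourth derivative bounds the rest.\<close>

lemma cgf_taylor:
  assumes "of_real x \<in> ball (0 :: complex) \<rho>"
  shows "norm (K (of_real x) - of_real (x\<^sup>2 / 2 + skew * x ^ 3 / 6)) \<le> b * \<delta>\<^sup>2 * x ^ 4 / 6"
proof -
  have "norm (cumulant 0 (of_real x) - (\<Sum>i\<le>3. cumulant (0 + i) 0 * (of_real x - 0) ^ i / fact i))
      \<le> b * \<delta>\<^sup>2 * norm (of_real x - 0 :: complex) ^ Suc 3 / fact 3"
    using assms \<rho> norm_cumulant_4 by (intro cumulant_taylor) auto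
  moreover have "{..3 :: nat} = {0, 1, 2, 3}" by auto
  ultimately show ?thesis
    using cumulants_at_0 by (simp add: cumulant_0 K0 fact_numeral)
qed

lemma mean_taylor:
  assumes "of_real x \<in> ball (0 :: complex) \<rho>"
  shows "norm (cumulant 1 (of_real x) - of_real x) \<le> b * \<delta> * x\<^sup>2"
proof -
  have "norm (cumulant 1 (of_real x) - (\<Sum>i\<le>1. cumulant (1 + i) 0 * (of_real x - 0) ^ i / fact i))
      \<le> b * \<delta> * norm (of_real x - 0 :: complex) ^ Suc 1 / fact 1"
    using assms \<rho> norm_cumulant_3 by (intro cumulant_taylor) (auto simp: numeral_3_eq_3)
  then show ?thesis
    using cumulants_at_0 by (simp add: numeral_2_eq_2)
qed

lemma variance_taylor:
  assumes "of_real x \<in> ball (0 :: complex) \<rho>"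
  shows "norm (cumulant 2 (of_real x) - 1) \<le> b * \<delta> * \<bar>x\<bar>"
proof -
  have "norm (cumulant 2 (of_real x) - (\<Sum>i\<le>0. cumulant (2 + i) 0 * (of_real x - 0) ^ i / fact i))
      \<le> b * \<delta> * norm (of_real x - 0 :: complex) ^ Suc 0 / fact 0"
    using assms \<rho> norm_cumulant_3 by (intro cumulant_taylor) (auto simp: numeral_3_eq_3)
  then show ?thesis
    using cumulants_at_0 by simp
qed

lemma cgf_taylor_at:
  assumes "of_real x \<in> ball (0 :: complex) \<rho>" "Complex x u \<in> ball 0 \<rho>"
  shows "norm (K (Complex x u) - (K (of_real x) + cumulant 1 (of_real x) * (\<i> * of_real u)
      - cumulant 2 (of_real x) * of_real (u\<^sup>2 / 2))) \<le> b * \<delta> * \<bar>u\<bar> ^ 3 / 2"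
proof -
  have "Complex x u - of_real x = \<i> * of_real u" by (simp add: Complex_eq)
  moreover have "norm (cumulant 0 (Complex x u) - (\<Sum>i\<le>2. cumulant (0 + i) (of_real x) * (Complex x u - of_real x) ^ i / fact i))
      \<le> b * \<delta> * norm (Complex x u - of_real x) ^ Suc 2 / fact 2"
    using assms norm_cumulant_3 by (intro cumulant_taylor) auto
  moreover have "{..2 :: nat} = {0, 1, 2}" by auto
  ultimately show ?thesis
    by (simp add: cumulant_0 fact_numeral norm_mult power_mult_distrib algebra_simps)
qed

definition tilted_mean :: "real \<Rightarrow> real" where
  "tilted_mean x = Re (cumulant 1 (of_real x))"

text \<open>At a real point the first cumulant is a quotient of real sums, the mean of the tilted
  law before centring, so \<open>Re\<close> in \<open>tilted_mean\<close> loses nothing.\<close>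

lemma cumulant_1_of_real:
  assumes "of_real x \<in> ball (0 :: complex) \<rho>"
  shows "cumulant 1 (of_real x) = of_real (tilted_mean x)"
proof -
  have "moment 1 (of_real x) = of_real (\<Sum>w\<in>set_pmf P. pmf P w * w * exp (x * w))"
    by (simp add: moment_def exp_of_real[symmetric])
  then have "cumulant 1 (of_real x) = of_real ((\<Sum>w\<in>set_pmf P. pmf P w * w * exp (x * w)) / mgf x)"
    using moment_1[OF assms] mgf_pos[of x] by (simp add: moment_0_of_real field_simps)
  then show ?thesis by (simp add: tilted_mean_def)
qed

text \<open>After matching the mean, the two exponents differ by \<open>\<zeta>\<close>: the
  variance is off by at most \<open>b * \<delta> * x\<close> and the cubic remainder is at most
  \<open>b * \<delta> * u ^ 3 / 2\<close>. The restrictions on \<open>x\<close> and \<open>u\<close>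
  keep \<open>norm \<zeta>\<close> at most \<open>u\<^sup>2 / 4\<close>, so half of the Gaussian
  exponent survives.\<close>

lemma char_tilted_law_close:
  assumes x: "0 \<le> x" "b * \<delta> * x \<le> 1 / 4" and u: "0 < u" "b * \<delta> * u \<le> 1 / 4"
  shows "cmod (char (tilted_law x) u - char (shifted_normal (tilted_mean x - x)) u)
     \<le> u * (b * \<delta> * (1 + x) * smoothing_weight u)"
proof -
  have "65 * \<delta> * (x + u) \<le> b * \<delta> * (x + u)"
    using b \<delta> x u by (intro mult_right_mono) auto
  also have "\<dots> \<le> 1 / 2" using x u by (simp add: algebra_simps)
  finally have "x + u < 1 / (128 * \<delta>)" using \<delta> x u by (simp add: field_simps)
  then have "x + u < \<rho>" using \<rho>_ge by simp
  then have ball: "of_real x \<in> ball (0 :: complex) \<rho>" "Complex x u \<in> ball 0 \<rho>"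
    using x u cmod_le[of "Complex x u"] by auto
  define m where "m = tilted_mean x"
  define \<zeta> where "\<zeta> = K (Complex x u) - K (of_real x) - \<i> * of_real (u * m) + of_real (u\<^sup>2 / 2)"
  have "norm \<zeta> \<le> b * \<delta> * u ^ 3 / 2 + b * \<delta> * x * (u\<^sup>2 / 2)"
  proof -
    have "\<zeta> = (K (Complex x u) - (K (of_real x) + cumulant 1 (of_real x) * (\<i> * of_real u)
      - cumulant 2 (of_real x) * of_real (u\<^sup>2 / 2))) - (cumulant 2 (of_real x) - 1) * of_real (u\<^sup>2 / 2)"
      unfolding \<zeta>_def m_def cumulant_1_of_real[OF ball(1)]
      by (simp add: algebra_simps del: of_real_divide of_real_power)
    also have "norm \<dots> \<le> b * \<delta> * \<bar>u\<bar> ^ 3 / 2 + b * \<delta> * \<bar>x\<bar> * (u\<^sup>2 / 2)"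
      using variance_taylor[OF ball(1)]
      by (intro norm_triangle_le_diff add_mono cgf_taylor_at[OF ball])
        (auto simp: norm_mult intro!: mult_right_mono divide_right_mono simp del: of_real_divide)
    finally show ?thesis using x u by simp
  qed
  also have "\<dots> = u\<^sup>2 / 2 * (b * \<delta> * u + b * \<delta> * x)"
    by (simp add: algebra_simps power2_eq_square power3_eq_cube)
  finally have \<zeta>1: "norm \<zeta> \<le> u\<^sup>2 / 2 * (b * \<delta> * u + b * \<delta> * x)" .
  also have "\<dots> \<le> u\<^sup>2 / 2 * (1 / 2)" using x u by (intro mult_left_mono) auto
  finally have \<zeta>2: "norm \<zeta> \<le> u\<^sup>2 / 4" by simp
  have "char (tilted_law x) u = iexp (u * (m - x)) * (exp (of_real (- u\<^sup>2 / 2)) * exp \<zeta>)"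
    unfolding char_tilted_law[OF ball] \<zeta>_def by (simp add: exp_add[symmetric] algebra_simps)
  then have "char (tilted_law x) u - char (shifted_normal (m - x)) u =
      iexp (u * (m - x)) * of_real (exp (- u\<^sup>2 / 2)) * (exp \<zeta> - 1)"
    unfolding char_shifted_normal exp_of_real[symmetric] by (simp add: algebra_simps)
  then have "cmod (char (tilted_law x) u - char (shifted_normal (m - x)) u) = exp (- u\<^sup>2 / 2) * norm (exp \<zeta> - 1)"
    by (simp add: norm_mult)
  also have "norm (exp \<zeta> - 1) \<le> exp (norm \<zeta>) * norm \<zeta>"
    using Taylor_exp_field[of \<zeta> 0] by simp
  also have "exp (norm \<zeta>) * norm \<zeta> \<le> exp (u\<^sup>2 / 4) * (u\<^sup>2 / 2 * (b * \<delta> * u + b * \<delta> * x))"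
    using \<zeta>1 \<zeta>2 by (intro mult_mono) auto
  also have "exp (- u\<^sup>2 / 2) * (exp (u\<^sup>2 / 4) * (u\<^sup>2 / 2 * (b * \<delta> * u + b * \<delta> * x))) =
     exp (- u\<^sup>2 / 4) * (u\<^sup>2 / 2 * (b * \<delta> * (u + x)))"
    by (simp add: mult.assoc[symmetric] exp_add[symmetric] distrib_left)
  \<comment> \<open>\<open>u + x \<le> (1 + x) * (1 + u)\<close> separates the dependence on
    \<open>x\<close> from an integrable function of \<open>u\<close>.\<close>
  also have "\<dots> \<le> exp (- u\<^sup>2 / 4) * (u\<^sup>2 / 2 * (b * \<delta> * ((1 + x) * (1 + u))))"
    using x u b \<delta> by (intro mult_left_mono) (auto simp: algebra_simps)
  also have "\<dots> = u * (b * \<delta> * (1 + x) * smoothing_weight u)"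
    using u by (simp add: smoothing_weight_def power2_eq_square algebra_simps)
  finally show ?thesis by (simp add: m_def mult_left_mono)
qed


lemma of_real_in_ball:
  assumes "0 \<le> x" "b * \<delta> * x \<le> 1 / 4"
  shows "of_real x \<in> ball (0 :: complex) \<rho>"
proof -
  have "65 * \<delta> * x \<le> b * \<delta> * x" using b \<delta> assms by (intro mult_right_mono) auto
  also have "\<dots> < 1 / 2" using assms by simp
  finally have "x < 1 / (128 * \<delta>)" using \<delta> assms by (simp add: field_simps)
  then show ?thesis using assms \<rho>_ge by simp
qed

lemma cdf_tilted_law_close:
  assumes C: "esseen_bound C" and x: "0 \<le> x" "b * \<delta> * x \<le> 1 / 4"
  shows "\<bar>cdf (tilted_law x) y - cdf (shifted_normal (tilted_mean x - x)) y\<bar>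
    \<le> C * b * (weight_mass + 4) * (\<delta> * (1 + x))"
proof -
  \<comment> \<open>\<open>?T\<close> is the largest frequency that
    \<open>char_tilted_law_close\<close> admits; the resulting
    \<open>1 / ?T = 4 * b * \<delta>\<close> is of the order of the error anyway.\<close>
  let ?h = "\<lambda>u. b * \<delta> * (1 + x) * smoothing_weight u" and ?T = "1 / (4 * b * \<delta>)"
  have b\<delta>: "b * \<delta> > 0" using b \<delta> by simp
  have "\<bar>cdf (tilted_law x) y - cdf (shifted_normal (tilted_mean x - x)) y\<bar> \<le>
     C * ((\<integral>u. ?h u \<partial>lborel) + 1 / ?T)"
  proof (rule C[unfolded esseen_bound_def, THEN conjunct2, rule_format])
    show "real_distribution (tilted_law x)" "real_distribution (shifted_normal (tilted_mean x - x))"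
      "integrable (tilted_law x) (\<lambda>x. x)" "integrable (shifted_normal (tilted_mean x - x)) (\<lambda>x. x)"
      by (rule real_distribution_tilted_law real_distribution_shifted_normal
          integrable_tilted_law integrable_shifted_normal)+
    show "cdf (shifted_normal (tilted_mean x - x)) t - cdf (shifted_normal (tilted_mean x - x)) s \<le> t - s"
      if "s \<le> t" for s t
      unfolding cdf_shifted_normal using Phi_diff_le[of "s - (tilted_mean x - x)" "t - (tilted_mean x - x)"] that by simp
    show "?T > 0" using b \<delta> by simp
    show "integrable lborel ?h" by (intro integrable_mult_right integrable_smoothing_weight)
    show "0 \<le> ?h u" for u using b\<delta> x smoothing_weight_nonneg by simp
    show "cmod (char (tilted_law x) u - char (shifted_normal (tilted_mean x - x)) u) \<le> u * ?h u"
      if "0 < u" "u \<le> ?T" for u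
      using that b\<delta> by (intro char_tilted_law_close x) (auto simp: field_simps)
  qed
  also have "\<dots> = C * (b * \<delta> * (1 + x) * weight_mass + 4 * b * \<delta>)" by (simp add: weight_mass_def)
  also have "\<dots> \<le> C * (b * \<delta> * (1 + x) * weight_mass + 4 * b * \<delta> * (1 + x))"
    using C x b \<delta> by (intro mult_left_mono add_left_mono) (auto simp: esseen_bound_def algebra_simps)
  also have "\<dots> = C * b * (weight_mass + 4) * (\<delta> * (1 + x))" by (simp add: algebra_simps)
  finally show ?thesis .
qed

text \<open>Replacing the mean \<open>\<mu>\<close> by 0 costs
  \<open>4 * \<bar>\<mu>\<bar> / (1 + x)\<close> with \<open>\<bar>\<mu>\<bar>\<close> at most
  \<open>b * \<delta> * x\<^sup>2\<close>; so not using the saddle point adds an error of the same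
  order as the one from Esseen's inequality.\<close>

lemma pos_laplace_tilted_law_close:
  assumes C: "esseen_bound C" and x: "0 \<le> x" "b * \<delta> * x \<le> 1 / 4"
  shows "\<bar>pos_laplace (tilted_law x) x - pos_laplace std_normal_distribution x\<bar>
    \<le> (2 * C * b * (weight_mass + 4) + 4 * b) * (\<delta> * (1 + x))"
proof -
  define \<mu> where "\<mu> = tilted_mean x - x"
  have ball: "of_real x \<in> ball (0 :: complex) \<rho>" by (rule of_real_in_ball[OF x])
  have "of_real \<mu> = cumulant 1 (of_real x) - of_real x"
    unfolding \<mu>_def cumulant_1_of_real[OF ball] by simp
  then have "norm (complex_of_real \<mu>) \<le> b * \<delta> * x\<^sup>2"
    using mean_taylor[OF ball] by metis
  then have "4 * \<bar>\<mu>\<bar> / (1 + x) \<le> 4 * (b * \<delta> * x\<^sup>2) / (1 + x)"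
    using x by (intro divide_right_mono) auto
  also have "\<dots> \<le> 4 * (b * \<delta> * (1 + x)\<^sup>2) / (1 + x)"
    using x b \<delta> by (intro divide_right_mono mult_left_mono power_mono) auto
  also have "\<dots> = 4 * b * (\<delta> * (1 + x))" using x by (simp add: power2_eq_square)
  finally have 1: "4 * \<bar>\<mu>\<bar> / (1 + x) \<le> 4 * b * (\<delta> * (1 + x))" .
  have 2: "\<bar>pos_laplace (tilted_law x) x - pos_laplace (shifted_normal \<mu>) x\<bar> \<le>
     2 * (C * b * (weight_mass + 4) * (\<delta> * (1 + x)))"
    unfolding \<mu>_def
    by (intro pos_laplace_diff_le real_distribution_tilted_law real_distribution_shifted_normal
        cdf_tilted_law_close assms)
  show ?thesis
    using 1 2 pos_laplace_shifted_normal_diff[OF x(1), of \<mu>] by (simp add: algebra_simps)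
qed

definition tail_ratio :: "real \<Rightarrow> real" where
  "tail_ratio x = measure_pmf.prob P {w. w > x} / ((1 - Phi x) * exp (skew * x ^ 3 / 6))"

text \<open>The ratio is \<open>exp \<theta> * (J / I)\<close>. As \<open>I\<close> is at least of
  order \<open>1 / (1 + x)\<close>, the absolute error \<open>\<delta> * (1 + x)\<close> of
  \<open>J\<close> becomes a relative error \<open>\<delta> * (1 + x)\<^sup>2\<close>;
  \<open>\<theta>\<close> is the fourth order remainder of the cumulant generating function.\<close>

lemma tail_ratio_small:
  assumes C: "esseen_bound C" and x: "0 \<le> x" "b * \<delta> * x \<le> 1 / 4" and D: "x\<^sup>2 * \<delta> \<le> D"
  defines "c0 \<equiv> std_normal_density 1 * exp (-1)"
  shows "\<bar>tail_ratio x - 1\<bar> \<le>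
    exp (b * D\<^sup>2) * (2 * (2 * C * b * (weight_mass + 4) + 4 * b) / c0 + b * D) * (\<delta> * (1 + x\<^sup>2))"
proof -
  define C3 where "C3 = 2 * C * b * (weight_mass + 4) + 4 * b"
  have "weight_mass \<ge> 0"
    unfolding weight_mass_def by (intro Bochner_Integration.integral_nonneg smoothing_weight_nonneg)
  then have "C3 \<ge> 0" using C b by (simp add: C3_def esseen_bound_def)
  have c0: "c0 > 0" by (simp add: c0_def normal_density_pos)
  have ball: "of_real x \<in> ball (0 :: complex) \<rho>" by (rule of_real_in_ball[OF x])
  define I where "I = pos_laplace std_normal_distribution x"
  define J where "J = pos_laplace (tilted_law x) x"
  define \<theta> where "\<theta> = Re (K (of_real x)) - (x\<^sup>2 / 2 + skew * x ^ 3 / 6)"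
  have I: "c0 / (1 + x) \<le> I" unfolding I_def c0_def by (rule pos_laplace_std_normal_ge[OF x(1)])
  then have "I > 0" using c0 x by (meson divide_pos_pos less_le_trans add_pos_nonneg zero_less_one)
  have mgf: "mgf x = exp (Re (K (of_real x)))"
    using arg_cong[OF exp_K_eq[OF ball], of norm] mgf_pos[of x] by (simp add: moment_0_of_real)
  have "tail_ratio x = exp (Re (K (of_real x))) * exp (- x\<^sup>2) * J / (exp (- x\<^sup>2 / 2) * I * exp (skew * x ^ 3 / 6))"
    unfolding tail_ratio_def tail_eq one_minus_Phi_eq mgf I_def J_def ..
  also have "\<dots> = exp (Re (K (of_real x))) * exp (- x\<^sup>2) * exp (x\<^sup>2 / 2) * exp (- (skew * x ^ 3 / 6)) * (J / I)"
    by (simp add: exp_minus field_simps)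
  also have "exp (Re (K (of_real x))) * exp (- x\<^sup>2) * exp (x\<^sup>2 / 2) * exp (- (skew * x ^ 3 / 6)) = exp \<theta>"
    by (simp add: exp_add[symmetric] \<theta>_def)
  finally have ratio: "tail_ratio x = exp \<theta> * (J / I)" .
  have "D \<ge> 0" using D \<delta> by (meson order_trans mult_nonneg_nonneg zero_le_power2 less_imp_le)
  have "\<bar>\<theta>\<bar> \<le> norm (K (of_real x) - of_real (x\<^sup>2 / 2 + skew * x ^ 3 / 6))"
    unfolding \<theta>_def using abs_Re_le_cmod[of "K (of_real x) - of_real (x\<^sup>2 / 2 + skew * x ^ 3 / 6)"]
    by (simp only: minus_complex.sel Re_complex_of_real)
  also have "\<dots> \<le> b * \<delta>\<^sup>2 * x ^ 4 / 6" by (rule cgf_taylor[OF ball])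
  also have "\<dots> \<le> b * \<delta>\<^sup>2 * x ^ 4" using b by simp
  also have "\<dots> = b * (x\<^sup>2 * \<delta>) * (x\<^sup>2 * \<delta>)" by (simp add: power2_eq_square power4_eq_xxxx)
  finally have th: "\<bar>\<theta>\<bar> \<le> b * (x\<^sup>2 * \<delta>) * (x\<^sup>2 * \<delta>)" .
  \<comment> \<open>One factor \<open>x\<^sup>2 * \<delta>\<close> is replaced by \<open>D\<close>
    to get a linear bound, then also the other one to keep \<open>exp \<theta>\<close>
    bounded.\<close>
  also have "\<dots> \<le> b * D * (x\<^sup>2 * \<delta>)"
    using D b \<delta> by (intro mult_right_mono mult_left_mono) auto
  finally have th1: "\<bar>\<theta>\<bar> \<le> b * D * (x\<^sup>2 * \<delta>)" .
  also have "\<dots> \<le> b * D * D" using D b \<open>D \<ge> 0\<close> by (intro mult_left_mono) auto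
  finally have th2: "\<bar>\<theta>\<bar> \<le> b * D\<^sup>2" by (simp add: power2_eq_square mult.assoc)
  have "\<bar>J / I - 1\<bar> = \<bar>J - I\<bar> / I" using \<open>I > 0\<close> by (simp add: field_simps abs_divide)
  also have "\<dots> \<le> C3 * (\<delta> * (1 + x)) / (c0 / (1 + x))"
    using pos_laplace_tilted_law_close[OF C x] I c0 x \<open>C3 \<ge> 0\<close> \<delta> unfolding I_def[symmetric] J_def[symmetric] C3_def[symmetric]
    by (intro frac_le) auto
  also have "\<dots> = C3 / c0 * \<delta> * (1 + x)\<^sup>2" by (simp add: power2_eq_square)
  also have "\<dots> \<le> C3 / c0 * \<delta> * (2 * (1 + x\<^sup>2))"
    using \<open>C3 \<ge> 0\<close> c0 \<delta> zero_le_power2[of "x - 1"]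
    by (intro mult_left_mono) (auto simp: power2_eq_square algebra_simps)
  finally have JI: "\<bar>J / I - 1\<bar> \<le> 2 * C3 / c0 * (\<delta> * (1 + x\<^sup>2))" by (simp add: mult_ac)
  have "\<bar>exp \<theta> - 1\<bar> \<le> exp \<bar>\<theta>\<bar> * \<bar>\<theta>\<bar>" using Taylor_exp_field[of \<theta> 0] by simp
  also have "\<dots> \<le> exp (b * D\<^sup>2) * (b * D * (x\<^sup>2 * \<delta>))"
    using th1 th2 by (intro mult_mono) auto
  also have "\<dots> \<le> exp (b * D\<^sup>2) * (b * D * (\<delta> * (1 + x\<^sup>2)))"
    using b \<open>D \<ge> 0\<close> \<delta> by (intro mult_left_mono) (auto simp: algebra_simps)
  finally have e1: "\<bar>exp \<theta> - 1\<bar> \<le> exp (b * D\<^sup>2) * (b * D * (\<delta> * (1 + x\<^sup>2)))" .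
  have "\<theta> \<le> b * D\<^sup>2" using th2 by linarith
  then have "exp \<theta> * \<bar>J / I - 1\<bar> \<le> exp (b * D\<^sup>2) * (2 * C3 / c0 * (\<delta> * (1 + x\<^sup>2)))"
    using JI by (intro mult_mono) auto
  moreover have "\<bar>tail_ratio x - 1\<bar> \<le> exp \<theta> * \<bar>J / I - 1\<bar> + \<bar>exp \<theta> - 1\<bar>"
  proof -
    have "tail_ratio x - 1 = exp \<theta> * (J / I - 1) + (exp \<theta> - 1)" unfolding ratio by (simp add: algebra_simps)
    then show ?thesis by (metis abs_triangle_ineq abs_mult abs_exp_cancel)
  qed
  moreover have "exp (b * D\<^sup>2) * (2 * C3 / c0 + b * D) * (\<delta> * (1 + x\<^sup>2)) =
      exp (b * D\<^sup>2) * (2 * C3 / c0 * (\<delta> * (1 + x\<^sup>2))) + exp (b * D\<^sup>2) * (b * D * (\<delta> * (1 + x\<^sup>2)))"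
    by (simp only: distrib_left distrib_right mult.assoc)
  ultimately show ?thesis using e1 unfolding C3_def[symmetric] by linarith
qed

text \<open>\<open>c1\<close> bounds the denominator from below for \<open>x \<le> X\<close>: the
  first two factors bound the normal tail, and the cubic exponent is at least
  \<open>- (b * D * X)\<close>. The ratio is then bounded, while
  \<open>\<delta> * (1 + x\<^sup>2)\<close> is at least \<open>\<delta>0\<close>.\<close>

lemma tail_ratio_large:
  assumes x: "0 \<le> x" and D: "x\<^sup>2 * \<delta> \<le> D" and \<delta>0: "0 < \<delta>0" "\<delta>0 \<le> \<delta>"
  defines "X \<equiv> sqrt (D / \<delta>0)" and "c0 \<equiv> std_normal_density 1 * exp (-1)"
  defines "c1 \<equiv> exp (- X\<^sup>2 / 2) * (c0 / (1 + X)) * exp (- (b * D * X))"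
  shows "\<bar>tail_ratio x - 1\<bar> \<le> (1 / c1 + 1) / \<delta>0 * (\<delta> * (1 + x\<^sup>2))"
proof -
  have c0: "c0 > 0" by (simp add: c0_def normal_density_pos)
  have "D \<ge> 0" using D \<delta> by (meson order_trans mult_nonneg_nonneg zero_le_power2 less_imp_le)
  have "x\<^sup>2 * \<delta>0 \<le> D" using D \<delta>0 mult_left_mono[of \<delta>0 \<delta> "x\<^sup>2"] by simp
  then have "x \<le> X" using \<delta>0 x by (auto simp: X_def field_simps intro!: real_le_rsqrt)
  have "X \<ge> 0" using x \<open>x \<le> X\<close> by simp
  have "c1 > 0" using c0 \<open>X \<ge> 0\<close> by (simp add: c1_def)
  have "\<bar>skew * x ^ 3 / 6\<bar> \<le> \<bar>skew\<bar> * x ^ 3" using x by (simp add: abs_mult)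
  also have "\<dots> \<le> b * \<delta> * x ^ 3" using abs_skew_le x by (intro mult_right_mono) auto
  also have "\<dots> = b * (x\<^sup>2 * \<delta>) * x" by (simp add: power2_eq_square power3_eq_cube)
  also have "\<dots> \<le> b * D * X" using b D \<open>D \<ge> 0\<close> \<open>x \<le> X\<close> x \<delta> by (intro mult_mono) auto
  finally have "- (b * D * X) \<le> skew * x ^ 3 / 6" by linarith
  then have e: "exp (- (b * D * X)) \<le> exp (skew * x ^ 3 / 6)" by simp
  have "exp (- X\<^sup>2 / 2) * (c0 / (1 + X)) \<le> exp (- x\<^sup>2 / 2) * pos_laplace std_normal_distribution x"
  proof (intro mult_mono)
    show "exp (- X\<^sup>2 / 2) \<le> exp (- x\<^sup>2 / 2)" using \<open>x \<le> X\<close> x by (simp add: power_mono)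
    have "c0 / (1 + X) \<le> c0 / (1 + x)" using c0 x \<open>x \<le> X\<close> by (intro divide_left_mono) auto
    also have "\<dots> \<le> pos_laplace std_normal_distribution x"
      unfolding c0_def by (rule pos_laplace_std_normal_ge[OF x])
    finally show "c0 / (1 + X) \<le> pos_laplace std_normal_distribution x" .
  qed (use c0 \<open>X \<ge> 0\<close> in auto)
  then have "c1 \<le> (1 - Phi x) * exp (skew * x ^ 3 / 6)"
    unfolding c1_def one_minus_Phi_eq
  proof (rule mult_mono[OF _ e])
    have "0 \<le> exp (- X\<^sup>2 / 2) * (c0 / (1 + X))" using c0 \<open>X \<ge> 0\<close> by simp
    also note \<open>exp (- X\<^sup>2 / 2) * (c0 / (1 + X)) \<le> exp (- x\<^sup>2 / 2) * pos_laplace std_normal_distribution x\<close>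
    finally show "0 \<le> exp (- x\<^sup>2 / 2) * pos_laplace std_normal_distribution x" .
  qed simp
  then have "tail_ratio x \<le> 1 / c1" "tail_ratio x \<ge> 0"
    unfolding tail_ratio_def using \<open>c1 > 0\<close> by (intro frac_le divide_nonneg_nonneg; simp)+
  then have "\<bar>tail_ratio x - 1\<bar> \<le> (1 / c1 + 1) * 1" using \<open>c1 > 0\<close> by (simp add: abs_le_iff)
  also have "\<dots> \<le> (1 / c1 + 1) * ((\<delta> * (1 + x\<^sup>2)) / \<delta>0)"
  proof (rule mult_left_mono)
    have "\<delta>0 * 1 \<le> \<delta> * (1 + x\<^sup>2)" using \<delta>0 by (intro mult_mono) auto
    then show "1 \<le> (\<delta> * (1 + x\<^sup>2)) / \<delta>0" using \<delta>0 by (simp add: field_simps)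
  qed (use \<open>c1 > 0\<close> in simp)
  finally show ?thesis by simp
qed

end


section \<open>From a bounded logarithm on a disc to the tail estimate\<close>

lemma higher_deriv_bound:
  assumes "K holomorphic_on ball 0 R" "\<And>z. z \<in> ball 0 R \<Longrightarrow> norm (K z) \<le> M" "z \<in> ball (0 :: complex) (R / 2)"
  shows "norm ((deriv ^^ n) K z) \<le> fact n * M / (R / 2) ^ n"
proof (rule Cauchy_inequality)
  have sub: "cball z (R / 2) \<subseteq> ball 0 R"
  proof
    fix y assume "y \<in> cball z (R / 2)"
    then have "norm (y - z) \<le> R / 2" by (simp add: dist_norm norm_minus_commute)
    then show "y \<in> ball 0 R" using assms(3) norm_triangle_ineq[of z "y - z"] by simp
  qed
  show "K holomorphic_on ball z (R / 2)"
    using sub ball_subset_cball by (intro holomorphic_on_subset[OF assms(1)]) blast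
  show "continuous_on (cball z (R / 2)) K"
    using sub by (intro continuous_on_subset[OF holomorphic_on_imp_continuous_on[OF assms(1)]])
  show "0 < R / 2" using assms(3) norm_ge_zero[of z] by (auto simp del: norm_ge_zero)
  show "norm (K x) \<le> M" if "norm (z - x) = R / 2" for x
    using sub that by (intro assms(2)) (auto simp: dist_norm)
qed

text \<open>All quantitative information on the law is reduced to
  \<open>M\<^sup>2 / R ^ 5 \<le> \<delta>\<close>. This single condition suffices because variance 1
  makes \<open>M\<close> at least \<open>R\<^sup>2 / 8\<close>.\<close>

lemma moderate_deviation:
  fixes D :: real
  assumes "D \<ge> 0"
  obtains C where "C \<ge> 0"
    "\<And>P K R M \<delta> x. pmf_cgf P K R \<Longrightarrow> (\<And>z. z \<in> ball 0 R \<Longrightarrow> norm (K z) \<le> M) \<Longrightarrow>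
       M\<^sup>2 / R ^ 5 \<le> \<delta> \<Longrightarrow> 0 \<le> x \<Longrightarrow> x\<^sup>2 * \<delta> \<le> D \<Longrightarrow>
       \<bar>measure_pmf.prob P {w. w > x} /
         ((1 - Phi x) * exp (measure_pmf.expectation P (\<lambda>w. w ^ 3) * x ^ 3 / 6)) - 1\<bar> \<le> C * (\<delta> * (1 + x\<^sup>2))"
proof -
  obtain CE where CE: "esseen_bound CE" using ex_esseen_bound by blast
  \<comment> \<open>any \<open>b \<ge> 384 * 512\<close> will do, by the Cauchy estimates for the third and fourth derivatives below\<close>
  define b :: real where "b = 200000"
  \<comment> \<open>Chosen so that \<open>\<delta> \<le> \<delta>0\<close> and
    \<open>x\<^sup>2 * \<delta> \<le> D\<close> force \<open>b * \<delta> * x \<le> 1 / 4\<close>;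
    \<open>D + 1\<close> avoids division by 0.\<close>
  define \<delta>0 where "\<delta>0 = 1 / (16 * b\<^sup>2 * (D + 1))"
  have \<delta>0: "\<delta>0 > 0" using assms by (simp add: \<delta>0_def b_def)
  define c0 where "c0 = std_normal_density 1 * exp (-1)"
  define X where "X = sqrt (D / \<delta>0)"
  define c1 where "c1 = exp (- X\<^sup>2 / 2) * (c0 / (1 + X)) * exp (- (b * D * X))"
  define C1 where "C1 = exp (b * D\<^sup>2) * (2 * (2 * CE * b * (weight_mass + 4) + 4 * b) / c0 + b * D)"
  define C2 where "C2 = (1 / c1 + 1) / \<delta>0"
  show ?thesis
  proof (rule that[of "max 0 (max C1 C2)"])
    fix P :: "real pmf" and K R M \<delta> x
    assume cgf: "pmf_cgf P K R" and M: "\<And>z. z \<in> ball 0 R \<Longrightarrow> norm (K z) \<le> M"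
      and \<delta>: "M\<^sup>2 / R ^ 5 \<le> \<delta>" and x: "0 \<le> x" "x\<^sup>2 * \<delta> \<le> D"
    interpret cgf: pmf_cgf P K R by fact
    have R: "R > 0" by (rule cgf.\<rho>)
    note bd = higher_deriv_bound[OF cgf.hol M]
    \<comment> \<open>The second derivative at 0 is the variance 1, so its Cauchy estimate is an
      inequality between \<open>R\<close> and \<open>M\<close>.\<close>
    have "norm (cgf.cumulant 2 0) \<le> fact 2 * M / (R / 2) ^ 2"
      unfolding cgf.cumulant_def using R by (intro bd) auto
    then have M8: "R\<^sup>2 \<le> 8 * M" using R cgf.cumulants_at_0(2) by (simp add: field_simps power2_eq_square)
    then have "M > 0" using R zero_less_power[OF R, of 2] by linarith
    have m3: "M / R ^ 3 \<le> 8 * \<delta>"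
    proof -
      have "M / R ^ 3 = M * R\<^sup>2 / R ^ 5" using R by (simp add: field_simps eval_nat_numeral)
      also have "\<dots> \<le> M * (8 * M) / R ^ 5" using M8 R \<open>M > 0\<close> by (intro divide_right_mono mult_left_mono) auto
      also have "\<dots> = 8 * (M\<^sup>2 / R ^ 5)" by (simp add: power2_eq_square)
      finally show ?thesis using \<delta> by simp
    qed
    have m1: "1 / R \<le> 64 * \<delta>"
    proof -
      have "1 / R = (R\<^sup>2)\<^sup>2 / R ^ 5" using R by (simp add: field_simps eval_nat_numeral)
      also have "\<dots> \<le> (8 * M)\<^sup>2 / R ^ 5" using M8 R by (intro divide_right_mono power_mono) auto
      also have "\<dots> = 64 * (M\<^sup>2 / R ^ 5)" by (simp add: power_mult_distrib)
      finally show ?thesis using \<delta> by simp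
    qed
    have "0 < 1 / R" using R by simp
    then have "\<delta> > 0" using m1 by linarith
    have "M / R ^ 4 = M / R ^ 3 * (1 / R)" using R by (simp add: field_simps eval_nat_numeral)
    also have "\<dots> \<le> (8 * \<delta>) * (64 * \<delta>)" using m3 m1 R \<open>\<delta> > 0\<close> by (intro mult_mono) auto
    finally have m4: "M / R ^ 4 \<le> 512 * \<delta>\<^sup>2" by (simp add: power2_eq_square)
    interpret bounded_cgf P K "R / 2" \<delta> b
    proof
      show "K holomorphic_on ball 0 (R / 2)"
        by (rule holomorphic_on_subset[OF cgf.hol]) (use R in auto)
      show "exp (K z) = measure_pmf.expectation P (\<lambda>w. exp (z * of_real w))" if "z \<in> ball 0 (R / 2)" for z
        using that R by (intro cgf.exp_K) auto
      show "1 / (128 * \<delta>) \<le> R / 2" using m1 R \<open>\<delta> > 0\<close> by (simp add: field_simps)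
      fix z assume z: "z \<in> ball (0 :: complex) (R / 2)"
      have "norm ((deriv ^^ 3) K z) \<le> fact 3 * M / (R / 2) ^ 3" by (rule bd[OF _ z])
      also have "\<dots> = 48 * (M / R ^ 3)" by (simp add: fact_numeral power_divide)
      also have "\<dots> \<le> b * \<delta>" using m3 \<open>\<delta> > 0\<close> by (simp add: b_def)
      finally show "norm ((deriv ^^ 3) K z) \<le> b * \<delta>" .
      have "norm ((deriv ^^ 4) K z) \<le> fact 4 * M / (R / 2) ^ 4" by (rule bd[OF _ z])
      also have "\<dots> = 384 * (M / R ^ 4)" by (simp add: fact_numeral power_divide)
      also have "\<dots> \<le> 384 * (512 * \<delta>\<^sup>2)" using m4 by (intro mult_left_mono) auto
      also have "\<dots> \<le> b * \<delta>\<^sup>2" by (simp add: b_def)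
      finally show "norm ((deriv ^^ 4) K z) \<le> b * \<delta>\<^sup>2" .
    qed (use cgf.fin cgf.mean cgf.second cgf.K0 R \<open>\<delta> > 0\<close> in \<open>auto simp: b_def\<close>)
    have nn: "0 \<le> \<delta> * (1 + x\<^sup>2)" using \<open>\<delta> > 0\<close> by simp
    have "\<bar>tail_ratio x - 1\<bar> \<le> max C1 C2 * (\<delta> * (1 + x\<^sup>2))"
    proof (cases "\<delta> \<le> \<delta>0")
      case True
      have "(b * \<delta> * x)\<^sup>2 = b\<^sup>2 * \<delta> * (x\<^sup>2 * \<delta>)" by (simp add: power2_eq_square)
      also have "\<dots> \<le> b\<^sup>2 * \<delta>0 * (D + 1)"
        using True x \<open>\<delta> > 0\<close> \<delta>0 by (intro mult_mono) auto
      also have "\<dots> = (1 / 4)\<^sup>2" using assms by (simp add: \<delta>0_def b_def power2_eq_square)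
      finally have "b * \<delta> * x \<le> 1 / 4" by (rule power2_le_imp_le) simp
      from tail_ratio_small[OF CE x(1) this x(2)]
      have "\<bar>tail_ratio x - 1\<bar> \<le> C1 * (\<delta> * (1 + x\<^sup>2))" by (simp only: C1_def c0_def)
      also have "\<dots> \<le> max C1 C2 * (\<delta> * (1 + x\<^sup>2))" using nn by (intro mult_right_mono) auto
      finally show ?thesis .
    next
      case False
      then have "\<delta>0 \<le> \<delta>" by simp
      from tail_ratio_large[OF x(1,2) \<delta>0 this]
      have "\<bar>tail_ratio x - 1\<bar> \<le> C2 * (\<delta> * (1 + x\<^sup>2))" by (simp only: C2_def c1_def c0_def X_def)
      also have "\<dots> \<le> max C1 C2 * (\<delta> * (1 + x\<^sup>2))" using nn by (intro mult_right_mono) auto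
      finally show ?thesis .
    qed
    also have "\<dots> \<le> max 0 (max C1 C2) * (\<delta> * (1 + x\<^sup>2))" using nn by (intro mult_right_mono) auto
    finally show "\<bar>measure_pmf.prob P {w. w > x} /
         ((1 - Phi x) * exp (measure_pmf.expectation P (\<lambda>w. w ^ 3) * x ^ 3 / 6)) - 1\<bar> \<le>
         max 0 (max C1 C2) * (\<delta> * (1 + x\<^sup>2))"
      by (simp only: tail_ratio_def skew_def)
  qed simp
qed

section \<open>Copies of a graph\<close>

definition copies :: "'a graph \<Rightarrow> nat \<Rightarrow> nat graph set" where
  "copies G N = {H. subgraph H ({..<N}, all_pairs {..<N}) \<and> graph_iso G H}"

definition graph_image :: "'a graph \<Rightarrow> ('a \<Rightarrow> 'b) \<Rightarrow> 'b graph" where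
  "graph_image G f = (f ` verts G, (`) f ` edges G)"

definition embeddings :: "'a set \<Rightarrow> nat \<Rightarrow> ('a \<Rightarrow> nat) set" where
  "embeddings V N = {f \<in> V \<rightarrow>\<^sub>E {..<N}. inj_on f V}"

lemma all_pairs_iff: "e \<in> all_pairs V \<longleftrightarrow> (\<exists>u w. u \<in> V \<and> w \<in> V \<and> u \<noteq> w \<and> e = {u, w})"
  by (auto simp: all_pairs_def card_2_iff)

lemma simple_graph_edgeE:
  assumes "simple_graph G" "e \<in> edges G"
  obtains u w where "u \<in> verts G" "w \<in> verts G" "u \<noteq> w" "e = {u, w}"
  using assms unfolding simple_graph_def by (metis all_pairs_iff subsetD)

lemma num_verts_ge_2:
  assumes "simple_graph G" "num_edges G \<ge> 1"
  shows "num_verts G \<ge> 2"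
proof -
  have "edges G \<noteq> {}" using assms(2) by (auto simp: num_edges_def)
  then obtain e where e: "e \<in> edges G" by blast
  obtain a b where ab: "a \<in> verts G" "b \<in> verts G" "a \<noteq> b"
    using simple_graph_edgeE[OF assms(1) e] by metis
  have "card {a, b} \<le> card (verts G)"
    using ab assms(1) by (intro card_mono) (auto simp: simple_graph_def)
  then show ?thesis using ab by (simp add: num_verts_def)
qed

lemma finite_all_pairs: "finite V \<Longrightarrow> finite (all_pairs V)"
  by (rule finite_subset[of _ "Pow V"]) (auto simp: all_pairs_def)

lemma finite_embeddings: "finite V \<Longrightarrow> finite (embeddings V N)"
  by (rule finite_subset[of _ "V \<rightarrow>\<^sub>E {..<N}"]) (auto simp: embeddings_def intro!: finite_PiE)

lemma inj_on_image_edges: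
  assumes "simple_graph G" "inj_on f (verts G)"
  shows "inj_on ((`) f) (edges G)"
proof -
  have "edges G \<subseteq> Pow (verts G)" using assms(1) by (auto simp: simple_graph_def all_pairs_def)
  then show ?thesis using inj_on_image_Pow[OF assms(2)] inj_on_subset by blast
qed

text \<open>Different embeddings can give the same copy, because of automorphisms of
  \<open>G\<close>. The counts below therefore pass through embeddings with inequalities or bounded
  multiplicity, never by a bijection.\<close>

lemma copies_eq_image:
  assumes G: "simple_graph G"
  shows "copies G N = graph_image G ` embeddings (verts G) N"
proof (intro equalityI subsetI)
  fix H assume "H \<in> copies G N"
  then have H: "simple_graph H" "verts H \<subseteq> {..<N}" "graph_iso G H"
    by (auto simp: copies_def subgraph_def)
  then obtain f where f: "bij_betw f (verts G) (verts H)"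
    "\<And>u w. u \<in> verts G \<Longrightarrow> w \<in> verts G \<Longrightarrow> {u, w} \<in> edges G \<longleftrightarrow> {f u, f w} \<in> edges H"
    by (auto simp: graph_iso_def)
  let ?f = "restrict f (verts G)"
  have fV: "f ` verts G = verts H" and inj: "inj_on f (verts G)" using f(1) by (auto simp: bij_betw_def)
  have "?f \<in> embeddings (verts G) N"
    using fV inj H(2) by (auto simp: embeddings_def inj_on_restrict_eq)
  moreover have "graph_image G ?f = H"
  proof -
    have "(`) ?f ` edges G = edges H"
    proof (intro equalityI subsetI)
      fix e assume "e \<in> (`) ?f ` edges G"
      then obtain e0 where e0: "e0 \<in> edges G" "e = ?f ` e0" by auto
      then obtain u w where uw: "u \<in> verts G" "w \<in> verts G" "e0 = {u, w}"
        using simple_graph_edgeE[OF G] by metis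
      then have "e = {f u, f w}" using e0 by auto
      then show "e \<in> edges H" using f(2)[OF uw(1,2)] e0 uw by simp
    next
      fix e assume e: "e \<in> edges H"
      then obtain a b where ab: "a \<in> verts H" "b \<in> verts H" "e = {a, b}"
        using simple_graph_edgeE[OF H(1)] by metis
      then obtain u w where uw: "u \<in> verts G" "w \<in> verts G" "a = f u" "b = f w"
        unfolding fV[symmetric] by blast
      then have "{u, w} \<in> edges G" "e = ?f ` {u, w}" using f(2) e ab by auto
      then show "e \<in> (`) ?f ` edges G" by blast
    qed
    moreover have "?f ` verts G = verts H" using fV by auto
    ultimately show ?thesis by (simp add: graph_image_def)
  qed
  ultimately show "H \<in> graph_image G ` embeddings (verts G) N" by blast
next
  fix H assume "H \<in> graph_image G ` embeddings (verts G) N"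
  then obtain f where f: "f \<in> verts G \<rightarrow>\<^sub>E {..<N}" "inj_on f (verts G)" and H: "H = graph_image G f"
    by (auto simp: embeddings_def)
  have edges: "e \<in> all_pairs (f ` verts G)" if "e \<in> edges H" for e
  proof -
    from that obtain e0 where e0: "e0 \<in> edges G" "e = f ` e0" by (auto simp: H graph_image_def)
    then obtain u w where uw: "u \<in> verts G" "w \<in> verts G" "u \<noteq> w" "e0 = {u, w}"
      using simple_graph_edgeE[OF G] by metis
    then show ?thesis using e0 f(2) by (auto simp: all_pairs_iff inj_on_def)
  qed
  have "f ` verts G \<subseteq> {..<N}" using f by auto
  moreover have "simple_graph H"
    using edges G by (auto simp: simple_graph_def H graph_image_def)
  moreover have "edges H \<subseteq> all_pairs {..<N}"
  proof
    fix e assume "e \<in> edges H"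
    from edges[OF this] show "e \<in> all_pairs {..<N}"
      using \<open>f ` verts G \<subseteq> {..<N}\<close> unfolding all_pairs_def by blast
  qed
  moreover have "graph_iso G H"
    unfolding graph_iso_def
  proof (intro exI[of _ f] conjI ballI)
    show "bij_betw f (verts G) (verts H)" using f by (auto simp: bij_betw_def H graph_image_def)
    fix u w assume uw: "u \<in> verts G" "w \<in> verts G"
    have "{f u, f w} \<in> edges H \<longleftrightarrow> f ` {u, w} \<in> (`) f ` edges G" by (simp add: H graph_image_def)
    also have "\<dots> \<longleftrightarrow> {u, w} \<in> edges G"
    proof
      assume "f ` {u, w} \<in> (`) f ` edges G"
      then obtain e0 where e0: "e0 \<in> edges G" "f ` {u, w} = f ` e0" by auto
      moreover have "e0 \<subseteq> verts G" using e0 G by (auto simp: simple_graph_def all_pairs_def)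
      ultimately have "{u, w} = e0" using inj_on_image_eq_iff[OF f(2)] uw by (metis empty_subsetI insert_subset)
      then show "{u, w} \<in> edges G" using e0 by simp
    qed (rule imageI)
    finally show "{u, w} \<in> edges G \<longleftrightarrow> {f u, f w} \<in> edges H" by simp
  qed
  ultimately show "H \<in> copies G N"
    by (auto simp: copies_def subgraph_def H graph_image_def)
qed

lemma card_edges_copy:
  assumes "simple_graph G" "H \<in> copies G N"
  shows "card (edges H) = num_edges G"
proof -
  obtain f where "f \<in> embeddings (verts G) N" "H = graph_image G f"
    using assms copies_eq_image by blast
  then show ?thesis using inj_on_image_edges[OF assms(1), of f]
    by (auto simp: embeddings_def graph_image_def num_edges_def card_image)
qed

lemma finite_copies: "simple_graph G \<Longrightarrow> finite (copies G N)"
  by (simp add: copies_eq_image finite_embeddings simple_graph_def)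

lemma card_copies_le:
  assumes "simple_graph G"
  shows "card (copies G N) \<le> N ^ num_verts G"
proof -
  have fin: "finite (verts G)" using assms by (simp add: simple_graph_def)
  have "card (copies G N) \<le> card (embeddings (verts G) N)"
    unfolding copies_eq_image[OF assms] by (rule card_image_le) (rule finite_embeddings[OF fin])
  also have "\<dots> \<le> card (verts G \<rightarrow>\<^sub>E {..<N})"
    by (rule card_mono) (auto simp: embeddings_def fin intro!: finite_PiE)
  finally show ?thesis using fin by (simp add: card_PiE num_verts_def)
qed

lemma card_two_values_fixed_le:
  assumes "finite V" "u \<in> V" "w \<in> V" "u \<noteq> w"
  shows "card {f \<in> V \<rightarrow>\<^sub>E {..<N}. f u = a \<and> f w = b} \<le> N ^ (card V - 2)"
proof -
  let ?F = "{f \<in> V \<rightarrow>\<^sub>E {..<N}. f u = a \<and> f w = b}" and ?V = "V - {u, w}"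
  have "inj_on (\<lambda>f. restrict f ?V) ?F"
  proof (rule inj_onI)
    fix f g assume f: "f \<in> ?F" and g: "g \<in> ?F" and eq: "restrict f ?V = restrict g ?V"
    show "f = g"
    proof
      fix x
      consider "x \<notin> V" | "x \<in> ?V" | "x = u" | "x = w" by auto
      then show "f x = g x"
      proof cases
        case 2
        then show ?thesis using fun_cong[OF eq, of x] by simp
      qed (use f g in \<open>auto simp: PiE_def extensional_def\<close>)
    qed
  qed
  moreover have "(\<lambda>f. restrict f ?V) ` ?F \<subseteq> ?V \<rightarrow>\<^sub>E {..<N}"
    by (intro image_subsetI restrict_PiE_iff[THEN iffD2]) (auto simp: PiE_def Pi_def)
  ultimately have "card ?F \<le> card (?V \<rightarrow>\<^sub>E {..<N})"
    using assms(1) by (intro card_inj_on_le finite_PiE) auto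
  also have "\<dots> = N ^ card ?V" using assms by (simp add: card_PiE)
  also have "card ?V = card V - 2" using assms by (simp add: card_Diff_subset)
  finally show ?thesis .
qed

text \<open>Some ordered pair of vertices of \<open>G\<close> is sent onto \<open>e\<close>; there
  are at most v^2 such pairs, and the other v - 2 vertices have at most N images each.\<close>

lemma card_copies_through_le:
  assumes G: "simple_graph G"
  shows "card {H \<in> copies G N. e \<in> edges H} \<le> (num_verts G)\<^sup>2 * N ^ (num_verts G - 2)"
proof (cases "\<exists>a b. e = {a, b} \<and> a \<noteq> b")
  \<comment> \<open>\<open>bounded_family\<close> asks for the degree of every \<open>e\<close>,
    also of those that are not pairs and lie in no copy.\<close>
  case False
  then have "e \<notin> edges H" if "H \<in> copies G N" for H
    using that simple_graph_edgeE[of H e] by (auto simp: copies_def subgraph_def)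
  then have "{H \<in> copies G N. e \<in> edges H} = {}" by blast
  then show ?thesis by (metis card.empty le0)
next
  case True
  then obtain a b where ab: "e = {a, b}" by auto
  let ?V = "verts G"
  have fin: "finite ?V" using G by (simp add: simple_graph_def)
  define F where "F = (\<lambda>(u, w). {f \<in> ?V \<rightarrow>\<^sub>E {..<N}. f u = a \<and> f w = b})"
  define D where "D = {(u, w) \<in> ?V \<times> ?V. u \<noteq> w}"
  have finF: "finite (F d)" for d
    by (rule finite_subset[of _ "?V \<rightarrow>\<^sub>E {..<N}"]) (auto simp: F_def fin intro!: finite_PiE)
  have finD: "finite D" by (rule finite_subset[of _ "?V \<times> ?V"]) (auto simp: D_def fin)
  have "{H \<in> copies G N. e \<in> edges H} \<subseteq> graph_image G ` (\<Union>d\<in>D. F d)"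
  proof
    fix H assume "H \<in> {H \<in> copies G N. e \<in> edges H}"
    then obtain f where f: "f \<in> ?V \<rightarrow>\<^sub>E {..<N}" "inj_on f ?V" "H = graph_image G f" "e \<in> edges H"
      using copies_eq_image[OF G] by (auto simp: embeddings_def)
    then obtain e0 where e0: "e0 \<in> edges G" "e = f ` e0" by (auto simp: graph_image_def)
    then obtain u w where uw: "u \<in> ?V" "w \<in> ?V" "u \<noteq> w" "e0 = {u, w}"
      using simple_graph_edgeE[OF G] by metis
    then have "{a, b} = {f u, f w}" using e0 ab by auto
    then have "f \<in> F (u, w) \<or> f \<in> F (w, u)" using f by (auto simp: F_def doubleton_eq_iff)
    then show "H \<in> graph_image G ` (\<Union>d\<in>D. F d)" using uw f(3) by (auto simp: D_def)
  qed
  then have "card {H \<in> copies G N. e \<in> edges H} \<le> card (graph_image G ` (\<Union>d\<in>D. F d))"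
    using finD finF by (intro card_mono) auto
  also have "\<dots> \<le> card (\<Union>d\<in>D. F d)" using finD finF by (intro card_image_le) auto
  also have "\<dots> \<le> (\<Sum>d\<in>D. card (F d))" by (rule card_UN_le[OF finD])
  also have "\<dots> \<le> (\<Sum>d\<in>D. N ^ (card ?V - 2))"
    by (intro sum_mono) (auto simp: F_def D_def intro!: card_two_values_fixed_le[OF fin])
  also have "\<dots> = card D * N ^ (card ?V - 2)" by simp
  also have "card D \<le> card (?V \<times> ?V)" by (rule card_mono) (auto simp: D_def fin)
  also have "\<dots> = (num_verts G)\<^sup>2" by (simp add: num_verts_def card_cartesian_product power2_eq_square)
  finally show ?thesis by (simp add: num_verts_def)
qed

lemma bounded_family_copies:
  assumes "simple_graph G"
  shows "bounded_family (all_pairs {..<N}) (num_edges G) ((num_verts G)\<^sup>2 * N ^ (num_verts G - 2))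
    (copies G N) edges"
  unfolding bounded_family_def
  using finite_copies[OF assms] card_edges_copy[OF assms] card_copies_through_le[OF assms]
  by (auto simp: copies_def subgraph_def)

lemma num_copies_eq:
  assumes "A \<subseteq> all_pairs {..<N}"
  shows "num_copies G ({..<N}, A) = card {H \<in> copies G N. edges H \<subseteq> A}"
proof -
  have "{H. subgraph H ({..<N}, A) \<and> graph_iso G H} = {H \<in> copies G N. edges H \<subseteq> A}"
    using assms by (auto simp: copies_def subgraph_def)
  then show ?thesis by (simp add: num_copies_def)
qed

text \<open>Extend \<open>g\<close> by one vertex at a time. Every step has at least
  \<open>N - card V + 1\<close> free images, a number that is positive even for
  \<open>N = card V\<close>.\<close>

lemma card_extensions_ge:
  assumes "finite V" "V0 \<subseteq> V" "card V \<le> N" "inj_on g V0" "g ` V0 \<subseteq> {..<N}"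
  shows "(N - card V + 1) ^ (card V - card V0) \<le> card {f \<in> embeddings V N. \<forall>u\<in>V0. f u = g u}"
proof -
  have fin0: "finite V0" using assms finite_subset by blast
  have "(N - card V + 1) ^ card B \<le> card {f \<in> embeddings (V0 \<union> B) N. \<forall>u\<in>V0. f u = g u}"
    if "finite B" "B \<inter> V0 = {}" "B \<subseteq> V" for B
    using that
  proof (induction B)
    case empty
    have "restrict g V0 \<in> {f \<in> embeddings (V0 \<union> {}) N. \<forall>u\<in>V0. f u = g u}"
      using assms by (auto simp: embeddings_def inj_on_restrict_eq)
    then have "{f \<in> embeddings (V0 \<union> {}) N. \<forall>u\<in>V0. f u = g u} \<noteq> {}" by blast
    then show ?case using finite_embeddings[of "V0 \<union> {}" N] fin0
      by (simp add: Suc_le_eq card_gt_0_iff)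
  next
    case (insert b B)
    let ?X = "\<lambda>B. {f \<in> embeddings (V0 \<union> B) N. \<forall>u\<in>V0. f u = g u}"
    let ?S = "SIGMA f:?X B. {..<N} - f ` (V0 \<union> B)"
    have b: "b \<notin> V0 \<union> B" using insert by auto
    have finX: "finite (?X C)" if "finite C" for C
      using finite_embeddings[of "V0 \<union> C" N] fin0 that by auto
    have "inj_on (\<lambda>(f, a). f(b := a)) ?S"
    proof (rule inj_onI)
      fix y z assume y: "y \<in> ?S" and z: "z \<in> ?S"
        and eq: "(case y of (f, a) \<Rightarrow> f(b := a)) = (case z of (f, a) \<Rightarrow> f(b := a))"
      obtain f a f' a' where yz: "y = (f, a)" "z = (f', a')" by (cases y; cases z) auto
      have "f x = f' x" for x
      proof (cases "x = b")
        case True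
        then show ?thesis using y z yz b by (auto simp: embeddings_def PiE_def extensional_def)
      next
        case False
        then show ?thesis using fun_cong[OF eq, of x] yz by simp
      qed
      moreover have "a = a'" using fun_cong[OF eq, of b] yz by simp
      ultimately show "y = z" using yz by auto
    qed
    moreover have "(\<lambda>(f, a). f(b := a)) ` ?S \<subseteq> ?X (insert b B)"
    proof clarify
      fix f a assume f: "f \<in> embeddings (V0 \<union> B) N" "\<forall>u\<in>V0. f u = g u" and a: "a < N" "a \<notin> f ` (V0 \<union> B)"
      have "inj_on (f(b := a)) (insert b (V0 \<union> B))"
        using f(1) a b unfolding embeddings_def by (auto simp: inj_on_def)
      moreover have "f(b := a) \<in> insert b (V0 \<union> B) \<rightarrow>\<^sub>E {..<N}"
        using f(1) a by (auto simp: embeddings_def PiE_def extensional_def)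
      ultimately show "f(b := a) \<in> embeddings (V0 \<union> insert b B) N \<and> (\<forall>u\<in>V0. (f(b := a)) u = g u)"
        using f(2) b by (auto simp: embeddings_def)
    qed
    ultimately have "card ?S \<le> card (?X (insert b B))"
      using finX[of "insert b B"] insert.hyps(1) by (intro card_inj_on_le) blast+
    moreover have "card (?X B) * (N - card V + 1) \<le> card ?S"
    proof -
      have "N - card V + 1 \<le> card ({..<N} - f ` (V0 \<union> B))" if "f \<in> ?X B" for f
      proof -
        \<comment> \<open>Strict, since \<open>b\<close> is not yet placed; this gives the summand
          1.\<close>
        have "card (V0 \<union> B) < card V"
          using insert assms b by (intro psubset_card_mono) auto
        moreover have "card (f ` (V0 \<union> B)) \<le> card (V0 \<union> B)"
          using insert fin0 by (intro card_image_le) auto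
        moreover have "card {..<N} - card (f ` (V0 \<union> B)) \<le> card ({..<N} - f ` (V0 \<union> B))"
          using insert fin0 by (intro diff_card_le_card_Diff) auto
        ultimately show ?thesis using assms(3) by simp
      qed
      then have "(\<Sum>f\<in>?X B. N - card V + 1) \<le> (\<Sum>f\<in>?X B. card ({..<N} - f ` (V0 \<union> B)))"
        by (intro sum_mono) auto
      also have "\<dots> = card ?S" using finX insert by (subst card_SigmaI) auto
      finally show ?thesis by simp
    qed
    moreover have "(N - card V + 1) ^ card B \<le> card (?X B)" using insert by auto
    ultimately have "(N - card V + 1) ^ card B * (N - card V + 1) \<le> card (?X (insert b B))"
      by (meson mult_le_mono1 order_trans)
    then show ?case using insert by (simp add: mult.commute)
  qed
  from this[of "V - V0"] show ?thesis
    using assms fin0 by (simp add: card_Diff_subset Un_absorb1 Int_commute)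
qed

section \<open>Variance of the number of copies\<close>

definition subset_count :: "'c set \<Rightarrow> ('c \<Rightarrow> 'e set) \<Rightarrow> 'e set \<Rightarrow> real" where
  "subset_count C I A = real (card {c \<in> C. I c \<subseteq> A})"

lemma subset_count_eq_sum: "finite C \<Longrightarrow> subset_count C I A = (\<Sum>c\<in>C. if I c \<subseteq> A then 1 else 0)"
  by (simp add: subset_count_def sum.If_cases Int_def)

lemma prob_superset:
  assumes "finite E" "J \<subseteq> E" "0 \<le> p" "p \<le> 1"
  shows "measure_pmf.expectation (random_subset E p) (\<lambda>A. if J \<subseteq> A then 1 else 0 :: real) = p ^ card J"
  using expectation_random_subset_superset[OF assms, of "\<lambda>_. 1 :: real"] by simp

lemma
  assumes "finite E" "finite C" "\<And>c. c \<in> C \<Longrightarrow> I c \<subseteq> E" "0 \<le> p" "p \<le> 1"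
  shows expectation_subset_count:
      "measure_pmf.expectation (random_subset E p) (subset_count C I) = (\<Sum>c\<in>C. p ^ card (I c))"
    and variance_subset_count: "measure_pmf.variance (random_subset E p) (subset_count C I) =
      (\<Sum>c\<in>C. \<Sum>c'\<in>C. p ^ card (I c \<union> I c') - p ^ card (I c) * p ^ card (I c'))"
proof -
  let ?M = "measure_pmf (random_subset E p)"
  have int: "integrable ?M f" for f :: "_ \<Rightarrow> real"
    by (simp add: integrable_measure_pmf_finite finite_set_random_subset assms)
  have S: "subset_count C I = (\<lambda>A. \<Sum>c\<in>C. if I c \<subseteq> A then 1 else 0)"
    using subset_count_eq_sum[OF assms(2)] by auto
  show E: "measure_pmf.expectation (random_subset E p) (subset_count C I) = (\<Sum>c\<in>C. p ^ card (I c))"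
    unfolding S by (subst Bochner_Integration.integral_sum) (auto simp: int prob_superset assms)
  have S2: "(subset_count C I A)\<^sup>2 = (\<Sum>c\<in>C. \<Sum>c'\<in>C. if I c \<union> I c' \<subseteq> A then 1 else 0)" for A
    unfolding S power2_eq_square sum_product by (intro sum.cong refl) auto
  have "measure_pmf.expectation (random_subset E p) (\<lambda>A. (subset_count C I A)\<^sup>2) =
      (\<Sum>c\<in>C. \<Sum>c'\<in>C. p ^ card (I c \<union> I c'))"
  proof -
    have "measure_pmf.expectation (random_subset E p) (\<lambda>A. (subset_count C I A)\<^sup>2) =
      (\<Sum>c\<in>C. \<Sum>c'\<in>C. measure_pmf.expectation (random_subset E p) (\<lambda>A. if I c \<union> I c' \<subseteq> A then 1 else 0))"
      unfolding S2 by (simp only: Bochner_Integration.integral_sum int)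
    also have "\<dots> = (\<Sum>c\<in>C. \<Sum>c'\<in>C. p ^ card (I c \<union> I c'))"
      using assms by (intro sum.cong refl prob_superset) auto
    finally show ?thesis .
  qed
  moreover have "measure_pmf.variance (random_subset E p) (subset_count C I) =
     measure_pmf.expectation (random_subset E p) (\<lambda>A. (subset_count C I A)\<^sup>2) -
     (measure_pmf.expectation (random_subset E p) (subset_count C I))\<^sup>2"
    by (rule measure_pmf.variance_eq[OF int int])
  ultimately show "measure_pmf.variance (random_subset E p) (subset_count C I) =
      (\<Sum>c\<in>C. \<Sum>c'\<in>C. p ^ card (I c \<union> I c') - p ^ card (I c) * p ^ card (I c'))"
    unfolding E by (simp add: power2_eq_square sum_product sum_subtractf)
qed

text \<open>Take an embedding of \<open>G\<close> and a second one that agrees with it on the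
  vertices of \<open>H\<close>: the two copies share the image of the edges of \<open>H\<close>. A
  pair of copies arises from at most v^(2 * v) pairs of embeddings, because each embedding maps into
  the vertex set of its copy.\<close>

lemma card_overlapping_pairs_ge:
  assumes G: "simple_graph G" and H: "subgraph H G" and N: "num_verts G \<le> N"
  shows "(N - num_verts G + 1) ^ (2 * num_verts G - num_verts H) \<le>
    card {(A, B) \<in> copies G N \<times> copies G N. num_edges H \<le> card (edges A \<inter> edges B)}
      * num_verts G ^ (2 * num_verts G)"
proof -
  let ?V = "verts G" and ?W = "verts H" and ?m = "N - num_verts G + 1"
  define Q where "Q = {(A, B) \<in> copies G N \<times> copies G N. num_edges H \<le> card (edges A \<inter> edges B)}"
  define Ext where "Ext f = {f' \<in> embeddings ?V N. \<forall>u\<in>?W. f' u = f u}" for f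
  define T where "T = (SIGMA f:embeddings ?V N. Ext f)"
  have fin: "finite ?V" and V0: "?W \<subseteq> ?V" "simple_graph H" "edges H \<subseteq> edges G"
    using G H by (auto simp: simple_graph_def subgraph_def)
  have finE: "finite (embeddings ?V N)" by (rule finite_embeddings[OF fin])
  have finX: "finite (Ext f)" for f using finE by (simp add: Ext_def)
  have finQ: "finite Q"
    by (rule finite_subset[of _ "copies G N \<times> copies G N"]) (auto simp: Q_def finite_copies[OF G])
  have le: "num_verts H \<le> num_verts G" unfolding num_verts_def by (rule card_mono[OF fin V0(1)])
  have "?m ^ num_verts G \<le> card {f \<in> embeddings ?V N. \<forall>u\<in>{}. f u = f u}"
    using card_extensions_ge[OF fin, of "{}" N] N by (simp add: num_verts_def)
  then have cE: "?m ^ num_verts G \<le> card (embeddings ?V N)" by simp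
  have cX: "?m ^ (num_verts G - num_verts H) \<le> card (Ext f)" if "f \<in> embeddings ?V N" for f
    unfolding Ext_def num_verts_def
    using that N V0 by (intro card_extensions_ge fin) (auto simp: embeddings_def num_verts_def inj_on_subset)
  have "?m ^ (2 * num_verts G - num_verts H) = ?m ^ num_verts G * ?m ^ (num_verts G - num_verts H)"
    using le by (simp add: power_add[symmetric] mult_2)
  also have "\<dots> \<le> card (embeddings ?V N) * ?m ^ (num_verts G - num_verts H)"
    using cE by (rule mult_le_mono1)
  also have "\<dots> = (\<Sum>f\<in>embeddings ?V N. ?m ^ (num_verts G - num_verts H))" by simp
  also have "\<dots> \<le> (\<Sum>f\<in>embeddings ?V N. card (Ext f))" by (intro sum_mono cX)
  also have "\<dots> = card T" unfolding T_def using finE finX by (subst card_SigmaI) auto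
  also have "card T \<le> card (\<Union>q\<in>Q. (?V \<rightarrow>\<^sub>E verts (fst q)) \<times> (?V \<rightarrow>\<^sub>E verts (snd q)))"
  proof (rule card_mono)
    have "finite (verts A)" if "A \<in> copies G N" for A
      using that by (auto simp: copies_def subgraph_def simple_graph_def)
    then show "finite (\<Union>q\<in>Q. (?V \<rightarrow>\<^sub>E verts (fst q)) \<times> (?V \<rightarrow>\<^sub>E verts (snd q)))"
      using finQ fin by (auto simp: Q_def intro!: finite_PiE)
    show "T \<subseteq> (\<Union>q\<in>Q. (?V \<rightarrow>\<^sub>E verts (fst q)) \<times> (?V \<rightarrow>\<^sub>E verts (snd q)))"
    proof
      fix t assume "t \<in> T"
      then obtain f g where t: "t = (f, g)" and f: "f \<in> embeddings ?V N" and g: "g \<in> embeddings ?V N"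
        and fg: "\<And>u. u \<in> ?W \<Longrightarrow> g u = f u" by (auto simp: T_def Ext_def)
      have "f ` e = g ` e" if "e \<in> edges H" for e
      proof -
        have "e \<subseteq> verts H" using that V0(2) by (auto simp: simple_graph_def all_pairs_def)
        then show ?thesis using fg by (intro image_cong) auto
      qed
      then have "f ` e \<in> (`) f ` edges G \<inter> (`) g ` edges G" if "e \<in> edges H" for e
        using that V0(3) by (metis IntI imageI subsetD)
      then have "(`) f ` edges H \<subseteq> edges (graph_image G f) \<inter> edges (graph_image G g)"
        by (auto simp: graph_image_def)
      moreover have "card ((`) f ` edges H) = num_edges H"
        using inj_on_image_edges[OF G, of f] f V0(3) unfolding num_edges_def
        by (intro card_image) (auto simp: embeddings_def inj_on_subset)
      moreover have "finite (edges G)" using G fin finite_all_pairs finite_subset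
        by (auto simp: simple_graph_def)
      ultimately have "num_edges H \<le> card (edges (graph_image G f) \<inter> edges (graph_image G g))"
        by (metis card_mono finite_Int finite_imageI graph_image_def snd_conv)
      then have "(graph_image G f, graph_image G g) \<in> Q"
        using f g copies_eq_image[OF G] by (auto simp: Q_def)
      moreover have "f \<in> ?V \<rightarrow>\<^sub>E verts (graph_image G f)" "g \<in> ?V \<rightarrow>\<^sub>E verts (graph_image G g)"
        using f g by (auto simp: embeddings_def graph_image_def PiE_def)
      ultimately show "t \<in> (\<Union>q\<in>Q. (?V \<rightarrow>\<^sub>E verts (fst q)) \<times> (?V \<rightarrow>\<^sub>E verts (snd q)))"
        unfolding t by force
    qed
  qed
  also have "\<dots> \<le> (\<Sum>q\<in>Q. card ((?V \<rightarrow>\<^sub>E verts (fst q)) \<times> (?V \<rightarrow>\<^sub>E verts (snd q))))"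
    by (rule card_UN_le[OF finQ])
  also have "\<dots> = (\<Sum>q\<in>Q. num_verts G ^ (2 * num_verts G))"
  proof (rule sum.cong[OF refl])
    have "card (?V \<rightarrow>\<^sub>E verts A) = num_verts G ^ num_verts G" if A: "A \<in> copies G N" for A
    proof -
      obtain f where "bij_betw f ?V (verts A)" using A by (auto simp: copies_def graph_iso_def)
      then have "card (verts A) = num_verts G" by (simp add: num_verts_def bij_betw_same_card)
      then show ?thesis using fin by (simp add: card_PiE num_verts_def)
    qed
    then show "card ((?V \<rightarrow>\<^sub>E verts (fst q)) \<times> (?V \<rightarrow>\<^sub>E verts (snd q))) = num_verts G ^ (2 * num_verts G)"
      if "q \<in> Q" for q
      using that by (auto simp: Q_def card_cartesian_product power_add[symmetric] mult_2)
  qed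
  finally show ?thesis unfolding Q_def[symmetric] by simp
qed

lemma finite_subgraphs: "simple_graph G \<Longrightarrow> finite {H. subgraph H G}"
proof (rule finite_subset[of _ "Pow (verts G) \<times> Pow (edges G)"])
  assume G: "simple_graph G"
  then have "finite (edges G)" using finite_all_pairs finite_subset by (auto simp: simple_graph_def)
  then show "finite (Pow (verts G) \<times> Pow (edges G))" using G by (simp add: simple_graph_def)
qed (auto simp: subgraph_def)

lemma psi_attained:
  assumes "simple_graph G" "num_edges G \<ge> 1"
  obtains H where "subgraph H G" "num_edges H > 0" "psi G N p = real N ^ num_verts H * p ^ num_edges H"
proof -
  let ?S = "{real N ^ num_verts H * p ^ num_edges H | H. subgraph H G \<and> num_edges H > 0}"
  have "?S = (\<lambda>H. real N ^ num_verts H * p ^ num_edges H) ` {H. subgraph H G \<and> num_edges H > 0}" by auto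
  then have "finite ?S" using finite_subgraphs[OF assms(1)] by simp
  moreover have "subgraph G G" using assms by (simp add: subgraph_def)
  then have "?S \<noteq> {}" using assms(2) by fastforce
  ultimately have "Min ?S \<in> ?S" by (rule Min_in)
  then show ?thesis using that unfolding psi_def by blast
qed

text \<open>Choose \<open>H\<close> attaining the minimum. All covariances are nonnegative, so only
  the pairs of copies sharing at least e(H) edges are kept; each contributes at least (1 - p) * p^(2
  * e - e(H)).\<close>

lemma variance_copies_ge:
  assumes G: "simple_graph G" "num_edges G \<ge> 1" and N: "num_verts G \<le> N" and p: "0 < p" "p < 1"
  shows "(1 - p) * (real N ^ (2 * num_verts G) * p ^ (2 * num_edges G)) / psi G N p \<le>
    real (num_verts G) ^ (4 * num_verts G) *
    measure_pmf.variance (random_subset (all_pairs {..<N}) p) (subset_count (copies G N) edges)"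
proof -
  obtain H where H: "subgraph H G" "num_edges H > 0"
    and psi: "psi G N p = real N ^ num_verts H * p ^ num_edges H"
    using psi_attained[OF G] .
  let ?v = "num_verts G" and ?e = "num_edges G" and ?h = "num_verts H" and ?k = "num_edges H"
  let ?C = "copies G N"
  define Q where "Q = {(A, B) \<in> ?C \<times> ?C. ?k \<le> card (edges A \<inter> edges B)}"
  have finC: "finite ?C" by (rule finite_copies[OF G(1)])
  have fin: "finite (verts G)" "finite (edges G)" using G finite_all_pairs finite_subset by (auto simp: simple_graph_def)
  have hv: "?h \<le> ?v" and ke: "?k \<le> ?e"
    using H(1) fin by (auto simp: subgraph_def num_verts_def num_edges_def intro: card_mono)
  have v: "?v \<ge> 1" using num_verts_ge_2[OF G] by simp
  have finA: "finite (edges A)" if "A \<in> ?C" for A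
    using card_edges_copy[OF G(1) that] G(2) by (metis card.infinite not_one_le_zero)
  let ?cov = "\<lambda>A B. p ^ card (edges A \<union> edges B) - p ^ card (edges A) * p ^ card (edges B)"
  have cov: "?cov A B = p ^ (2 * ?e - card (edges A \<inter> edges B)) - p ^ (2 * ?e)" if "A \<in> ?C" "B \<in> ?C" for A B
  proof -
    have "card (edges A \<union> edges B) = 2 * ?e - card (edges A \<inter> edges B)"
      using card_Un_Int[OF finA[OF that(1)] finA[OF that(2)]] card_edges_copy[OF G(1)] that by simp
    then show ?thesis using card_edges_copy[OF G(1)] that by (simp add: power_add[symmetric] mult_2)
  qed
  have cov_nonneg: "0 \<le> ?cov A B" if "A \<in> ?C" "B \<in> ?C" for A B
    unfolding cov[OF that] using p by (simp add: power_decreasing)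
  have cov_ge: "(1 - p) * p ^ (2 * ?e - ?k) \<le> ?cov A B" if "(A, B) \<in> Q" for A B
  proof -
    have AB: "A \<in> ?C" "B \<in> ?C" "?k \<le> card (edges A \<inter> edges B)" using that by (auto simp: Q_def)
    \<comment> \<open>\<open>?k \<ge> 1\<close> gives \<open>p ^ ?k \<le> p\<close>, whence the
      factor \<open>1 - p\<close>.\<close>
    have "p ^ (2 * ?e) = p ^ (2 * ?e - ?k) * p ^ ?k" using ke by (simp add: power_add[symmetric])
    also have "\<dots> \<le> p ^ (2 * ?e - ?k) * p ^ 1"
      using p H(2) by (intro mult_left_mono power_decreasing) auto
    finally have "(1 - p) * p ^ (2 * ?e - ?k) \<le> p ^ (2 * ?e - ?k) - p ^ (2 * ?e)" by (simp add: algebra_simps)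
    also have "p ^ (2 * ?e - ?k) \<le> p ^ (2 * ?e - card (edges A \<inter> edges B))"
      using p AB(3) by (intro power_decreasing) auto
    finally show ?thesis unfolding cov[OF AB(1,2)] by simp
  qed
  have "real (card Q) * ((1 - p) * p ^ (2 * ?e - ?k)) = (\<Sum>q\<in>Q. (1 - p) * p ^ (2 * ?e - ?k))" by simp
  also have "\<dots> \<le> (\<Sum>(A, B)\<in>Q. ?cov A B)" using cov_ge by (intro sum_mono) (auto split: prod.split)
  also have "\<dots> \<le> (\<Sum>(A, B)\<in>?C \<times> ?C. ?cov A B)"
    using finC cov_nonneg by (intro sum_mono2) (auto simp: Q_def)
  also have "\<dots> = measure_pmf.variance (random_subset (all_pairs {..<N}) p) (subset_count ?C edges)"
    using p finC by (subst variance_subset_count)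
      (auto simp: sum.cartesian_product finite_all_pairs copies_def subgraph_def)
  finally have var: "real (card Q) * ((1 - p) * p ^ (2 * ?e - ?k)) \<le>
     measure_pmf.variance (random_subset (all_pairs {..<N}) p) (subset_count ?C edges)" .
  \<comment> \<open>The right side exceeds the left by (v - 1) * (N - v). This trades the N - v + 1
    free images for N at the cost of powers of v.\<close>
  have Nv: "real N \<le> real ?v * real (N - ?v + 1)"
  proof -
    have "0 \<le> (real ?v - 1) * (real N - real ?v)" using v N by (intro mult_nonneg_nonneg) auto
    then show ?thesis using N by (simp add: of_nat_diff algebra_simps)
  qed
  have "real N ^ (2 * ?v - ?h) \<le> (real ?v * real (N - ?v + 1)) ^ (2 * ?v - ?h)"
    by (intro power_mono Nv) auto
  also have "\<dots> = real ?v ^ (2 * ?v - ?h) * real ((N - ?v + 1) ^ (2 * ?v - ?h))"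
    by (simp add: power_mult_distrib)
  \<comment> \<open>One factor v^(2 * v) comes from \<open>Nv\<close>, the other from the
    multiplicity in \<open>card_overlapping_pairs_ge\<close>.\<close>
  also have "\<dots> \<le> real ?v ^ (2 * ?v) * real (card Q * ?v ^ (2 * ?v))"
    using card_overlapping_pairs_ge[OF G(1) H(1) N] v unfolding Q_def[symmetric]
    by (intro mult_mono power_increasing) (simp_all only: of_nat_le_iff, auto)
  also have "\<dots> = real ?v ^ (4 * ?v) * real (card Q)"
    by (simp add: power_add[symmetric])
  finally have NQ: "real N ^ (2 * ?v - ?h) \<le> real ?v ^ (4 * ?v) * real (card Q)" .
  have "N > 0" using v N by simp
  have "(1 - p) * (real N ^ (2 * ?v) * p ^ (2 * ?e)) / psi G N p =
     real N ^ (2 * ?v - ?h) * ((1 - p) * p ^ (2 * ?e - ?k))"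
  proof -
    have "real N ^ (2 * ?v) = real N ^ (2 * ?v - ?h) * real N ^ ?h" "p ^ (2 * ?e) = p ^ (2 * ?e - ?k) * p ^ ?k"
      using hv ke by (auto simp: power_add[symmetric])
    then show ?thesis unfolding psi using p \<open>N > 0\<close> by simp
  qed
  also have "\<dots> \<le> real ?v ^ (4 * ?v) * real (card Q) * ((1 - p) * p ^ (2 * ?e - ?k))"
    using NQ p by (intro mult_right_mono) auto
  also have "\<dots> = real ?v ^ (4 * ?v) * (real (card Q) * ((1 - p) * p ^ (2 * ?e - ?k)))" by simp
  also have "\<dots> \<le> real ?v ^ (4 * ?v) *
      measure_pmf.variance (random_subset (all_pairs {..<N}) p) (subset_count ?C edges)"
    by (intro mult_left_mono var) auto
  finally show ?thesis .
qed

section \<open>The number of copies in the random graph\<close>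

lemma norm_exp_minus_1_le:
  fixes z :: complex
  assumes "norm z \<le> 1 / 2"
  shows "norm (exp z - 1) \<le> 2 * norm z"
proof -
  have "norm (exp z - 1) \<le> exp (norm z) * norm z" using Taylor_exp_field[of z 0] by simp
  also have "exp (norm z) \<le> exp (1 / 2)" using assms by simp
  also have "exp (1 / 2 :: real) \<le> 2" using exp_bound[of "1 / 2 :: real"] by (simp add: power2_eq_square)
  finally show ?thesis by (simp add: mult_right_mono)
qed

lemma even_power_powr:
  fixes y :: real
  assumes "y > 0"
  shows "(y ^ (2 * k)) powr (5/2) = y ^ (5 * k)"
proof -
  have "(y ^ (2 * k)) powr (5/2) = (y powr real (2 * k)) powr (5/2)"
    using assms by (simp only: powr_realpow)
  also have "\<dots> = y powr (real (2 * k) * (5/2))" by (rule powr_powr)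
  also have "real (2 * k) * (5/2) = real (5 * k)" by simp
  also have "y powr real (5 * k) = y ^ (5 * k)" using assms by (rule powr_realpow)
  finally show ?thesis .
qed

lemma psi_pos:
  assumes "simple_graph G" "num_edges G \<ge> 1" "N > 0" "0 < p"
  shows "psi G N p > 0"
proof -
  obtain H where "subgraph H G" "num_edges H > 0" "psi G N p = real N ^ num_verts H * p ^ num_edges H"
    using psi_attained[OF assms(1,2)] .
  then show ?thesis using assms(3,4) by simp
qed

text \<open>With radius r = c / N^(v - 2) and degree bound L = v^2 * N^(v - 2), the product of L and
  the perturbation stays at most 1/8; this fixes \<open>c\<close>. In the bound on \<open>K\<close>
  the term \<open>4 * c * 2 ^ d\<close> comes from the logarithm and \<open>c\<close> from the
  centring, since r * N^v = c * N^2.\<close>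

lemma std_count_cgf:
  fixes G :: "'a graph"
  assumes G: "simple_graph G" "num_edges G \<ge> 1" and N: "num_verts G \<le> N" and p: "0 < p" "p < 1"
  defines "v \<equiv> num_verts G" and "d \<equiv> num_edges G"
  defines "c \<equiv> 1 / (16 * real (v\<^sup>2) * 2 ^ d)"
  defines "\<sigma> \<equiv> sqrt (measure_pmf.variance (random_subset (all_pairs {..<N}) p) (subset_count (copies G N) edges))"
  shows "\<sigma> > 0" "\<exists>K. pmf_cgf (map_pmf (std_count G N p) (erdos_renyi N p)) K (c / real N ^ (v - 2) * \<sigma>) \<and>
     (\<forall>z\<in>ball 0 (c / real N ^ (v - 2) * \<sigma>). norm (K z) \<le> (4 * c * 2 ^ d + c) * (real N)\<^sup>2)"
proof -
  let ?E = "all_pairs {..<N}" and ?C = "copies G N"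
  let ?RS = "random_subset ?E p" and ?S = "subset_count ?C edges"
  have finE: "finite ?E" by (simp add: finite_all_pairs)
  have finC: "finite ?C" by (rule finite_copies[OF G(1)])
  have fV: "finite (verts G)" using G by (simp add: simple_graph_def)
  have v: "v \<ge> 2" unfolding v_def by (rule num_verts_ge_2[OF G])
  have Npos: "N > 0" using v N by (simp add: v_def)
  have psi: "psi G N p > 0"
    by (rule psi_pos[OF G Npos p(1)])
  have "0 < (1 - p) * (real N ^ (2 * num_verts G) * p ^ (2 * num_edges G)) / psi G N p"
    using p Npos psi by simp
  also note variance_copies_ge[OF G N p]
  finally have "0 < measure_pmf.variance ?RS ?S"
    using v by (simp add: zero_less_mult_iff v_def)
  then show \<sigma>: "\<sigma> > 0" by (simp add: \<sigma>_def)
  have \<sigma>2: "\<sigma>\<^sup>2 = measure_pmf.variance ?RS ?S"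
    unfolding \<sigma>_def using \<open>0 < measure_pmf.variance ?RS ?S\<close> by simp
  have c: "c > 0" using v by (simp add: c_def)
  define r where "r = c / real N ^ (v - 2)"
  have r: "r > 0" using c Npos by (simp add: r_def)
  have rN: "r * real N ^ (v - 2) = c" using Npos by (simp add: r_def)
  have rle: "r \<le> c"
    unfolding r_def using c Npos by (simp add: divide_le_eq mult_le_cancel_left1)
  have v4: "4 \<le> real (v\<^sup>2)" using v power_mono[of 2 v 2] by (simp only: of_nat_le_iff[symmetric, where 'a = real]) simp
  have c2d: "c * 2 ^ d = 1 / (16 * real (v\<^sup>2))" by (simp add: c_def)
  have c2d_le: "c * 2 ^ d \<le> 1 / 64" unfolding c2d using v4 by (simp add: divide_le_eq)
  have "c * 1 \<le> c * 2 ^ d" using c by (intro mult_left_mono) auto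
  then have c_le: "c \<le> 1 / 64" using c2d_le by simp
  have small: "norm (exp z - 1) * 2 ^ d \<le> 2 * r * 2 ^ d" if "norm z < r" for z :: complex
  proof -
    have "norm (exp z - 1) \<le> 2 * norm z" using that rle c_le by (intro norm_exp_minus_1_le) auto
    then show ?thesis using that by (intro mult_right_mono) auto
  qed
  define L where "L = v\<^sup>2 * N ^ (v - 2)"
  have small1: "norm (exp z - 1) * 2 ^ d < 1 / 2" if "norm z < r" for z :: complex
  proof -
    have "r * 2 ^ d \<le> c * 2 ^ d" using rle by (intro mult_right_mono) auto
    then show ?thesis using small[OF that] c2d_le by linarith
  qed
  have small2: "(1 + norm (exp z - 1) * 2 ^ d) ^ L \<le> 4 / 3" if "norm z < r" for z :: complex
  proof -
    let ?\<eta> = "norm (exp z - 1) * 2 ^ d"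
    have "(1 + ?\<eta>) ^ L \<le> exp ?\<eta> ^ L" by (intro power_mono exp_ge_add_one_self) auto
    also have "\<dots> = exp (real L * ?\<eta>)" by (simp add: exp_of_nat_mult)
    also have "real L * ?\<eta> \<le> real L * (2 * r * 2 ^ d)" by (intro mult_left_mono small that) auto
    also have "\<dots> = 2 * real (v\<^sup>2) * (r * real N ^ (v - 2)) * 2 ^ d" by (simp add: L_def)
    also have "\<dots> = 2 * real (v\<^sup>2) * (c * 2 ^ d)" unfolding rN by simp
    \<comment> \<open>This is where the 16 in \<open>c\<close> is used: exp (1/8) is below
      4/3.\<close>
    also have "\<dots> = 1 / 8" unfolding c2d using v by simp
    also have "exp (1 / 8 :: real) \<le> 4 / 3" using exp_bound[of "1 / 8 :: real"] by (simp add: power2_eq_square)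
    finally show ?thesis by simp
  qed
  have "bounded_family ?E d L ?C edges"
    unfolding L_def v_def d_def by (rule bounded_family_copies[OF G(1)])
  from fam_gf_logarithm[where r = r, OF finE this less_imp_le[OF p(1)] less_imp_le[OF p(2)] small1 small2]
  obtain K where K: "K holomorphic_on ball 0 r"
    "\<And>z. z \<in> ball 0 r \<Longrightarrow> exp (K z) = fam_gf ?E p (exp z - 1) ?C edges"
    "\<And>z. z \<in> ball 0 r \<Longrightarrow> norm (K z) \<le> real (card ?C) * (2 * (norm (exp z - 1) * 2 ^ d))" by auto
  define m where "m = measure_pmf.expectation ?RS ?S"
  have cardC: "real (card ?C) \<le> real N ^ v"
    using card_copies_le[OF G(1), of N] unfolding v_def by (simp only: of_nat_le_iff of_nat_power[symmetric])
  have m: "0 \<le> m" "m \<le> real N ^ v"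
  proof -
    have *: "m = (\<Sum>c\<in>?C. p ^ card (edges c))"
      unfolding m_def using p by (intro expectation_subset_count finE finC) (auto simp: copies_def subgraph_def)
    show "0 \<le> m" unfolding * using p by (intro sum_nonneg) auto
    have "m \<le> (\<Sum>c\<in>?C. 1)" unfolding * using p by (intro sum_mono power_le_one) auto
    then have "m \<le> real (card ?C)" by simp
    then show "m \<le> real N ^ v" using cardC by linarith
  qed
  have er: "measure_pmf.expectation (erdos_renyi N p) f = measure_pmf.expectation ?RS (\<lambda>A. f ({..<N}, A))"
    for f :: "_ \<Rightarrow> 'b :: {banach, second_countable_topology}"
    by (simp add: erdos_renyi_eq)
  have cc: "copy_count G ({..<N}, A) = ?S A" if "A \<subseteq> ?E" for A
    using num_copies_eq[OF that, of G] by (simp add: copy_count_def subset_count_def)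
  have ecc: "measure_pmf.expectation ?RS (\<lambda>A. h (copy_count G ({..<N}, A))) = measure_pmf.expectation ?RS (\<lambda>A. h (?S A))"
    for h :: "real \<Rightarrow> 'b :: {banach, second_countable_topology}"
    by (rule expectation_random_subset_cong) (simp add: cc)
  have mcc: "measure_pmf.expectation (erdos_renyi N p) (copy_count G) = m"
    using ecc[of "\<lambda>s. s"] by (simp add: er m_def)
  have vcc: "measure_pmf.variance (erdos_renyi N p) (copy_count G) = \<sigma>\<^sup>2"
    unfolding mcc unfolding \<sigma>2 er m_def[symmetric] by (rule ecc)
  have sc: "std_count G N p k = (copy_count G k - m) / \<sigma>" for k
    using \<sigma> by (simp add: std_count_def mcc vcc[unfolded mcc])
  have E_std: "measure_pmf.expectation (map_pmf (std_count G N p) (erdos_renyi N p)) h =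
      measure_pmf.expectation ?RS (\<lambda>A. h ((?S A - m) / \<sigma>))" for h :: "real \<Rightarrow> 'b :: {banach, second_countable_topology}"
    unfolding integral_map_pmf er sc by (rule ecc)
  have int: "integrable (measure_pmf ?RS) f" for f :: "_ \<Rightarrow> 'b :: {banach, second_countable_topology}"
    by (simp add: integrable_measure_pmf_finite finite_set_random_subset finE)
  define KW where "KW z = K (z / of_real \<sigma>) - z * of_real (m / \<sigma>)" for z :: complex
  have ball: "z / of_real \<sigma> \<in> ball 0 r" if "z \<in> ball 0 (r * \<sigma>)" for z :: complex
    using that \<sigma> by (simp add: norm_divide divide_less_eq)
  have "pmf_cgf (map_pmf (std_count G N p) (erdos_renyi N p)) KW (r * \<sigma>)"
  proof
    show "finite (set_pmf (map_pmf (std_count G N p) (erdos_renyi N p)))"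
      by (simp add: erdos_renyi_eq finite_set_random_subset finE)
    show "measure_pmf.expectation (map_pmf (std_count G N p) (erdos_renyi N p)) (\<lambda>w. w) = 0"
      unfolding E_std
      by (subst integral_divide_zero, subst Bochner_Integration.integral_diff[OF int int]) (simp add: m_def)
    show "measure_pmf.expectation (map_pmf (std_count G N p) (erdos_renyi N p)) (\<lambda>w. w\<^sup>2) = 1"
      unfolding E_std power_divide integral_divide_zero m_def \<sigma>2[symmetric] using \<sigma> by simp
    show "KW holomorphic_on ball 0 (r * \<sigma>)"
    proof -
      have "(K \<circ> (\<lambda>z. z / of_real \<sigma>)) holomorphic_on ball 0 (r * \<sigma>)"
        using \<sigma> ball by (intro holomorphic_on_compose_gen[OF _ K(1)] holomorphic_intros) auto
      then show ?thesis unfolding KW_def o_def by (intro holomorphic_intros) auto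
    qed
    show "exp (KW z) = measure_pmf.expectation (map_pmf (std_count G N p) (erdos_renyi N p)) (\<lambda>w. exp (z * of_real w))"
      if z: "z \<in> ball 0 (r * \<sigma>)" for z
    proof -
      have "exp (KW z) = exp (K (z / of_real \<sigma>)) * exp (- (z * of_real (m / \<sigma>)))"
        by (simp add: KW_def exp_diff exp_minus field_simps)
      also have "exp (K (z / of_real \<sigma>)) = measure_pmf.expectation ?RS (\<lambda>A. exp (z / of_real \<sigma> * of_real (?S A)))"
        unfolding K(2)[OF ball[OF z]] fam_gf_exp[OF finC] by (simp add: subset_count_def)
      also have "\<dots> * exp (- (z * of_real (m / \<sigma>))) =
         measure_pmf.expectation ?RS (\<lambda>A. exp (z / of_real \<sigma> * of_real (?S A)) * exp (- (z * of_real (m / \<sigma>))))"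
        by simp
      also have "\<dots> = measure_pmf.expectation ?RS (\<lambda>A. exp (z * of_real ((?S A - m) / \<sigma>)))"
        using \<sigma> by (intro Bochner_Integration.integral_cong refl)
          (simp add: exp_add[symmetric] diff_divide_distrib algebra_simps)
      finally show ?thesis unfolding E_std .
    qed
    show "KW 0 = 0" using K(3)[of 0] r by (simp add: KW_def)
    show "r * \<sigma> > 0" using r \<sigma> by simp
  qed
  moreover have "norm (KW z) \<le> (4 * c * 2 ^ d + c) * (real N)\<^sup>2" if z: "z \<in> ball 0 (r * \<sigma>)" for z
  proof -
    have zr: "norm (z / of_real \<sigma>) < r" using ball[OF z] by simp
    have rNv: "r * real N ^ v = c * (real N)\<^sup>2"
    proof -
      have "real N ^ v = real N ^ (v - 2) * (real N)\<^sup>2"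
        using v by (metis le_add_diff_inverse2 power_add)
      then show ?thesis using rN by (simp add: mult.assoc[symmetric])
    qed
    have "norm (K (z / of_real \<sigma>)) \<le> real (card ?C) * (2 * (norm (exp (z / of_real \<sigma>) - 1) * 2 ^ d))"
      by (rule K(3)[OF ball[OF z]])
    also have "\<dots> \<le> real N ^ v * (2 * (2 * r * 2 ^ d))"
      using small[OF zr] cardC r by (intro mult_mono) auto
    also have "\<dots> = 4 * (r * real N ^ v) * 2 ^ d" by simp
    finally have 1: "norm (K (z / of_real \<sigma>)) \<le> 4 * c * 2 ^ d * (real N)\<^sup>2" unfolding rNv by (simp add: mult_ac)
    have "norm (z * of_real (m / \<sigma>)) = norm (z / of_real \<sigma>) * m"
      using m \<sigma> by (simp add: norm_mult norm_divide)
    also have "\<dots> \<le> r * real N ^ v" using zr m r by (intro mult_mono) auto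
    finally have 2: "norm (z * of_real (m / \<sigma>)) \<le> c * (real N)\<^sup>2" unfolding rNv .
    have "norm (KW z) \<le> norm (K (z / of_real \<sigma>)) + norm (z * of_real (m / \<sigma>))"
      unfolding KW_def by (rule norm_triangle_ineq4)
    also have "\<dots> \<le> (4 * c * 2 ^ d + c) * (real N)\<^sup>2" using 1 2 by (simp add: distrib_right)
    finally show ?thesis .
  qed
  ultimately show "\<exists>K. pmf_cgf (map_pmf (std_count G N p) (erdos_renyi N p)) K (c / real N ^ (v - 2) * \<sigma>) \<and>
     (\<forall>z\<in>ball 0 (c / real N ^ (v - 2) * \<sigma>). norm (K z) \<le> (4 * c * 2 ^ d + c) * (real N)\<^sup>2)"
    unfolding r_def by blast
qed

text \<open>The left tail of the count is the right tail of its negative, whose skewness has the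
  opposite sign.\<close>

lemma pmf_cgf_uminus:
  assumes "pmf_cgf P K \<rho>"
  shows "pmf_cgf (map_pmf uminus P) (\<lambda>z. K (- z)) \<rho>"
proof -
  interpret pmf_cgf P K \<rho> by fact
  show ?thesis
  proof
    have "(K \<circ> uminus) holomorphic_on ball 0 \<rho>"
      by (intro holomorphic_on_compose_gen[OF _ hol] holomorphic_intros) auto
    then show "(\<lambda>z. K (- z)) holomorphic_on ball 0 \<rho>" by (simp add: o_def)
    show "exp (K (- z)) = measure_pmf.expectation (map_pmf uminus P) (\<lambda>w. exp (z * of_real w))"
      if "z \<in> ball 0 \<rho>" for z
      using exp_K[of "- z"] that by simp
  qed (use fin mean second K0 \<rho> in auto)
qed

theorem proposition2p3:
  fixes G :: "'a graph" and C0 :: real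
  assumes "simple_graph G"
    and "num_edges G \<ge> 1"
    and "C0 > 0"
  shows "\<exists>C::real. \<forall>(N::nat) (p::real) (x::real).
    N \<ge> num_verts G \<longrightarrow> 0 < p \<longrightarrow> p < 1 \<longrightarrow> 0 \<le> x \<longrightarrow>
    x \<le> C0 * sqrt (real N ^ 6 * (1 - p) powr (5/2) * p ^ (5 * num_edges G)
                    / psi G N p powr (5/2)) \<longrightarrow>
    max
      \<bar>measure_pmf.prob (erdos_renyi N p) {K. std_count G N p K < - x}
         / (Phi (- x) * exp (- (skewness G N p * x ^ 3 / 6))) - 1\<bar>
      \<bar>measure_pmf.prob (erdos_renyi N p) {K. std_count G N p K > x}
         / ((1 - Phi x) * exp (skewness G N p * x ^ 3 / 6)) - 1\<bar>
    \<le> C * psi G N p powr (5/2)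
        / ((1 - p) powr (5/2) * p ^ (5 * num_edges G) * real N ^ 6) * (1 + x\<^sup>2)"
proof -
  note G = assms(1,2)
  define v where "v = num_verts G"
  define d where "d = num_edges G"
  have v: "v \<ge> 2" unfolding v_def by (rule num_verts_ge_2[OF G])
  define c where "c = 1 / (16 * real (v\<^sup>2) * 2 ^ d)"
  define c' where "c' = 4 * c * 2 ^ d + c"
  \<comment> \<open>The reciprocal of the constant in \<open>variance_copies_ge\<close>, so that
    \<open>\<kappa> * t \<le> \<sigma>\<^sup>2\<close> below.\<close>
  define \<kappa> where "\<kappa> = 1 / real v ^ (4 * v)"
  \<comment> \<open>Collects the constants of M^2 / R^5 when \<open>\<sigma>\<close> is replaced by
    its lower bound, so that M^2 / R^5 is at most \<open>B * \<delta>\<close>.\<close>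
  define B where "B = c'\<^sup>2 / (c ^ 5 * \<kappa> powr (5/2))"
  have c: "c > 0" and c': "c' > 0" and \<kappa>: "\<kappa> > 0" using v by (auto simp: c_def c'_def \<kappa>_def add_pos_pos)
  then have B: "B > 0" by (simp add: B_def)
  obtain C where C: "C \<ge> 0"
    "\<And>P K R M \<delta> x. pmf_cgf P K R \<Longrightarrow> (\<And>z. z \<in> ball 0 R \<Longrightarrow> norm (K z) \<le> M) \<Longrightarrow>
       M\<^sup>2 / R ^ 5 \<le> \<delta> \<Longrightarrow> 0 \<le> x \<Longrightarrow> x\<^sup>2 * \<delta> \<le> B * C0\<^sup>2 \<Longrightarrow>
       \<bar>measure_pmf.prob P {w. w > x} /
         ((1 - Phi x) * exp (measure_pmf.expectation P (\<lambda>w. w ^ 3) * x ^ 3 / 6)) - 1\<bar> \<le> C * (\<delta> * (1 + x\<^sup>2))"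
    using moderate_deviation[of "B * C0\<^sup>2"] B by auto
  show ?thesis
  \<comment> \<open>\<open>moderate_deviation\<close> is applied with \<open>B * \<delta>\<close> in
    place of \<open>\<delta>\<close>, hence the product \<open>C * B\<close>; neither factor depends
    on \<open>N\<close>, \<open>p\<close> or \<open>x\<close>.\<close>
  proof (intro exI[of _ "C * B"] allI impI)
    fix N :: nat and p x :: real
    assume N: "N \<ge> num_verts G" and p: "0 < p" "p < 1" and x: "0 \<le> x"
      "x \<le> C0 * sqrt (real N ^ 6 * (1 - p) powr (5/2) * p ^ (5 * num_edges G) / psi G N p powr (5/2))"
    have Npos: "N > 0" using v N by (simp add: v_def)
    have psi: "psi G N p > 0"
      by (rule psi_pos[OF G Npos p(1)])
    define \<delta> where "\<delta> = psi G N p powr (5/2) / ((1 - p) powr (5/2) * p ^ (5 * num_edges G) * real N ^ 6)"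
    have \<delta>: "\<delta> > 0" using p psi Npos by (simp add: \<delta>_def)
    define \<sigma> where "\<sigma> = sqrt (measure_pmf.variance (random_subset (all_pairs {..<N}) p) (subset_count (copies G N) edges))"
    note cgf = std_count_cgf[OF G N p, folded v_def d_def, folded c_def \<sigma>_def, folded c'_def]
    have \<sigma>: "\<sigma> > 0" by (rule cgf(1))
    define R where "R = c / real N ^ (v - 2) * \<sigma>"
    define M where "M = c' * (real N)\<^sup>2"
    let ?P = "map_pmf (std_count G N p) (erdos_renyi N p)"
    obtain K where K: "pmf_cgf ?P K R" "\<And>z. z \<in> ball 0 R \<Longrightarrow> norm (K z) \<le> M"
      using cgf(2) unfolding R_def M_def by blast
    have \<sigma>2: "\<sigma>\<^sup>2 = measure_pmf.variance (random_subset (all_pairs {..<N}) p) (subset_count (copies G N) edges)"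
      using \<sigma> unfolding \<sigma>_def by (simp add: real_sqrt_gt_0_iff)
    define t where "t = (1 - p) * (real N ^ (2 * v) * p ^ (2 * d)) / psi G N p"
    have t: "t > 0" using p Npos psi by (simp add: t_def)
    have "t \<le> real v ^ (4 * v) * \<sigma>\<^sup>2"
      using variance_copies_ge[OF G N p] unfolding \<sigma>2 t_def v_def d_def .
    then have "\<kappa> * t \<le> \<kappa> * (real v ^ (4 * v) * \<sigma>\<^sup>2)" using \<kappa> by (intro mult_left_mono) auto
    also have "\<dots> = \<sigma>\<^sup>2" using v by (simp add: \<kappa>_def)
    finally have "\<kappa> * t \<le> \<sigma>\<^sup>2" .
    then have "(\<kappa> * t) powr (5/2) \<le> \<sigma>\<^sup>2 powr (5/2)" using \<kappa> t by (intro powr_mono2) auto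
    also have "\<sigma>\<^sup>2 powr (5/2) = \<sigma> ^ 5"
      using even_power_powr[OF \<sigma>, of 1] by simp
    finally have \<sigma>5: "(\<kappa> * t) powr (5/2) \<le> \<sigma> ^ 5" .
    have tp: "(\<kappa> * t) powr (5/2) = \<kappa> powr (5/2) * ((1 - p) powr (5/2) * (real N ^ (5 * v) * p ^ (5 * d)) / psi G N p powr (5/2))"
      unfolding t_def using \<kappa> p Npos psi by (simp add: powr_mult powr_divide even_power_powr)
    \<comment> \<open>N^4 from M^2 against the N^10 left over here gives the N^6 of the error
      term.\<close>
    have N5: "real N ^ (5 * v) = (real N ^ (v - 2)) ^ 5 * real N ^ 10"
    proof -
      have "5 * v = (v - 2) * 5 + 10" using v by simp
      then show ?thesis by (simp only: power_mult[symmetric] power_add[symmetric])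
    qed
    have "M\<^sup>2 / R ^ 5 = c'\<^sup>2 * real N ^ 4 * (real N ^ (v - 2)) ^ 5 / (c ^ 5 * \<sigma> ^ 5)"
      using Npos c \<sigma> by (simp add: M_def R_def power_mult_distrib power_divide)
    also have "\<dots> \<le> c'\<^sup>2 * real N ^ 4 * (real N ^ (v - 2)) ^ 5 / (c ^ 5 * (\<kappa> * t) powr (5/2))"
      using \<sigma>5 c \<sigma> \<kappa> t by (intro divide_left_mono mult_left_mono mult_pos_pos) auto
    also have "\<dots> = B * \<delta>"
      unfolding tp N5 B_def \<delta>_def d_def[symmetric] using Npos c \<kappa> p psi
      by (simp add: field_simps eval_nat_numeral)
    finally have MR: "M\<^sup>2 / R ^ 5 \<le> B * \<delta>" .
    \<comment> \<open>The range of \<open>x\<close> amounts to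
      \<open>x\<^sup>2 * \<delta> \<le> C0\<^sup>2\<close>, which is why \<open>D\<close> was taken
      as \<open>B * C0\<^sup>2\<close>.\<close>
    have "x \<le> C0 * sqrt (1 / \<delta>)" using x(2) by (simp add: \<delta>_def mult_ac)
    then have "x\<^sup>2 \<le> (C0 * sqrt (1 / \<delta>))\<^sup>2" using x by (intro power_mono) auto
    also have "\<dots> = C0\<^sup>2 / \<delta>" using \<delta> by (simp add: power_mult_distrib)
    finally have "x\<^sup>2 * \<delta> \<le> C0\<^sup>2" using \<delta> by (simp add: field_simps)
    then have xB: "x\<^sup>2 * (B * \<delta>) \<le> B * C0\<^sup>2" using B by (simp add: mult_ac)
    have skew: "measure_pmf.expectation ?P (\<lambda>w. w ^ 3) = skewness G N p" by (simp add: skewness_def)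
    have "\<bar>measure_pmf.prob ?P {w. w > x} / ((1 - Phi x) * exp (skewness G N p * x ^ 3 / 6)) - 1\<bar>
        \<le> C * (B * \<delta> * (1 + x\<^sup>2))"
      using C(2)[OF K MR x(1) xB] unfolding skew .
    then have right: "\<bar>measure_pmf.prob (erdos_renyi N p) {K. std_count G N p K > x} /
        ((1 - Phi x) * exp (skewness G N p * x ^ 3 / 6)) - 1\<bar> \<le> C * (B * \<delta> * (1 + x\<^sup>2))"
      by (simp add: vimage_def)
    have "\<bar>measure_pmf.prob (map_pmf uminus ?P) {w. w > x} / ((1 - Phi x) * exp (- skewness G N p * x ^ 3 / 6)) - 1\<bar>
        \<le> C * (B * \<delta> * (1 + x\<^sup>2))"
      using C(2)[OF pmf_cgf_uminus[OF K(1)] _ MR x(1) xB] K(2) by (simp add: skewness_def)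
    then have left: "\<bar>measure_pmf.prob (erdos_renyi N p) {K. std_count G N p K < - x} /
        (Phi (- x) * exp (- (skewness G N p * x ^ 3 / 6))) - 1\<bar> \<le> C * (B * \<delta> * (1 + x\<^sup>2))"
      by (simp add: vimage_def Phi_minus less_minus_iff)
    have "C * (B * \<delta> * (1 + x\<^sup>2)) = C * B * psi G N p powr (5/2)
        / ((1 - p) powr (5/2) * p ^ (5 * num_edges G) * real N ^ 6) * (1 + x\<^sup>2)"
      by (simp add: \<delta>_def)
    then show "max
      \<bar>measure_pmf.prob (erdos_renyi N p) {K. std_count G N p K < - x}
         / (Phi (- x) * exp (- (skewness G N p * x ^ 3 / 6))) - 1\<bar>
      \<bar>measure_pmf.prob (erdos_renyi N p) {K. std_count G N p K > x}
         / ((1 - Phi x) * exp (skewness G N p * x ^ 3 / 6)) - 1\<bar>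
    \<le> C * B * psi G N p powr (5/2)
        / ((1 - p) powr (5/2) * p ^ (5 * num_edges G) * real N ^ 6) * (1 + x\<^sup>2)"
      using left right by (metis max.bounded_iff)
  qed
qed

end
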